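(* There exist two symbols $\phi, \psi\colon\mathbb{D}\to\mathbb{D}$ of same modulus $|\phi^\ast| = |\psi^\ast|$ a.e. on $\mathbb{T}$ such that $C_\phi$ is compact on $H^2$, but in no Schatten class $S_p$ for $0 < p < \infty$, whereas $C_\psi \colon H^2\to H^2$ is in $S_p$ for every $p > 2$.
   Context: $\mathbb{D}$ is the open unit disc of $\mathbb{C}$, $\mathbb{T} = \partial\mathbb{D}$ its boundary, and $H^2$ the Hardy space on $\mathbb{D}$. A symbol is an analytic self-map $\phi$ of $\mathbb{D}$ whose radial boundary value function $\phi^\ast$ (defined a.e. on $\mathbb{T}$) satisfies $|\phi^\ast|<1$ a.e. on $\mathbb{T}$ (this condition is automatic when $C_\phi$ is compact). $C_\phi\colon H^2\to H^2$, $C_\phi(f) = f\circ\phi$, is the (bounded) composition operator. For $p>0$, $S_p$ is the Schatten class of operators on $H^2$, i.e. the compact operators whose sequence of singular numbers is in $\ell^p$. *)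

theory Defs
  imports "HOL-Complex_Analysis.Complex_Analysis"
begin

section \<open>The Hardy space\<close>

definition taylor_coeff :: "(complex \<Rightarrow> complex) \<Rightarrow> nat \<Rightarrow> complex" where
  "taylor_coeff f n = (deriv ^^ n) f 0 / fact n"

text \<open>
  Functions in the Hardy space are extended by \<open>0\<close> outside of the unit disc, so that
  equality in the type is equality on the disc.
\<close>

definition hardy_space :: "(complex \<Rightarrow> complex) set" where
  "hardy_space = {f. f holomorphic_on ball 0 1 \<and> (\<forall>z. z \<notin> ball 0 1 \<longrightarrow> f z = 0) \<and>
                     summable (\<lambda>n. (cmod (taylor_coeff f n))\<^sup>2)}"

lemma taylor_coeff_zero [simp]: "taylor_coeff (\<lambda>_. 0) n = 0"
proof -
  have "(deriv ^^ n) (\<lambda>_::complex. 0::complex) = (\<lambda>_. 0)"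
    by (induction n) auto
  then show ?thesis
    by (simp add: taylor_coeff_def)
qed

lemma taylor_coeff_add:
  assumes "f holomorphic_on ball 0 1" "g holomorphic_on ball 0 1"
  shows "taylor_coeff (\<lambda>z. f z + g z) n = taylor_coeff f n + taylor_coeff g n"
  using higher_deriv_add[OF assms open_ball, of 0 n]
  by (simp add: taylor_coeff_def add_divide_distrib)

lemma taylor_coeff_cmult:
  assumes "f holomorphic_on ball 0 1"
  shows "taylor_coeff (\<lambda>z. c * f z) n = c * taylor_coeff f n"
  using higher_deriv_cmult[OF assms _ open_ball, of 0 n c]
  by (simp add: taylor_coeff_def)

lemma hardy_space_zero: "(\<lambda>_. 0) \<in> hardy_space"
  by (simp add: hardy_space_def)

lemma hardy_space_cmult: "f \<in> hardy_space \<Longrightarrow> (\<lambda>z. c * f z) \<in> hardy_space"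
  by (auto simp: hardy_space_def taylor_coeff_cmult norm_mult power_mult_distrib
      intro!: holomorphic_intros summable_mult)

lemma hardy_space_add:
  assumes "f \<in> hardy_space" "g \<in> hardy_space"
  shows "(\<lambda>z. f z + g z) \<in> hardy_space"
proof -
  let ?a = "taylor_coeff f" and ?b = "taylor_coeff g"
  have le: "(cmod (?a n + ?b n))\<^sup>2 \<le> 2 * (cmod (?a n))\<^sup>2 + 2 * (cmod (?b n))\<^sup>2" for n
  proof -
    have "(cmod (?a n + ?b n))\<^sup>2 \<le> (cmod (?a n) + cmod (?b n))\<^sup>2"
      by (intro power_mono norm_triangle_ineq) auto
    then show ?thesis
      using sum_squares_bound[of "cmod (?a n)" "cmod (?b n)"] by (simp add: power2_sum)
  qed
  have "summable (\<lambda>n. 2 * (cmod (?a n))\<^sup>2 + 2 * (cmod (?b n))\<^sup>2)"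
    using assms by (intro summable_add summable_mult) (auto simp: hardy_space_def)
  then have "summable (\<lambda>n. (cmod (?a n + ?b n))\<^sup>2)"
    by (rule summable_comparison_test') (simp add: le)
  then show ?thesis
    using assms by (auto simp: hardy_space_def taylor_coeff_add intro!: holomorphic_intros)
qed

typedef hardy2 = hardy_space
  using hardy_space_zero by blast

setup_lifting type_definition_hardy2

instantiation hardy2 :: ab_group_add
begin
lift_definition zero_hardy2 :: hardy2 is "\<lambda>_. 0"
  by (rule hardy_space_zero)
lift_definition plus_hardy2 :: "hardy2 \<Rightarrow> hardy2 \<Rightarrow> hardy2" is "\<lambda>f g z. f z + g z"
  by (rule hardy_space_add)
lift_definition uminus_hardy2 :: "hardy2 \<Rightarrow> hardy2" is "\<lambda>f z. - f z"
  using hardy_space_cmult[of _ "-1"] by simp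
definition minus_hardy2 :: "hardy2 \<Rightarrow> hardy2 \<Rightarrow> hardy2" where
  "minus_hardy2 f g = f + (- g)"
instance
  by standard (simp_all add: minus_hardy2_def, (transfer, simp add: fun_eq_iff add_ac)+)
end

lift_definition cscale :: "complex \<Rightarrow> hardy2 \<Rightarrow> hardy2" is "\<lambda>c f z. c * f z"
  by (rule hardy_space_cmult)

global_interpretation hardy2: vector_space cscale
  defines hardy2_dim = hardy2.dim
  by standard (transfer, simp add: fun_eq_iff algebra_simps)+

lift_definition hcoeff :: "hardy2 \<Rightarrow> nat \<Rightarrow> complex" is taylor_coeff .

definition cinner :: "hardy2 \<Rightarrow> hardy2 \<Rightarrow> complex" where
  "cinner f g = (\<Sum>n. hcoeff f n * cnj (hcoeff g n))"

lemma hcoeff_add [simp]: "hcoeff (f + g) n = hcoeff f n + hcoeff g n"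
  by transfer (simp add: hardy_space_def taylor_coeff_add)

lemma hcoeff_cscale [simp]: "hcoeff (cscale c f) n = c * hcoeff f n"
  by transfer (simp add: hardy_space_def taylor_coeff_cmult)

lemma summable_hcoeff: "summable (\<lambda>n. (cmod (hcoeff f n))\<^sup>2)"
  by transfer (simp add: hardy_space_def)

lemma summable_cinner: "summable (\<lambda>n. hcoeff f n * cnj (hcoeff g n))"
proof (rule summable_comparison_test')
  show "summable (\<lambda>n. (cmod (hcoeff f n))\<^sup>2 + (cmod (hcoeff g n))\<^sup>2)"
    by (intro summable_add summable_hcoeff)
  show "norm (hcoeff f n * cnj (hcoeff g n)) \<le> (cmod (hcoeff f n))\<^sup>2 + (cmod (hcoeff g n))\<^sup>2" for n
    using sum_squares_bound[of "cmod (hcoeff f n)" "cmod (hcoeff g n)"]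
      mult_nonneg_nonneg[OF norm_ge_zero[of "hcoeff f n"] norm_ge_zero[of "hcoeff g n"]]
    unfolding norm_mult complex_mod_cnj by linarith
qed

lemma cinner_add_left: "cinner (f + g) h = cinner f h + cinner g h"
  using suminf_add[OF summable_cinner[of f h] summable_cinner[of g h]]
  by (simp add: cinner_def distrib_right)

lemma cinner_cscale_left: "cinner (cscale c f) h = c * cinner f h"
  using suminf_mult[OF summable_cinner[of f h], of c]
  by (simp add: cinner_def mult.assoc)

lemma cinner_commute: "cinner f g = cnj (cinner g f)"
proof -
  have "(\<lambda>n. cnj (hcoeff g n * cnj (hcoeff f n))) sums cnj (cinner g f)"
    unfolding cinner_def sums_cnj by (rule summable_sums[OF summable_cinner])
  then have "(\<lambda>n. hcoeff f n * cnj (hcoeff g n)) sums cnj (cinner g f)"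
    by (simp add: mult.commute)
  then show ?thesis
    unfolding cinner_def[of f g] by (rule sums_unique[symmetric])
qed

lemma cinner_same: "cinner f f = of_real (\<Sum>n. (cmod (hcoeff f n))\<^sup>2)"
  unfolding cinner_def complex_norm_square[symmetric]
  using suminf_of_real[OF summable_hcoeff[of f], where ?'a = complex] by simp

lemma hardy2_eq_0_iff: "f = 0 \<longleftrightarrow> (\<forall>n. hcoeff f n = 0)"
proof
  assume "\<forall>n. hcoeff f n = 0"
  then show "f = 0"
  proof (transfer, intro ext)
    fix f :: "complex \<Rightarrow> complex" and z
    assume f: "f \<in> hardy_space" and 0: "\<forall>n. taylor_coeff f n = 0"
    show "f z = 0"
    proof (cases "z \<in> ball 0 1")
      case True
      have "(\<lambda>n. (deriv ^^ n) f 0 / fact n * (z - 0) ^ n) sums f z"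
        using f True by (intro holomorphic_power_series[of f 0 1]) (auto simp: hardy_space_def)
      then have "(\<lambda>n. 0) sums f z"
        using 0 by (simp add: taylor_coeff_def)
      then show ?thesis
        using sums_unique2 sums_zero by blast
    qed (use f in \<open>auto simp: hardy_space_def\<close>)
  qed
qed (transfer, simp)

text \<open>
  The real inner product is the real part of the complex one, so both induce the same norm.
\<close>

instantiation hardy2 :: real_inner
begin
definition scaleR_hardy2 :: "real \<Rightarrow> hardy2 \<Rightarrow> hardy2" where
  "scaleR_hardy2 r f = cscale (of_real r) f"
definition inner_hardy2 :: "hardy2 \<Rightarrow> hardy2 \<Rightarrow> real" where
  "inner_hardy2 f g = Re (cinner f g)"
definition norm_hardy2 :: "hardy2 \<Rightarrow> real" where
  "norm_hardy2 f = sqrt (inner f f)"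
definition dist_hardy2 :: "hardy2 \<Rightarrow> hardy2 \<Rightarrow> real" where
  "dist_hardy2 f g = norm (f - g)"
definition sgn_hardy2 :: "hardy2 \<Rightarrow> hardy2" where
  "sgn_hardy2 f = inverse (norm f) *\<^sub>R f"
definition uniformity_hardy2 :: "(hardy2 \<times> hardy2) filter" where
  "uniformity_hardy2 = (INF e\<in>{0<..}. principal {(f, g). dist f g < e})"
definition open_hardy2 :: "hardy2 set \<Rightarrow> bool" where
  "open_hardy2 U \<longleftrightarrow> (\<forall>f\<in>U. eventually (\<lambda>(f', g). f' = f \<longrightarrow> g \<in> U) uniformity)"
instance
proof
  fix f g h :: hardy2 and r s :: real
  show "r *\<^sub>R (f + g) = r *\<^sub>R f + r *\<^sub>R g" "(r + s) *\<^sub>R f = r *\<^sub>R f + s *\<^sub>R f"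
    "r *\<^sub>R s *\<^sub>R f = (r * s) *\<^sub>R f" "1 *\<^sub>R f = f"
    by (simp_all add: scaleR_hardy2_def hardy2.scale_right_distrib hardy2.scale_left_distrib)
  show "inner f g = inner g f"
    using cinner_commute[of f g] by (simp add: inner_hardy2_def)
  show "inner (f + g) h = inner f h + inner g h"
    by (simp add: inner_hardy2_def cinner_add_left)
  show "inner (r *\<^sub>R f) g = r * inner f g"
    by (simp add: inner_hardy2_def scaleR_hardy2_def cinner_cscale_left)
  show "0 \<le> inner f f"
    by (simp add: inner_hardy2_def cinner_same suminf_nonneg[OF summable_hcoeff])
  show "inner f f = 0 \<longleftrightarrow> f = 0"
    by (simp add: inner_hardy2_def cinner_same hardy2_eq_0_iff
        suminf_eq_zero_iff[OF summable_hcoeff])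
qed (simp_all add: norm_hardy2_def dist_hardy2_def sgn_hardy2_def uniformity_hardy2_def
    open_hardy2_def)
end

section \<open>Schatten classes\<close>

definition compact_operator :: "(hardy2 \<Rightarrow> hardy2) \<Rightarrow> bool" where
  "compact_operator T \<longleftrightarrow>
     Vector_Spaces.linear cscale cscale T \<and> compact (closure (T ` cball 0 1))"

definition hilbert_adjoint :: "(hardy2 \<Rightarrow> hardy2) \<Rightarrow> hardy2 \<Rightarrow> hardy2" where
  "hilbert_adjoint T = (THE S. \<forall>f g. cinner (T f) g = cinner f (S g))"

definition eigenspace :: "(hardy2 \<Rightarrow> hardy2) \<Rightarrow> complex \<Rightarrow> hardy2 set" where
  "eigenspace T c = {f. T f = cscale c f}"

text \<open>
  The singular numbers of a compact operator \<open>T\<close> are the square roots of the eigenvalues of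
  \<open>T\<^sup>*T\<close>, listed in nonincreasing order and repeated according to multiplicity; if \<open>T\<close> has finite
  rank, the list is continued by zeros. The finiteness condition is needed since the cardinality of
  an infinite set is \<open>0\<close>. For compact \<open>T\<close> the eigenspaces below are finite-dimensional, so that the
  sequence exists and is unique.
\<close>

definition is_singular_numbers :: "(hardy2 \<Rightarrow> hardy2) \<Rightarrow> (nat \<Rightarrow> real) \<Rightarrow> bool" where
  "is_singular_numbers T s \<longleftrightarrow> decseq s \<and> (\<forall>n. 0 \<le> s n) \<and>
     (\<forall>\<sigma>>0. finite {n. s n = \<sigma>} \<and>
        card {n. s n = \<sigma>} = hardy2_dim (eigenspace (hilbert_adjoint T \<circ> T) (of_real (\<sigma>\<^sup>2))))"

definition singular_numbers :: "(hardy2 \<Rightarrow> hardy2) \<Rightarrow> nat \<Rightarrow> real" where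
  "singular_numbers T = (THE s. is_singular_numbers T s)"

definition schatten_class :: "real \<Rightarrow> (hardy2 \<Rightarrow> hardy2) set" where
  "schatten_class p = {T. compact_operator T \<and> summable (\<lambda>n. singular_numbers T n powr p)}"

section \<open>Symbols and composition operators\<close>

text \<open>By Fatou's theorem, the limit exists for almost all \<open>\<zeta>\<close> on the unit circle if \<open>\<phi>\<close> is a
  bounded analytic function.\<close>

definition radial_limit :: "(complex \<Rightarrow> complex) \<Rightarrow> complex \<Rightarrow> complex" where
  "radial_limit \<phi> \<zeta> = Lim (at_left (1::real)) (\<lambda>r. \<phi> (of_real r * \<zeta>))"

definition ae_circle :: "(complex \<Rightarrow> bool) \<Rightarrow> bool" where
  "ae_circle P \<longleftrightarrow> (AE t in lebesgue_on {0..2 * pi}. P (cis t))"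

definition symbol :: "(complex \<Rightarrow> complex) \<Rightarrow> bool" where
  "symbol \<phi> \<longleftrightarrow> \<phi> holomorphic_on ball 0 1 \<and> \<phi> ` ball 0 1 \<subseteq> ball 0 1 \<and>
     ae_circle (\<lambda>\<zeta>. cmod (radial_limit \<phi> \<zeta>) < 1)"

text \<open>By Littlewood's subordination principle, the function below is in the Hardy space whenever
  \<open>\<phi>\<close> is an analytic self-map of the disc.\<close>

definition composition_operator :: "(complex \<Rightarrow> complex) \<Rightarrow> hardy2 \<Rightarrow> hardy2" where
  "composition_operator \<phi> f =
     Abs_hardy2 (\<lambda>z. if z \<in> ball 0 1 then Rep_hardy2 f (\<phi> z) else 0)"

end

theory Submission
  imports Defs "HOL-Real_Asymp.Real_Asymp"
begin

text \<open>
  With \<open>s = (1 - z) / (1 + z)\<close> the symbols are \<open>\<phi> = exp (- F(s))\<close> and \<open>\<psi> = \<phi> exp (- 1 / s)\<close>, where \<open>F\<close> maps the right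
  half plane into itself; the second factor of \<open>\<psi>\<close> is inner, so the moduli agree on the circle. Near \<open>1\<close>
  the function \<open>F\<close> behaves like \<open>s \<Lambda>(s)\<close>, where \<open>\<Lambda>\<close> is of order \<open>(log log (1 / \<bar>s\<bar>))\<^sup>2\<close>. Hence the boundary curve of \<open>\<phi>\<close>
  passes \<open>1\<close> along the circle, and spends a time of order \<open>h / \<Lambda>(h)\<close> within distance \<open>h\<close> of \<open>1\<close>. As \<open>\<Lambda>(h)\<close> tends to
  infinity, a Schur test makes \<open>C\<^sub>\<phi>\<close> compact; testing \<open>C\<^sub>\<phi>\<close> on normalised dyadic blocks of monomials shows that it is
  in no Schatten class, as no power of \<open>1 / \<Lambda>(2\<^sup>-\<^sup>m)\<close> is summable over \<open>m\<close>. The inner factor spreads the boundary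
  values of \<open>\<psi>\<close> evenly over all directions, so that the norm of \<open>C\<^sub>\<psi>\<close> on \<open>z\<^sup>N H\<^sup>2\<close> is \<open>O(N\<^sup>-\<^sup>\<gamma>\<^sup>/\<^sup>2)\<close> for every \<open>\<gamma> < 1\<close>; this
  norm dominates the \<open>N\<close>-th singular number.
\<close>

section \<open>The Hilbert space structure\<close>


text \<open>The growth of \<open>slope\<close> is squeezed from two sides. At distance 2^-k from 1
  the modulus of the first symbol is only bounded below by a multiple of 2^-k / k, so the
  singularity of 1 / (modulus + difference of arguments) costs a factor ln k in the Schur test.
  Hence \<open>slope\<close> has to outgrow ln k, while every fixed power of \<open>slope m\<close>
  has to stay below m; (ln m)^2 satisfies both. For the second symbol the same loss is absorbed by a
  small power \<open>\<delta>\<close>: the kernel is interpolated between its bound by the modulus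
  and its bound by the argument, and this is why only exponents \<open>\<gamma>\<close> < 1, and so
  only p > 2, are reached. Singular numbers are defined by multiplicities of eigenvalues of T*T, so
  the spectral theorem is built first, by successive maximisation of the norm of T. Composition
  operators are reached through polynomials in the boundary function; their boundedness is the case
  N = 0 of the estimates that later give compactness and decay.\<close>

lemma cinner_add_right: "cinner f (g + h) = cinner f g + cinner f h"
  by (metis cinner_add_left cinner_commute complex_cnj_add)

lemma cinner_cscale_right: "cinner f (cscale c g) = cnj c * cinner f g"
  by (metis cinner_commute cinner_cscale_left complex_cnj_mult)

lemma cinner_zero_left [simp]: "cinner 0 f = 0"
  using cinner_add_left[of 0 0 f] by simp

lemma cinner_zero_right [simp]: "cinner f 0 = 0"
  using cinner_add_right[of f 0 0] by simp

lemma cinner_diff_left: "cinner (f - g) h = cinner f h - cinner g h"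
  using cinner_add_left[of "f - g" g h] by simp

lemma cinner_diff_right: "cinner h (f - g) = cinner h f - cinner h g"
  using cinner_add_right[of h "f - g" g] by simp

lemma cinner_sum_left: "cinner (\<Sum>i\<in>A. f i) g = (\<Sum>i\<in>A. cinner (f i) g)"
  by (induction A rule: infinite_finite_induct) (auto simp: cinner_add_left)

lemma cinner_sum_right: "cinner g (\<Sum>i\<in>A. f i) = (\<Sum>i\<in>A. cinner g (f i))"
  by (induction A rule: infinite_finite_induct) (auto simp: cinner_add_right)

lemma hardy2_norm_sq: "(norm f)\<^sup>2 = (\<Sum>n. (cmod (hcoeff f n))\<^sup>2)"
proof -
  have "(norm f)\<^sup>2 = inner f f"
    by (simp add: power2_norm_eq_inner)
  also have "\<dots> = (\<Sum>n. (cmod (hcoeff f n))\<^sup>2)"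
    by (simp add: inner_hardy2_def cinner_same)
  finally show ?thesis .
qed

lemma cinner_self: "cinner f f = of_real ((norm f)\<^sup>2)"
  by (simp add: cinner_same hardy2_norm_sq)

lemma norm_sq_Re_cinner: "(norm f)\<^sup>2 = Re (cinner f f)"
  by (simp add: cinner_self)

lemma norm_cscale [simp]: "norm (cscale c f) = cmod c * norm f"
proof -
  have "cnj c * (c * of_real ((norm f)\<^sup>2)) = of_real ((cmod c)\<^sup>2 * (norm f)\<^sup>2)"
    unfolding of_real_mult complex_norm_square by (simp only: mult.assoc mult.left_commute)
  then have "(norm (cscale c f))\<^sup>2 = (cmod c)\<^sup>2 * (norm f)\<^sup>2"
    by (subst norm_sq_Re_cinner)
       (simp only: cinner_cscale_left cinner_cscale_right cinner_self[of f] Re_complex_of_real)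
  then have "(norm (cscale c f))\<^sup>2 = (cmod c * norm f)\<^sup>2"
    by (simp only: power_mult_distrib)
  then show ?thesis
    by (rule power2_eq_imp_eq) auto
qed

text \<open>A unimodular factor \<open>u\<close> makes the complex product real and nonnegative,
  which reduces the claim to the real inner product.\<close>

lemma cinner_Cauchy_Schwarz: "cmod (cinner f g) \<le> norm f * norm g"
proof (cases "cinner f g = 0")
  case False
  define u where "u = cnj (cinner f g) / of_real (cmod (cinner f g))"
  have u: "cmod u = 1"
    using False by (simp add: u_def norm_divide)
  have "u * cinner f g = of_real ((cmod (cinner f g))\<^sup>2) / of_real (cmod (cinner f g))"
    unfolding u_def complex_norm_square by (simp add: mult.commute)
  also have "\<dots> = of_real (cmod (cinner f g))"
    by (simp add: power2_eq_square)
  finally have "cmod (cinner f g) = inner (cscale u f) g"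
    by (simp add: inner_hardy2_def cinner_cscale_left)
  also have "\<dots> \<le> norm (cscale u f) * norm g"
    by (rule norm_cauchy_schwarz)
  finally show ?thesis
    using u by simp
qed auto

lemma norm_add_sq: "(norm (f + g))\<^sup>2 = (norm f)\<^sup>2 + 2 * Re (cinner f g) + (norm g)\<^sup>2"
  using cinner_commute[of g f]
  by (simp add: norm_sq_Re_cinner cinner_add_left cinner_add_right)

lemma norm_add_sq_orthogonal: "cinner f g = 0 \<Longrightarrow> (norm (f + g))\<^sup>2 = (norm f)\<^sup>2 + (norm g)\<^sup>2"
  by (simp add: norm_add_sq)

lemma hardy2_parallelogram:
  fixes f g :: hardy2
  shows "(norm (f + g))\<^sup>2 + (norm (f - g))\<^sup>2 = 2 * (norm f)\<^sup>2 + 2 * (norm g)\<^sup>2"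
  by (simp add: power2_norm_eq_inner inner_add inner_diff inner_commute)

lemma hcoeff_zero [simp]: "hcoeff 0 n = 0"
  using hardy2_eq_0_iff by blast

lemma hcoeff_minus [simp]: "hcoeff (- f) n = - hcoeff f n"
  using hcoeff_add[of f "- f" n] by (simp add: eq_neg_iff_add_eq_0 add.commute del: hcoeff_add)

lemma hcoeff_diff [simp]: "hcoeff (f - g) n = hcoeff f n - hcoeff g n"
  using hcoeff_add[of f "- g" n] by (simp del: hcoeff_add)

lemma hcoeff_sum [simp]: "hcoeff (\<Sum>i\<in>A. f i) n = (\<Sum>i\<in>A. hcoeff (f i) n)"
  by (induction A rule: infinite_finite_induct) auto

lemma hardy2_eqI: "(\<And>n. hcoeff f n = hcoeff g n) \<Longrightarrow> f = g"
  using hardy2_eq_0_iff[of "f - g"] by simp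

lemma norm_hcoeff_le: "cmod (hcoeff f n) \<le> norm f"
proof -
  have "(\<Sum>k\<in>{n}. (cmod (hcoeff f k))\<^sup>2) \<le> (norm f)\<^sup>2"
    unfolding hardy2_norm_sq by (rule sum_le_suminf[OF summable_hcoeff]) auto
  then show ?thesis
    by (simp add: power2_le_iff_abs_le)
qed

subsection \<open>Completeness and point evaluation\<close>

lemma square_summable_imp_power_series_summable:
  fixes a :: "nat \<Rightarrow> complex"
  assumes "summable (\<lambda>n. (cmod (a n))\<^sup>2)" "cmod z < 1"
  shows "summable (\<lambda>n. norm (a n * z ^ n))"
proof (rule summable_comparison_test')
  have "summable (\<lambda>n. (cmod z ^ 2) ^ n)"
    using assms(2) by (intro summable_geometric) (simp add: power_less_one_iff abs_square_less_1)
  then show "summable (\<lambda>n. (cmod (a n))\<^sup>2 + (cmod z ^ n)\<^sup>2)"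
    using assms(1) by (intro summable_add) (simp_all add: power_mult[symmetric] mult.commute)
  show "norm (norm (a n * z ^ n)) \<le> (cmod (a n))\<^sup>2 + (cmod z ^ n)\<^sup>2" for n
    using sum_squares_bound[of "cmod (a n)" "cmod z ^ n"]
      mult_nonneg_nonneg[OF norm_ge_zero[of "a n"] zero_le_power[OF norm_ge_zero[of z], of n]]
    unfolding norm_mult norm_power real_norm_def abs_mult abs_norm_cancel power_abs by linarith
qed

text \<open>The Riesz-Fischer direction. Limits of Cauchy sequences, monomials and values of the
  adjoint are all produced from their coefficients in this way.\<close>

lemma square_summable_hardy2:
  fixes a :: "nat \<Rightarrow> complex"
  assumes a: "summable (\<lambda>n. (cmod (a n))\<^sup>2)"
  shows "\<exists>f. \<forall>n. hcoeff f n = a n"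
proof -
  define f where "f = (\<lambda>z. if z \<in> ball 0 1 then \<Sum>n. a n * z ^ n else 0)"
  have sums: "(\<lambda>n. a n * (z - 0) ^ n) sums f z" if "z \<in> ball 0 1" for z
    using square_summable_imp_power_series_summable[OF a, of z] that
    by (auto simp: f_def intro: summable_sums summable_norm_cancel)
  have holo: "f holomorphic_on ball 0 1"
    by (rule power_series_holomorphic[OF sums])
  have coeff: "taylor_coeff f n = a n" for n
  proof -
    have "((\<lambda>z. \<Sum>n. a n * z ^ n) has_fps_expansion Abs_fps a)"
    proof (rule has_fps_expansionI)
      show "\<forall>\<^sub>F u in nhds 0. (\<lambda>n. fps_nth (Abs_fps a) n * u ^ n) sums (\<Sum>n. a n * u ^ n)"
      proof -
        have "\<forall>\<^sub>F u in nhds (0::complex). u \<in> ball 0 1"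
          by (intro eventually_nhds_in_open) auto
        then show ?thesis
          by eventually_elim
            (use square_summable_imp_power_series_summable[OF a] in \<open>auto intro!: summable_sums intro: summable_norm_cancel\<close>)
      qed
    qed
    moreover have "\<forall>\<^sub>F z in nhds 0. (\<Sum>n. a n * z ^ n) = f z"
    proof -
      have "\<forall>\<^sub>F u in nhds (0::complex). u \<in> ball 0 1"
        by (intro eventually_nhds_in_open) auto
      then show ?thesis
        by eventually_elim (auto simp: f_def)
    qed
    ultimately have "f has_fps_expansion Abs_fps a"
      using has_fps_expansion_cong[of "\<lambda>z. \<Sum>n. a n * z ^ n" f] by simp
    from fps_nth_fps_expansion[OF this, of n] show ?thesis
      by (simp add: taylor_coeff_def)
  qed
  have "f \<in> hardy_space"
    using holo a unfolding hardy_space_def mem_Collect_eq coeff by (auto simp: f_def)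
  then have "hcoeff (Abs_hardy2 f) n = a n" for n
    by (simp add: hcoeff.rep_eq Abs_hardy2_inverse coeff)
  then show ?thesis
    by blast
qed

lemma hardy2_eval_sums:
  assumes "cmod z < 1"
  shows "(\<lambda>n. hcoeff f n * z ^ n) sums Rep_hardy2 f z"
proof -
  have "Rep_hardy2 f holomorphic_on ball 0 1"
    using Rep_hardy2[of f] by (simp add: hardy_space_def)
  from holomorphic_power_series[OF this, of z] show ?thesis
    using assms by (simp add: hcoeff.rep_eq taylor_coeff_def)
qed

lemma norm_le_of_partial_sums:
  assumes "\<And>n. (\<Sum>k<n. (cmod (hcoeff f k))\<^sup>2) \<le> B\<^sup>2" "0 \<le> B"
  shows "norm f \<le> B"
proof -
  have "(norm f)\<^sup>2 \<le> B\<^sup>2"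
    unfolding hardy2_norm_sq using assms by (intro suminf_le_const[OF summable_hcoeff]) auto
  then show ?thesis
    using assms(2) power2_le_imp_le by blast
qed

instance hardy2 :: complete_space
proof
  fix X :: "nat \<Rightarrow> hardy2"
  assume X: "Cauchy X"
  have "Cauchy (\<lambda>n. hcoeff (X n) k)" for k
  proof (rule CauchyI)
    fix e :: real assume "e > 0"
    then obtain M where M: "\<forall>m\<ge>M. \<forall>n\<ge>M. norm (X m - X n) < e"
      using X Cauchy_iff by blast
    then show "\<exists>M. \<forall>m\<ge>M. \<forall>n\<ge>M. norm (hcoeff (X m) k - hcoeff (X n) k) < e"
      using norm_hcoeff_le[of _ k] by (metis hcoeff_diff le_less_trans)
  qed
  then have "\<forall>k. \<exists>l. (\<lambda>n. hcoeff (X n) k) \<longlonglongrightarrow> l"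
    using Cauchy_convergent_iff convergent_def by blast
  then obtain a where a: "\<And>k. (\<lambda>n. hcoeff (X n) k) \<longlonglongrightarrow> a k"
    by metis
  have est: "(\<Sum>k<K. (cmod (hcoeff (X m) k - a k))\<^sup>2) \<le> e\<^sup>2"
    if M: "\<forall>m\<ge>M. \<forall>n\<ge>M. norm (X m - X n) < e" and m: "m \<ge> M" and "e > 0" for M m K and e :: real
  proof (rule LIMSEQ_le_const2)
    show "(\<lambda>n. \<Sum>k<K. (cmod (hcoeff (X m) k - hcoeff (X n) k))\<^sup>2)
        \<longlonglongrightarrow> (\<Sum>k<K. (cmod (hcoeff (X m) k - a k))\<^sup>2)"
      by (intro tendsto_intros a)
    have "(\<Sum>k<K. (cmod (hcoeff (X m) k - hcoeff (X n) k))\<^sup>2) \<le> e\<^sup>2" if "n \<ge> M" for n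
    proof -
      have "(\<Sum>k<K. (cmod (hcoeff (X m - X n) k))\<^sup>2) \<le> (norm (X m - X n))\<^sup>2"
        unfolding hardy2_norm_sq by (rule sum_le_suminf[OF summable_hcoeff]) auto
      also have "\<dots> \<le> e\<^sup>2"
        using M m that by (intro power_mono) (auto intro: less_imp_le)
      finally show ?thesis by simp
    qed
    then show "\<exists>N. \<forall>n\<ge>N. (\<Sum>k<K. (cmod (hcoeff (X m) k - hcoeff (X n) k))\<^sup>2) \<le> e\<^sup>2"
      by blast
  qed
  have ex: "\<exists>M. \<forall>m\<ge>M. \<forall>n\<ge>M. norm (X m - X n) < e" if "e > 0" for e
    using X that Cauchy_iff by blast
  obtain M1 where M1: "\<forall>m\<ge>M1. \<forall>n\<ge>M1. norm (X m - X n) < 1"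
    using ex[of 1] by auto
  \<comment> \<open>The estimate \<open>est\<close> controls differences from \<open>X M1\<close>,
    so the limit is built as \<open>X M1\<close> minus the element \<open>b\<close> with these
    coefficients.\<close>
  have "summable (\<lambda>k. (cmod (hcoeff (X M1) k - a k))\<^sup>2)"
    by (rule summableI_nonneg_bounded[of _ "1\<^sup>2"]) (use est[OF M1, of M1] in auto)
  from square_summable_hardy2[OF this]
  obtain b where b: "\<And>k. hcoeff b k = hcoeff (X M1) k - a k"
    by blast
  define g where "g = X M1 - b"
  have g: "hcoeff g k = a k" for k
    by (simp add: g_def b)
  have "X \<longlonglongrightarrow> g"
  proof (rule LIMSEQ_I)
    fix e :: real assume e: "e > 0"
    obtain M where M: "\<forall>m\<ge>M. \<forall>n\<ge>M. norm (X m - X n) < e / 2"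
      using ex[of "e / 2"] e by auto
    have "norm (X m - g) \<le> e / 2" if "m \<ge> M" for m
      using est[OF M that] e by (intro norm_le_of_partial_sums) (auto simp: g)
    then show "\<exists>no. \<forall>n\<ge>no. norm (X n - g) < e"
      using e by (intro exI[of _ M]) fastforce
  qed
  then show "convergent X"
    by (auto simp: convergent_def)
qed

text \<open>A crude constant suffices, because the bound only serves to make point evaluation
  continuous.\<close>

lemma hardy2_eval_bound:
  assumes z: "cmod z < 1"
  shows "cmod (Rep_hardy2 f z) \<le> norm f / (1 - cmod z)"
proof -
  have geo: "(\<lambda>n. cmod z ^ n) sums (1 / (1 - cmod z))"
    using z by (intro geometric_sums) auto
  then have "(\<lambda>n. norm f * cmod z ^ n) sums (norm f * (1 / (1 - cmod z)))"
    by (rule sums_mult)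
  then have s: "summable (\<lambda>n. norm f * cmod z ^ n)" "(\<Sum>n. norm f * cmod z ^ n) = norm f / (1 - cmod z)"
    by (auto simp: sums_iff)
  have le: "norm (hcoeff f n * z ^ n) \<le> norm f * cmod z ^ n" for n
    using norm_hcoeff_le[of f n] by (simp add: norm_mult norm_power mult_right_mono)
  have "norm (\<Sum>n. hcoeff f n * z ^ n) \<le> (\<Sum>n. norm f * cmod z ^ n)"
    by (rule norm_suminf_le[OF le s(1)])
  then show ?thesis
    using hardy2_eval_sums[OF z, of f] s(2) by (simp add: sums_iff)
qed

lemma hardy2_ext: "(\<And>z. cmod z < 1 \<Longrightarrow> Rep_hardy2 f z = Rep_hardy2 g z) \<Longrightarrow> f = g"
proof -
  assume *: "\<And>z. cmod z < 1 \<Longrightarrow> Rep_hardy2 f z = Rep_hardy2 g z"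
  have "Rep_hardy2 f z = Rep_hardy2 g z" for z
    using * Rep_hardy2[of f] Rep_hardy2[of g] by (cases "z \<in> ball 0 1") (auto simp: hardy_space_def)
  then show ?thesis
    by (simp add: Rep_hardy2_inject[symmetric] fun_eq_iff)
qed

subsection \<open>Monomials\<close>

definition hmonom :: "nat \<Rightarrow> hardy2" where
  "hmonom n = (SOME f. \<forall>k. hcoeff f k = (if k = n then 1 else 0))"

lemma hcoeff_hmonom [simp]: "hcoeff (hmonom n) k = (if k = n then 1 else 0)"
proof -
  have "summable (\<lambda>k. (cmod (if k = n then 1 else 0))\<^sup>2)"
    by (rule summable_finite[of "{n}"]) auto
  from someI_ex[OF square_summable_hardy2[OF this]] show ?thesis
    unfolding hmonom_def by blast
qed

lemma Rep_hmonom: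
  assumes "cmod z < 1"
  shows "Rep_hardy2 (hmonom n) z = z ^ n"
proof -
  have "(\<lambda>k. hcoeff (hmonom n) k * z ^ k) sums (z ^ n)"
    using sums_single[of n "\<lambda>k. z ^ k"] by (simp add: if_distribR if_distrib[of "\<lambda>x. x * _"] cong: if_cong)
  then show ?thesis
    using hardy2_eval_sums[OF assms, of "hmonom n"] sums_unique2 by blast
qed

lemma cinner_hmonom: "cinner f (hmonom n) = hcoeff f n"
  unfolding cinner_def using sums_single[of n "\<lambda>k. hcoeff f k"]
  by (simp add: if_distrib sums_iff cong: if_cong)

lemma hardy2_partial_sums: "(\<lambda>n. \<Sum>k<n. cscale (hcoeff f k) (hmonom k)) \<longlonglongrightarrow> f"
proof (rule LIMSEQ_I)
  fix e :: real assume e: "e > 0"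
  define P where "P n = (\<Sum>k<n. cscale (hcoeff f k) (hmonom k))" for n
  have P: "hcoeff (f - P n) k = (if k < n then 0 else hcoeff f k)" for n k
    by (simp add: P_def if_distrib cong: if_cong)
  have "(\<lambda>n. \<Sum>k. (cmod (hcoeff f (k + n)))\<^sup>2) \<longlonglongrightarrow> 0"
    using suminf_exist_split2[OF summable_hcoeff[of f]] by simp
  moreover have "0 < e\<^sup>2" using e by simp
  ultimately obtain N where N: "\<forall>n\<ge>N. norm ((\<Sum>k. (cmod (hcoeff f (k + n)))\<^sup>2) - 0) < e\<^sup>2"
    using LIMSEQ_D by blast
  have "norm (P n - f) < e" if "n \<ge> N" for n
  proof -
    have "(norm (f - P n))\<^sup>2 = (\<Sum>k. (cmod (hcoeff (f - P n) (k + n)))\<^sup>2)"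
      unfolding hardy2_norm_sq
      using suminf_split_initial_segment[OF summable_hcoeff[of "f - P n"], of n] by (simp add: P del: hcoeff_diff)
    also have "\<dots> = (\<Sum>k. (cmod (hcoeff f (k + n)))\<^sup>2)"
      by (simp add: P del: hcoeff_diff)
    also have "\<dots> < e\<^sup>2"
      using N that by force
    finally show ?thesis
      using e by (simp add: norm_minus_commute power_less_imp_less_base)
  qed
  then show "\<exists>no. \<forall>n\<ge>no. norm ((\<Sum>k<n. cscale (hcoeff f k) (hmonom k)) - f) < e"
    unfolding P_def by blast
qed


section \<open>Singular numbers of an injective compact operator\<close>

text \<open>The n + 1 columns lie in the span of n monomials, so \<open>hardy2\<close> itself
  supplies the linear algebra. Dependence is a property of sets, hence repeated columns form a
  separate case, solved by a difference of two unit vectors.\<close>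

lemma homogeneous_system_nontrivial_solution:
  fixes A :: "nat \<Rightarrow> nat \<Rightarrow> complex"
  shows "\<exists>c. (\<exists>j\<le>n. c j \<noteq> 0) \<and> (\<forall>i<n. (\<Sum>j\<le>n. c j * A i j) = 0)"
proof -
  define v where "v j = (\<Sum>i<n. cscale (A i j) (hmonom i))" for j
  have v: "hcoeff (v j) i = A i j" if "i < n" for i j
    using that by (simp add: v_def if_distrib cong: if_cong)
  show ?thesis
  proof (cases "inj_on v {..n}")
    case True
    have "v ` {..n} \<subseteq> hardy2.span (hmonom ` {..<n})"
      unfolding v_def
      by (intro image_subsetI hardy2.span_sum hardy2.span_scale hardy2.span_base imageI)
    moreover have "card (v ` {..n}) = n + 1"
      using True by (simp add: card_image)
    moreover have "card (hmonom ` {..<n}) \<le> n"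
      using card_image_le[of "{..<n}" hmonom] by simp
    ultimately have "hardy2.dependent (v ` {..n})"
      using hardy2.independent_span_bound[of "hmonom ` {..<n}" "v ` {..n}"] by fastforce
    then obtain u where u: "\<exists>w\<in>v ` {..n}. u w \<noteq> 0" "(\<Sum>w\<in>v ` {..n}. cscale (u w) w) = 0"
      using hardy2.dependent_finite[of "v ` {..n}"] by auto
    have "(\<Sum>j\<le>n. u (v j) * A i j) = 0" if "i < n" for i
    proof -
      have "0 = hcoeff (\<Sum>j\<le>n. cscale (u (v j)) (v j)) i"
        using u(2) True by (simp add: sum.reindex del: hcoeff_sum)
      also have "\<dots> = (\<Sum>j\<le>n. u (v j) * A i j)"
        using that by (simp add: v)
      finally show ?thesis by simp
    qed
    then show ?thesis
      using u(1) by (intro exI[of _ "\<lambda>j. u (v j)"]) auto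
  next
    case False
    then obtain j k where jk: "j \<le> n" "k \<le> n" "j \<noteq> k" "v j = v k"
      by (auto simp: inj_on_def)
    define c :: "nat \<Rightarrow> complex" where "c i = (if i = j then 1 else 0) - (if i = k then 1 else 0)" for i
    have "(\<Sum>i\<le>n. c i * A l i) = A l j - A l k" for l
      using jk(1,2)
      by (simp add: c_def left_diff_distrib sum_subtractf if_distribR if_distrib[of "\<lambda>x. x * _"] cong: if_cong)
    then have "(\<Sum>i\<le>n. c i * A l i) = 0" if "l < n" for l
      using that v[of l j] v[of l k] jk(4) by simp
    moreover have "c j \<noteq> 0"
      using jk(3) by (simp add: c_def)
    ultimately show ?thesis
      using jk(1) by blast
  qed
qed

text \<open>A combination of the first \<open>card X + 1\<close> monomials does it. This keeps the
  supremum in \<open>ex_maximizer\<close> from being taken over the empty set.\<close>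

lemma ex_unit_orthogonal:
  assumes "finite X"
  shows "\<exists>y. norm y = 1 \<and> (\<forall>x\<in>X. cinner y x = 0)"
proof -
  obtain h where h: "bij_betw h {..<card X} X"
    using assms ex_bij_betw_nat_finite by (metis atLeast0LessThan)
  obtain c where c: "\<exists>j\<le>card X. c j \<noteq> 0"
      "\<forall>i<card X. (\<Sum>j\<le>card X. c j * cinner (hmonom j) (h i)) = 0"
    using homogeneous_system_nontrivial_solution[of "card X" "\<lambda>i j. cinner (hmonom j) (h i)"] by blast
  define y where "y = (\<Sum>j\<le>card X. cscale (c j) (hmonom j))"
  have "hcoeff y j = c j" if "j \<le> card X" for j
    using that by (simp add: y_def if_distrib cong: if_cong)
  then have y: "y \<noteq> 0"
    using c(1) by auto
  have "cinner y (h i) = 0" if "i < card X" for i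
    using c(2) that by (simp add: y_def cinner_sum_left cinner_cscale_left)
  then have "cinner y x = 0" if "x \<in> X" for x
    using that bij_betw_imp_surj_on[OF h] by (metis imageE lessThan_iff)
  then show ?thesis
    using y by (intro exI[of _ "cscale (of_real (inverse (norm y))) y"]) (auto simp: cinner_cscale_left norm_inverse)
qed

lemma tendsto_cinner_left:
  assumes "X \<longlonglongrightarrow> f"
  shows "(\<lambda>n. cinner (X n) g) \<longlonglongrightarrow> cinner f g"
proof -
  have "(\<lambda>n. norm (X n - f) * norm g) \<longlonglongrightarrow> 0"
    using assms by (intro tendsto_mult_left_zero) (simp add: LIM_zero_iff tendsto_norm_zero)
  then have "(\<lambda>n. cinner (X n) g - cinner f g) \<longlonglongrightarrow> 0"
    by (rule Lim_null_comparison[rotated])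
       (auto simp: cinner_Cauchy_Schwarz simp flip: cinner_diff_left)
  then show ?thesis
    by (simp add: LIM_zero_iff)
qed

lemma linear_coeff_zero_of_nonneg:
  fixes b c :: real
  assumes "\<And>e. 0 \<le> e * b + e\<^sup>2 * c"
  shows "b = 0"
proof (rule ccontr)
  assume b: "b \<noteq> 0"
  \<comment> \<open>At e = - b / d the expression is (b / d)^2 * (c - d), negative as soon as d
    exceeds c.\<close>
  define d where "d = 2 * (\<bar>c\<bar> + 1)"
  have d: "d > 0" by (simp add: d_def)
  have "0 \<le> (- b / d) * b + (- b / d)\<^sup>2 * c"
    by (rule assms)
  also have "\<dots> = (b\<^sup>2 / d\<^sup>2) * (c - d)"
    using d by (simp add: field_simps power2_eq_square)
  finally have "0 \<le> (b\<^sup>2 / d\<^sup>2) * (c - d)" .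
  moreover have "b\<^sup>2 / d\<^sup>2 > 0"
    using b d by simp
  ultimately have "c - d \<ge> 0"
    using zero_le_mult_iff[of "b\<^sup>2 / d\<^sup>2" "c - d"] by linarith
  then show False
    by (simp add: d_def)
qed

text \<open>Injectivity keeps every singular number positive, so the list never continues by zeros.
  Nonconstant symbols give injective composition operators.\<close>

locale injective_compact_operator =
  fixes T :: "hardy2 \<Rightarrow> hardy2"
  assumes compact_operator: "compact_operator T"
    and inj: "T f = 0 \<Longrightarrow> f = 0"
begin

lemma lin: "Vector_Spaces.linear cscale cscale T"
  using compact_operator by (simp add: compact_operator_def)

lemma add: "T (f + g) = T f + T g"
  using lin by (simp add: Vector_Spaces.linear_iff)

lemma scale: "T (cscale c f) = cscale c (T f)"
  using lin by (simp add: Vector_Spaces.linear_iff)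

lemma zero: "T 0 = 0"
  using add[of 0 0] by simp

lemma diff: "T (f - g) = T f - T g"
  using add[of "f - g" g] by simp

lemma sum: "T (\<Sum>i\<in>A. f i) = (\<Sum>i\<in>A. T (f i))"
  by (induction A rule: infinite_finite_induct) (auto simp: add zero)

lemma bounded: "\<exists>K>0. \<forall>f. norm (T f) \<le> K * norm f"
proof -
  have "bounded (T ` cball 0 1)"
    using compact_operator compact_imp_bounded bounded_subset closure_subset
    unfolding compact_operator_def by blast
  then obtain K where K: "K > 0" "\<And>f. norm f \<le> 1 \<Longrightarrow> norm (T f) \<le> K"
    by (auto simp: bounded_pos)
  have "norm (T f) \<le> K * norm f" for f
  proof (cases "f = 0")
    case False
    define g where "g = cscale (of_real (inverse (norm f))) f"
    have "norm (T g) \<le> K"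
      using False by (intro K(2)) (simp add: g_def norm_inverse)
    moreover have "norm (T g) = norm (T f) / norm f"
      by (simp add: g_def scale divide_inverse mult.commute norm_inverse)
    ultimately show ?thesis
      using False by (simp add: field_simps)
  qed (simp add: zero)
  with K(1) show ?thesis by blast
qed

lemma tendsto: "X \<longlonglongrightarrow> f \<Longrightarrow> (\<lambda>n. T (X n)) \<longlonglongrightarrow> T f"
proof -
  assume X: "X \<longlonglongrightarrow> f"
  obtain K where K: "\<And>f. norm (T f) \<le> K * norm f"
    using bounded by metis
  have "(\<lambda>n. K * norm (X n - f)) \<longlonglongrightarrow> 0"
    using X by (intro tendsto_mult_right_zero) (simp add: LIM_zero_iff tendsto_norm_zero)
  then have "(\<lambda>n. T (X n) - T f) \<longlonglongrightarrow> 0"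
    by (rule Lim_null_comparison[rotated]) (auto simp: K simp flip: diff)
  then show ?thesis
    by (simp add: LIM_zero_iff)
qed

text \<open>A maximising sequence converges: if \<open>L\<close> is the supremum, the parallelogram law gives
  \<open>L\<^sup>2 \<parallel>y - z\<parallel>\<^sup>2 \<le> \<parallel>T y - T z\<parallel>\<^sup>2 + 2 (L\<^sup>2 - \<parallel>T y\<parallel>\<^sup>2) + 2 (L\<^sup>2 - \<parallel>T z\<parallel>\<^sup>2)\<close> for unit vectors,
  and compactness makes the first term small along a subsequence.\<close>

lemma ex_maximizer:
  assumes X: "finite X"
  shows "\<exists>x. norm x = 1 \<and> (\<forall>w\<in>X. cinner x w = 0) \<and>
           (\<forall>y. (\<forall>w\<in>X. cinner y w = 0) \<longrightarrow> norm (T y) \<le> norm (T x) * norm y)"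
proof -
  define M where "M = {y. \<forall>w\<in>X. cinner y w = 0}"
  define S where "S = {norm (T y) | y. norm y = 1 \<and> y \<in> M}"
  define L where "L = Sup S"
  obtain K where K: "K > 0" "\<And>f. norm (T f) \<le> K * norm f"
    using bounded by metis
  have bdd: "bdd_above S"
    using K(2) by (intro bdd_aboveI[of _ K]) (auto simp: S_def, metis mult.right_neutral)
  obtain y0 where y0: "norm y0 = 1" "y0 \<in> M"
    using ex_unit_orthogonal[OF X] by (auto simp: M_def)
  then have ne: "S \<noteq> {}"
    by (auto simp: S_def)
  have "norm (T y0) \<le> L"
    unfolding L_def using y0 by (intro cSup_upper bdd) (auto simp: S_def)
  moreover have "T y0 \<noteq> 0"
    using inj y0(1) by fastforce
  ultimately have L: "L > 0"
    by (meson less_le_trans zero_less_norm_iff)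
  have M_scale: "cscale c y \<in> M" if "y \<in> M" for c y
    using that by (simp add: M_def cinner_cscale_left)
  have M_add: "y + z \<in> M" if "y \<in> M" "z \<in> M" for y z
    using that by (simp add: M_def cinner_add_left)
  have le: "norm (T y) \<le> L * norm y" if y: "y \<in> M" for y
  proof (cases "y = 0")
    case False
    define g where "g = cscale (of_real (inverse (norm y))) y"
    have "norm (T g) \<in> S"
      unfolding S_def using False y by (auto intro!: exI[of _ g] simp: g_def M_scale norm_inverse)
    then have "norm (T g) \<le> L"
      unfolding L_def by (intro cSup_upper bdd)
    moreover have "norm (T g) = norm (T y) / norm y"
      by (simp add: g_def scale divide_inverse mult.commute norm_inverse)
    ultimately show ?thesis
      using False by (simp add: field_simps)
  qed (simp add: zero)
  have "\<exists>y. norm y = 1 \<and> y \<in> M \<and> L - 1 / Suc n < norm (T y)" for n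
  proof -
    have "\<exists>a\<in>S. L - 1 / Suc n < a"
      unfolding L_def using ne bdd by (subst less_cSup_iff[symmetric]) auto
    then show ?thesis by (auto simp: S_def)
  qed
  then obtain y where y: "\<And>n. norm (y n) = 1" "\<And>n. y n \<in> M" "\<And>n. L - 1 / Suc n < norm (T (y n))"
    by metis
  have "seq_compact (closure (T ` cball 0 1))"
    using compact_operator by (simp add: compact_operator_def compact_eq_seq_compact_metric)
  moreover have "\<forall>n. T (y n) \<in> closure (T ` cball 0 1)"
    using y(1) by (intro allI subsetD[OF closure_subset] imageI) auto
  ultimately obtain l r where r: "strict_mono r" "(\<lambda>n. T (y (r n))) \<longlonglongrightarrow> l"
    unfolding seq_compact_def by (force simp: o_def)
  define z where "z n = y (r n)" for n
  have z: "norm (z n) = 1" "z n \<in> M" for n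
    using y by (auto simp: z_def)
  have Tz_le: "norm (T (z n)) \<le> L" for n
    using le[OF z(2)[of n]] z(1)[of n] by simp
  have "(\<lambda>n. norm (T (y n))) \<longlonglongrightarrow> L"
  proof (rule real_tendsto_sandwich)
    show "\<forall>\<^sub>F n in sequentially. L - 1 / Suc n \<le> norm (T (y n))"
      using y(3) by (intro always_eventually allI less_imp_le)
    show "\<forall>\<^sub>F n in sequentially. norm (T (y n)) \<le> L"
      using le[OF y(2)] y(1) by auto
    show "(\<lambda>n. L - 1 / Suc n) \<longlonglongrightarrow> L"
      by real_asymp
  qed auto
  then have Tz: "(\<lambda>n. norm (T (z n))) \<longlonglongrightarrow> L"
    unfolding z_def using LIMSEQ_subseq_LIMSEQ[OF _ r(1)] by (force simp: o_def)
  have key: "L\<^sup>2 * (norm (z m - z n))\<^sup>2 \<le> (norm (T (z m) - T (z n)))\<^sup>2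
      + 2 * (L\<^sup>2 - (norm (T (z m)))\<^sup>2) + 2 * (L\<^sup>2 - (norm (T (z n)))\<^sup>2)" for m n
  proof -
    have "(norm (T (z m + z n)))\<^sup>2 \<le> (L * norm (z m + z n))\<^sup>2"
      by (intro power_mono le M_add z) auto
    moreover have "(norm (T (z m + z n)))\<^sup>2 + (norm (T (z m) - T (z n)))\<^sup>2
        = 2 * (norm (T (z m)))\<^sup>2 + 2 * (norm (T (z n)))\<^sup>2"
      unfolding add by (rule hardy2_parallelogram)
    moreover have "L\<^sup>2 * (norm (z m + z n))\<^sup>2 + L\<^sup>2 * (norm (z m - z n))\<^sup>2 = 4 * L\<^sup>2"
      using hardy2_parallelogram[of "z m" "z n"] z(1)
      by (simp flip: distrib_left)
    ultimately show ?thesis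
      by (simp add: power_mult_distrib)
  qed
  have "Cauchy z"
  proof (rule CauchyI)
    fix e :: real assume e: "e > 0"
    have "Cauchy (\<lambda>n. T (z n))"
      using r(2) unfolding z_def by (intro LIMSEQ_imp_Cauchy)
    \<comment> \<open>With these tolerances each of the three groups of terms in \<open>key\<close>
      contributes at most a quarter of L^2 * e^2.\<close>
    then obtain N1 where N1: "\<And>m n. m \<ge> N1 \<Longrightarrow> n \<ge> N1 \<Longrightarrow> norm (T (z m) - T (z n)) < L * e / 2"
      using CauchyD[of "\<lambda>n. T (z n)" "L * e / 2"] L e by auto
    have "(\<lambda>n. L\<^sup>2 - (norm (T (z n)))\<^sup>2) \<longlonglongrightarrow> L\<^sup>2 - L\<^sup>2"
      by (intro tendsto_intros Tz)
    then have "\<forall>\<^sub>F n in sequentially. L\<^sup>2 - (norm (T (z n)))\<^sup>2 < L\<^sup>2 * e\<^sup>2 / 8"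
      using L e by (intro order_tendstoD) auto
    then obtain N2 where N2: "\<And>n. n \<ge> N2 \<Longrightarrow> L\<^sup>2 - (norm (T (z n)))\<^sup>2 < L\<^sup>2 * e\<^sup>2 / 8"
      by (auto simp: eventually_sequentially)
    show "\<exists>M. \<forall>m\<ge>M. \<forall>n\<ge>M. norm (z m - z n) < e"
    proof (intro exI allI impI)
      fix m n assume mn: "m \<ge> max N1 N2" "n \<ge> max N1 N2"
      have "(norm (T (z m) - T (z n)))\<^sup>2 \<le> (L * e / 2)\<^sup>2"
        using N1[of m n] mn by (intro power_mono) auto
      then have "L\<^sup>2 * (norm (z m - z n))\<^sup>2 \<le> (L * e / 2)\<^sup>2 + 2 * (L\<^sup>2 * e\<^sup>2 / 8) + 2 * (L\<^sup>2 * e\<^sup>2 / 8)"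
        using key[of m n] N2[of m] N2[of n] mn by (smt (verit) max.bounded_iff)
      also have "\<dots> < L\<^sup>2 * e\<^sup>2"
        using L e by (simp add: power_divide power_mult_distrib)
      finally have "(norm (z m - z n))\<^sup>2 < e\<^sup>2"
        using L by simp
      then show "norm (z m - z n) < e"
        using e by (simp add: power_less_imp_less_base)
    qed
  qed
  then obtain x where x: "z \<longlonglongrightarrow> x"
    using Cauchy_convergent_iff convergent_def by blast
  have "(\<lambda>n. norm (z n)) \<longlonglongrightarrow> norm x"
    using x by (rule tendsto_norm)
  then have "norm x = 1"
    using z(1) by (simp add: LIMSEQ_const_iff)
  moreover have "cinner x w = 0" if "w \<in> X" for w
    using tendsto_cinner_left[OF x, of w] z(2) that by (simp add: M_def LIMSEQ_const_iff)
  moreover have "norm (T x) = L"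
    using tendsto_norm[OF tendsto[OF x]] Tz LIMSEQ_unique by blast
  ultimately show ?thesis
    using le by (intro exI[of _ x]) (auto simp: M_def)
qed

definition maximizer :: "hardy2 set \<Rightarrow> hardy2" where
  "maximizer X = (SOME x. norm x = 1 \<and> (\<forall>w\<in>X. cinner x w = 0) \<and>
     (\<forall>y. (\<forall>w\<in>X. cinner y w = 0) \<longrightarrow> norm (T y) \<le> norm (T x) * norm y))"

text \<open>Each vector maximises the norm of \<open>T\<close> on the orthogonal complement of all
  earlier ones, so the recursion has to carry the vectors found so far.\<close>

primrec eigenvectors :: "nat \<Rightarrow> hardy2 list" where
  "eigenvectors 0 = []"
| "eigenvectors (Suc n) = maximizer (set (eigenvectors n)) # eigenvectors n"

definition eigenvector :: "nat \<Rightarrow> hardy2" where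
  "eigenvector n = maximizer (set (eigenvectors n))"

definition sing :: "nat \<Rightarrow> real" where
  "sing n = norm (T (eigenvector n))"

lemma set_eigenvectors: "set (eigenvectors n) = eigenvector ` {..<n}"
  by (induction n) (auto simp: eigenvector_def lessThan_Suc)

lemma eigenvector_props:
  "norm (eigenvector n) = 1 \<and> (\<forall>i<n. cinner (eigenvector n) (eigenvector i) = 0) \<and>
   (\<forall>y. (\<forall>i<n. cinner y (eigenvector i) = 0) \<longrightarrow> norm (T y) \<le> sing n * norm y)"
  using someI_ex[OF ex_maximizer[of "set (eigenvectors n)"], folded maximizer_def]
  unfolding eigenvector_def[symmetric] sing_def unfolding set_eigenvectors
  by auto

lemma norm_eigenvector: "norm (eigenvector n) = 1"
  and norm_T_le_sing: "(\<And>i. i < n \<Longrightarrow> cinner y (eigenvector i) = 0) \<Longrightarrow> norm (T y) \<le> sing n * norm y"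
  using eigenvector_props[of n] by auto

lemma cinner_eigenvector: "cinner (eigenvector m) (eigenvector n) = (if m = n then 1 else 0)"
proof (cases m n rule: linorder_cases)
  case less
  then show ?thesis
    using eigenvector_props[of n] cinner_commute[of "eigenvector m" "eigenvector n"] by simp
next
  case greater
  then show ?thesis
    using eigenvector_props[of m] by simp
qed (simp add: cinner_self norm_eigenvector)

lemma sing_pos: "sing n > 0"
  unfolding sing_def using inj[of "eigenvector n"] norm_eigenvector[of n] by fastforce

lemma decseq_sing: "decseq sing"
proof (rule decseq_SucI)
  show "sing (Suc n) \<le> sing n" for n
    using norm_T_le_sing[of n "eigenvector (Suc n)"]
    by (simp add: cinner_eigenvector norm_eigenvector sing_def)
qed

text \<open>First-order condition: (sing n)^2 * |x + e h|^2 - |T (x + e h)|^2 is nonnegative for all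
  real e and vanishes at e = 0, so its linear term in e is zero.\<close>

lemma cinner_T_eigenvector_orthogonal:
  assumes h: "\<And>i. i < n \<Longrightarrow> cinner h (eigenvector i) = 0"
  shows "cinner (T (eigenvector n)) (T h) = of_real ((sing n)\<^sup>2) * cinner (eigenvector n) h"
proof -
  have Re0: "Re (of_real ((sing n)\<^sup>2) * cinner (eigenvector n) h - cinner (T (eigenvector n)) (T h)) = 0"
    if h: "\<And>i. i < n \<Longrightarrow> cinner h (eigenvector i) = 0" for h
  proof -
    let ?x = "eigenvector n"
    define b where "b = (sing n)\<^sup>2 * Re (cinner ?x h) - Re (cinner (T ?x) (T h))"
    define c where "c = (sing n)\<^sup>2 * (norm h)\<^sup>2 - (norm (T h))\<^sup>2"
    have "0 \<le> e * (2 * b) + e\<^sup>2 * c" for e :: real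
    proof -
      let ?y = "?x + cscale (of_real e) h"
      have "(norm (T ?y))\<^sup>2 \<le> (sing n * norm ?y)\<^sup>2"
        using h by (intro power_mono norm_T_le_sing)
          (auto simp: cinner_add_left cinner_cscale_left cinner_eigenvector)
      moreover have "(norm ?y)\<^sup>2 = 1 + 2 * (e * Re (cinner ?x h)) + e\<^sup>2 * (norm h)\<^sup>2"
        by (simp add: norm_add_sq norm_eigenvector cinner_cscale_right power_mult_distrib)
      moreover have "(norm (T ?y))\<^sup>2 = (sing n)\<^sup>2 + 2 * (e * Re (cinner (T ?x) (T h))) + e\<^sup>2 * (norm (T h))\<^sup>2"
        by (simp add: add scale norm_add_sq sing_def cinner_cscale_right power_mult_distrib)
      ultimately show ?thesis
        by (simp add: b_def c_def power_mult_distrib algebra_simps)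
    qed
    from linear_coeff_zero_of_nonneg[OF this] show ?thesis
      by (simp add: b_def)
  qed
  \<comment> \<open>Real variations only give the real part of the identity; replacing h by i h
    gives the imaginary part.\<close>
  have "cinner (cscale \<i> h) (eigenvector i) = 0" if "i < n" for i
    using h[OF that] by (simp add: cinner_cscale_left)
  from Re0[OF this] Re0[OF h] show ?thesis
    by (simp add: complex_eq_iff scale cinner_cscale_right)
qed

lemma cinner_T_eigenvector_eigenvector:
  "cinner (T (eigenvector m)) (T (eigenvector n)) = (if m = n then of_real ((sing n)\<^sup>2) else 0)"
proof (cases m n rule: linorder_cases)
  case less
  then show ?thesis
    using cinner_T_eigenvector_orthogonal[of m "eigenvector n"] by (simp add: cinner_eigenvector)
next
  case greater
  then show ?thesis
    using cinner_T_eigenvector_orthogonal[of n "eigenvector m"]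
      cinner_commute[of "T (eigenvector m)" "T (eigenvector n)"]
    by (simp add: cinner_eigenvector)
qed (simp add: cinner_self sing_def)

definition tail :: "nat \<Rightarrow> hardy2 \<Rightarrow> hardy2" where
  "tail N f = f - (\<Sum>n<N. cscale (cinner f (eigenvector n)) (eigenvector n))"

lemma cinner_tail: "i < N \<Longrightarrow> cinner (tail N f) (eigenvector i) = 0"
  by (simp add: tail_def cinner_diff_left cinner_sum_left cinner_cscale_left cinner_eigenvector
      if_distrib cong: if_cong)

lemma tail_decomp: "f = tail N f + (\<Sum>n<N. cscale (cinner f (eigenvector n)) (eigenvector n))"
  by (simp add: tail_def)

text \<open>The weak form of the eigenvalue equation for T*T. The components of f along earlier
  eigenvectors contribute 0 to both sides, which leaves the orthogonal case.\<close>

lemma cinner_T_eigenvector: "cinner (T (eigenvector n)) (T f) = of_real ((sing n)\<^sup>2) * cinner (eigenvector n) f"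
proof -
  let ?P = "\<Sum>i<n. cscale (cinner f (eigenvector i)) (eigenvector i)"
  have "cinner (T (eigenvector n)) (T ?P) = 0" "cinner (eigenvector n) ?P = 0"
    by (simp_all add: sum scale cinner_sum_right cinner_cscale_right cinner_T_eigenvector_eigenvector
        cinner_eigenvector)
  moreover have "cinner (T (eigenvector n)) (T (tail n f)) =
      of_real ((sing n)\<^sup>2) * cinner (eigenvector n) (tail n f)"
    by (intro cinner_T_eigenvector_orthogonal cinner_tail)
  ultimately show ?thesis
    using arg_cong[OF tail_decomp[of f n], of T] arg_cong[OF tail_decomp[of f n], of "cinner (eigenvector n)"]
    by (simp add: add cinner_add_right)
qed

lemma norm_sq_decomp:
  "(norm f)\<^sup>2 = (\<Sum>n<N. (cmod (cinner f (eigenvector n)))\<^sup>2) + (norm (tail N f))\<^sup>2"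
proof (induction N)
  case 0
  then show ?case by (simp add: tail_def)
next
  case (Suc N)
  let ?v = "cscale (cinner f (eigenvector N)) (eigenvector N)"
  have "cinner (tail (Suc N) f) ?v = 0"
    using cinner_tail[of N "Suc N" f] by (simp add: cinner_cscale_right)
  moreover have "tail N f = tail (Suc N) f + ?v"
    by (simp add: tail_def)
  ultimately show ?case
    using Suc by (simp add: norm_add_sq_orthogonal norm_eigenvector)
qed

lemma norm_T_sq_decomp:
  "(norm (T f))\<^sup>2 = (\<Sum>n<N. (sing n)\<^sup>2 * (cmod (cinner f (eigenvector n)))\<^sup>2) + (norm (T (tail N f)))\<^sup>2"
proof (induction N)
  case 0
  then show ?case by (simp add: tail_def)
next
  case (Suc N)
  let ?v = "cscale (cinner f (eigenvector N)) (eigenvector N)"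
  have "cinner (T ?v) (T (tail (Suc N) f)) = 0"
    using cinner_tail[of N "Suc N" f] cinner_commute[of "eigenvector N" "tail (Suc N) f"]
    by (simp add: scale cinner_cscale_left cinner_T_eigenvector)
  then have "cinner (T (tail (Suc N) f)) (T ?v) = 0"
    using cinner_commute by (metis complex_cnj_zero)
  moreover have "tail N f = tail (Suc N) f + ?v"
    by (simp add: tail_def)
  then have "T (tail N f) = T (tail (Suc N) f) + T ?v"
    by (simp only: add)
  ultimately have "(norm (T (tail N f)))\<^sup>2 = (norm (T (tail (Suc N) f)))\<^sup>2 + (norm (T ?v))\<^sup>2"
    by (simp add: norm_add_sq_orthogonal)
  moreover have "(norm (T ?v))\<^sup>2 = (sing N)\<^sup>2 * (cmod (cinner f (eigenvector N)))\<^sup>2"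
    by (simp add: scale sing_def power_mult_distrib)
  ultimately show ?case
    using Suc by simp
qed

text \<open>Otherwise the images of the eigenvectors are orthogonal with norms bounded away from 0,
  and no subsequence of them is Cauchy, against compactness.\<close>

lemma sing_tendsto_0: "sing \<longlonglongrightarrow> 0"
proof (rule ccontr)
  assume not: "\<not> sing \<longlonglongrightarrow> 0"
  have "Bseq sing"
    using decseq_sing sing_pos by (intro decseq_bounded[of _ 0]) (auto intro: less_imp_le)
  then have "convergent sing"
    using decseq_sing Bseq_monoseq_convergent decseq_imp_monoseq by blast
  then obtain e where e: "sing \<longlonglongrightarrow> e"
    by (auto simp: convergent_def)
  have ge: "e \<le> sing n" for n
    using decseq_ge[OF decseq_sing e] .
  have "e \<ge> 0"
    using e sing_pos by (intro LIMSEQ_le_const[OF e]) (auto intro: less_imp_le)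
  then have "e > 0"
    using not e by (cases "e = 0") auto
  have "seq_compact (closure (T ` cball 0 1))"
    using compact_operator by (simp add: compact_operator_def compact_eq_seq_compact_metric)
  moreover have "\<forall>n. T (eigenvector n) \<in> closure (T ` cball 0 1)"
    using norm_eigenvector by (intro allI subsetD[OF closure_subset] imageI) auto
  ultimately obtain l r where r: "strict_mono r" "(\<lambda>n. T (eigenvector (r n))) \<longlonglongrightarrow> l"
    unfolding seq_compact_def by (force simp: o_def)
  from LIMSEQ_imp_Cauchy[OF r(2)] \<open>e > 0\<close>
  obtain M where M: "\<And>m n. m \<ge> M \<Longrightarrow> n \<ge> M \<Longrightarrow> norm (T (eigenvector (r m)) - T (eigenvector (r n))) < e"
    by (meson CauchyD)
  have "r M \<noteq> r (Suc M)"
    using r(1) by (simp add: strict_mono_eq)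
  then have "(norm (T (eigenvector (r M)) - T (eigenvector (r (Suc M)))))\<^sup>2
      = (sing (r M))\<^sup>2 + (sing (r (Suc M)))\<^sup>2"
    by (simp add: norm_sq_Re_cinner cinner_diff_left cinner_diff_right cinner_T_eigenvector_eigenvector)
  also have "\<dots> \<ge> e\<^sup>2 + 0"
    using ge \<open>e > 0\<close> by (intro add_mono power_mono) auto
  finally have "e \<le> norm (T (eigenvector (r M)) - T (eigenvector (r (Suc M))))"
    using power2_le_imp_le by (metis add.right_neutral norm_ge_zero)
  then show False
    using M[of M "Suc M"] by simp
qed

text \<open>The remainder after N terms is at most (sing N * norm f)^2, since
  \<open>tail N f\<close> is orthogonal to the first N eigenvectors.\<close>

lemma norm_T_sums: "(\<lambda>n. (sing n)\<^sup>2 * (cmod (cinner f (eigenvector n)))\<^sup>2) sums (norm (T f))\<^sup>2"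
proof -
  have "(\<lambda>N. (norm (T (tail N f)))\<^sup>2) \<longlonglongrightarrow> 0"
  proof (rule Lim_null_comparison)
    have "norm (tail N f) \<le> norm f" for N
    proof (rule power2_le_imp_le)
      show "(norm (tail N f))\<^sup>2 \<le> (norm f)\<^sup>2"
        using norm_sq_decomp[of f N] by (simp add: sum_nonneg)
    qed auto
    moreover have "norm (T (tail N f)) \<le> sing N * norm (tail N f)" for N
      by (intro norm_T_le_sing cinner_tail)
    ultimately have "norm (T (tail N f)) \<le> sing N * norm f" for N
      by (meson mult_left_mono order_trans less_imp_le sing_pos)
    then show "\<forall>\<^sub>F N in sequentially. norm ((norm (T (tail N f)))\<^sup>2) \<le> (sing N * norm f)\<^sup>2"
      by (intro always_eventually allI) (simp add: power_mono)
    show "(\<lambda>N. (sing N * norm f)\<^sup>2) \<longlonglongrightarrow> 0"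
      using tendsto_power[OF tendsto_mult_right[OF sing_tendsto_0, of "norm f"], of 2] by simp
  qed
  then have "(\<lambda>N. (norm (T f))\<^sup>2 - (norm (T (tail N f)))\<^sup>2) \<longlonglongrightarrow> (norm (T f))\<^sup>2 - 0"
    by (intro tendsto_intros)
  moreover have "(norm (T f))\<^sup>2 - (norm (T (tail N f)))\<^sup>2
      = (\<Sum>n<N. (sing n)\<^sup>2 * (cmod (cinner f (eigenvector n)))\<^sup>2)" for N
    using norm_T_sq_decomp[of f N] by simp
  ultimately show ?thesis
    by (simp add: sums_def)
qed

text \<open>\<open>b\<close> is the coefficient sequence that the image of \<open>g\<close> must
  have. Testing \<open>T\<close> on its finite sections \<open>w\<close> bounds their norms by K *
  norm g, hence \<open>b\<close> is square summable.\<close>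

lemma ex_adjoint: "\<exists>S. \<forall>f g. cinner (T f) g = cinner f (S g)"
proof -
  obtain K where K: "K > 0" "\<And>f. norm (T f) \<le> K * norm f"
    using bounded by metis
  have "\<exists>h. \<forall>f. cinner (T f) g = cinner f h" for g
  proof -
    define b where "b k = cnj (cinner (T (hmonom k)) g)" for k
    have "(\<Sum>k<n. (cmod (b k))\<^sup>2) \<le> (K * norm g)\<^sup>2" for n
    proof -
      define w where "w = (\<Sum>k<n. cscale (b k) (hmonom k))"
      have hw: "hcoeff w k = (if k < n then b k else 0)" for k
        by (simp add: w_def if_distrib cong: if_cong)
      have nw: "(norm w)\<^sup>2 = (\<Sum>k<n. (cmod (b k))\<^sup>2)"
        unfolding hardy2_norm_sq hw by (subst suminf_finite[of "{..<n}"]) auto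
      have "cinner (T w) g = (\<Sum>k<n. b k * cnj (b k))"
        by (simp add: w_def sum scale cinner_sum_left cinner_cscale_left b_def)
      also have "\<dots> = of_real ((norm w)\<^sup>2)"
        by (simp add: nw flip: complex_norm_square)
      finally have "(norm w)\<^sup>2 = cmod (cinner (T w) g)"
        by (simp add: norm_power)
      also have "\<dots> \<le> norm (T w) * norm g"
        by (rule cinner_Cauchy_Schwarz)
      also have "\<dots> \<le> K * norm w * norm g"
        by (intro mult_right_mono K) auto
      finally have "norm w * norm w \<le> norm w * (K * norm g)"
        by (simp add: power2_eq_square mult_ac)
      then have "norm w \<le> K * norm g"
        using K(1) by (cases "w = 0") auto
      then show ?thesis
        unfolding nw[symmetric] by (intro power_mono) auto
    qed
    then have "summable (\<lambda>k. (cmod (b k))\<^sup>2)"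
      by (intro summableI_nonneg_bounded[of _ "(K * norm g)\<^sup>2"]) auto
    from square_summable_hardy2[OF this] obtain h where h: "\<And>k. hcoeff h k = b k"
      by blast
    have "cinner (T f) g = cinner f h" for f
    proof (rule LIMSEQ_unique)
      let ?P = "\<lambda>n. \<Sum>k<n. cscale (hcoeff f k) (hmonom k)"
      show "(\<lambda>n. cinner (T (?P n)) g) \<longlonglongrightarrow> cinner (T f) g"
        by (intro tendsto_cinner_left tendsto hardy2_partial_sums)
      have "cinner (hmonom k) h = cinner (T (hmonom k)) g" for k
        using cinner_commute[of "hmonom k" h] by (simp add: cinner_hmonom h b_def)
      then have "cinner (T (?P n)) g = cinner (?P n) h" for n
        by (simp add: sum scale cinner_sum_left cinner_cscale_left)
      then show "(\<lambda>n. cinner (T (?P n)) g) \<longlonglongrightarrow> cinner f h"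
        by (simp only:) (intro tendsto_cinner_left hardy2_partial_sums)
    qed
    then show ?thesis by blast
  qed
  then show ?thesis by metis
qed

lemma cinner_adjoint: "cinner (T f) g = cinner f (hilbert_adjoint T g)"
proof -
  have "\<exists>!S. \<forall>f g. cinner (T f) g = cinner f (S g)"
  proof (rule ex_ex1I[OF ex_adjoint])
    fix S S' assume S: "\<forall>f g. cinner (T f) g = cinner f (S g)" "\<forall>f g. cinner (T f) g = cinner f (S' g)"
    have "S g = S' g" for g
    proof -
      have "cinner (S g - S' g) (S g - S' g) = 0"
        using S by (metis cinner_diff_right right_minus_eq)
      then show ?thesis
        by (simp add: cinner_self)
    qed
    then show "S = S'" by blast
  qed
  from theI'[OF this] show ?thesis
    unfolding hilbert_adjoint_def by blast
qed

text \<open>The weak form of T*T f = c f; it removes the adjoint from the arguments below.\<close>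

lemma eigenspace_iff:
  "f \<in> eigenspace (hilbert_adjoint T \<circ> T) c \<longleftrightarrow> (\<forall>g. cinner (T g) (T f) = cnj c * cinner g f)"
proof
  assume "f \<in> eigenspace (hilbert_adjoint T \<circ> T) c"
  then show "\<forall>g. cinner (T g) (T f) = cnj c * cinner g f"
    by (simp add: eigenspace_def cinner_adjoint cinner_cscale_right)
next
  assume *: "\<forall>g. cinner (T g) (T f) = cnj c * cinner g f"
  define d where "d = hilbert_adjoint T (T f) - cscale c f"
  have "cinner d d = 0"
    using *[rule_format, of d] unfolding cinner_adjoint
    by (subst (2) d_def) (simp add: cinner_diff_right cinner_cscale_right)
  then show "f \<in> eigenspace (hilbert_adjoint T \<circ> T) c"
    by (simp add: cinner_self d_def eigenspace_def)
qed

lemma finite_sing_eq: "\<sigma> > 0 \<Longrightarrow> finite {n. sing n = \<sigma>}"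
proof -
  assume "\<sigma> > 0"
  then have "\<forall>\<^sub>F n in sequentially. sing n < \<sigma>"
    using sing_tendsto_0 by (intro order_tendstoD)
  then obtain N where "\<And>n. n \<ge> N \<Longrightarrow> sing n < \<sigma>"
    by (auto simp: eventually_sequentially)
  then have "{n. sing n = \<sigma>} \<subseteq> {..<N}"
    by (force simp: not_le[symmetric])
  then show ?thesis
    using finite_subset by blast
qed

text \<open>Subtracting from an element of the eigenspace its projection to the span leaves some d
  in the eigenspace that is orthogonal to every eigenvector, because distinct eigenvalues force
  orthogonality. Then T d = 0 by \<open>norm_T_sums\<close>, and injectivity gives d = 0.\<close>

lemma eigenspace_eq_span:
  assumes \<sigma>: "\<sigma> > 0"
  shows "eigenspace (hilbert_adjoint T \<circ> T) (of_real (\<sigma>\<^sup>2)) = hardy2.span (eigenvector ` {n. sing n = \<sigma>})"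
    (is "?E = hardy2.span (eigenvector ` ?A)")
proof
  have "hardy2.subspace ?E"
    by (rule hardy2.subspaceI)
       (auto simp: eigenspace_iff zero add scale cinner_add_right cinner_cscale_right algebra_simps)
  moreover have "eigenvector ` ?A \<subseteq> ?E"
  proof safe
    fix n assume n: "\<sigma> = sing n"
    show "eigenvector n \<in> eigenspace (hilbert_adjoint T \<circ> T) (of_real ((sing n)\<^sup>2))"
      unfolding eigenspace_iff
      using cinner_T_eigenvector[of n] cinner_commute[of "T _" "T (eigenvector n)"] cinner_commute[of _ "eigenvector n"]
      by simp
  qed
  ultimately show "hardy2.span (eigenvector ` ?A) \<subseteq> ?E"
    by (intro hardy2.span_minimal)
  show "?E \<subseteq> hardy2.span (eigenvector ` ?A)"
  proof
    fix f assume f: "f \<in> ?E"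
    then have f': "cinner (T g) (T f) = of_real (\<sigma>\<^sup>2) * cinner g f" for g
      by (simp add: eigenspace_iff)
    define p where "p = (\<Sum>n\<in>?A. cscale (cinner f (eigenvector n)) (eigenvector n))"
    have p: "p \<in> hardy2.span (eigenvector ` ?A)"
      unfolding p_def by (intro hardy2.span_sum hardy2.span_scale hardy2.span_base) auto
    then have "p \<in> ?E"
      using \<open>hardy2.span (eigenvector ` ?A) \<subseteq> ?E\<close> by blast
    then have p': "cinner (T g) (T p) = of_real (\<sigma>\<^sup>2) * cinner g p" for g
      by (simp add: eigenspace_iff)
    define d where "d = f - p"
    have d: "cinner (T g) (T d) = of_real (\<sigma>\<^sup>2) * cinner g d" for g
      by (simp add: d_def diff cinner_diff_right f' p' right_diff_distrib)
    have orth: "cinner d (eigenvector n) = 0" for n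
    proof (cases "n \<in> ?A")
      case True
      then show ?thesis
        using finite_sing_eq[OF \<sigma>]
        by (simp add: d_def p_def cinner_diff_left cinner_sum_left cinner_cscale_left cinner_eigenvector
            if_distrib cong: if_cong)
    next
      case False
      have "of_real ((sing n)\<^sup>2) * cinner (eigenvector n) d = of_real (\<sigma>\<^sup>2) * cinner (eigenvector n) d"
        using d[of "eigenvector n"] by (simp add: cinner_T_eigenvector)
      then have "(of_real ((sing n)\<^sup>2) :: complex) = of_real (\<sigma>\<^sup>2) \<or> cinner (eigenvector n) d = 0"
        unfolding mult_cancel_right by (rule disj_commute[THEN iffD1])
      moreover have "(sing n)\<^sup>2 \<noteq> \<sigma>\<^sup>2"
        using False \<sigma> sing_pos[of n] by (simp add: power2_eq_iff_nonneg)
      ultimately have "cinner (eigenvector n) d = 0"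
        using of_real_eq_iff by blast
      then show ?thesis
        using cinner_commute[of d "eigenvector n"] by simp
    qed
    have "(norm (T d))\<^sup>2 = 0"
      using norm_T_sums[of d] by (simp add: orth sums_iff)
    then have "d = 0"
      using inj by simp
    then show "f \<in> hardy2.span (eigenvector ` ?A)"
      using p by (simp add: d_def)
  qed
qed

lemma inj_eigenvector: "inj eigenvector"
  by (rule injI) (metis cinner_eigenvector zero_neq_one)

lemma independent_eigenvectors:
  assumes "finite A"
  shows "hardy2.independent (eigenvector ` A)"
proof
  assume "hardy2.dependent (eigenvector ` A)"
  then obtain u where u: "\<exists>w\<in>eigenvector ` A. u w \<noteq> 0" "(\<Sum>w\<in>eigenvector ` A. cscale (u w) w) = 0"
    using hardy2.dependent_finite[of "eigenvector ` A"] assms by auto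
  then obtain n where n: "n \<in> A" "u (eigenvector n) \<noteq> 0"
    by blast
  have "(\<Sum>m\<in>A. cscale (u (eigenvector m)) (eigenvector m)) = 0"
    using u(2) inj_on_subset[OF inj_eigenvector] by (simp add: sum.reindex)
  then have "cinner (\<Sum>m\<in>A. cscale (u (eigenvector m)) (eigenvector m)) (eigenvector n) = 0"
    by simp
  then show False
    using n assms by (simp add: cinner_sum_left cinner_cscale_left cinner_eigenvector if_distrib cong: if_cong)
qed

lemma is_singular_numbers_sing: "is_singular_numbers T sing"
  unfolding is_singular_numbers_def
proof (intro conjI allI impI)
  fix \<sigma> :: real assume \<sigma>: "\<sigma> > 0"
  show "finite {n. sing n = \<sigma>}"
    by (rule finite_sing_eq[OF \<sigma>])
  then show "card {n. sing n = \<sigma>} = hardy2_dim (eigenspace (hilbert_adjoint T \<circ> T) (of_real (\<sigma>\<^sup>2)))"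
    unfolding eigenspace_eq_span[OF \<sigma>]
    using hardy2.dim_span_eq_card_independent[OF independent_eigenvectors]
    by (simp add: card_image inj_on_subset[OF inj_eigenvector])
qed (use decseq_sing sing_pos in \<open>auto intro: less_imp_le\<close>)

end

text \<open>At a first disagreement s' n < s n, the value s n is taken by s' only before n, where
  the lists agree, and by s at n as well; the multiplicities would differ.\<close>

lemma is_singular_numbers_unique:
  assumes s: "is_singular_numbers T s" and s': "is_singular_numbers T s'"
  shows "s = s'"
proof -
  have not_less: "\<not> s' n < s n"
    if s: "is_singular_numbers T s" and s': "is_singular_numbers T s'" and eq: "\<forall>i<n. s i = s' i"
    for s s' n
  proof
    assume less: "s' n < s n"
    define \<sigma> where "\<sigma> = s n"
    have \<sigma>: "\<sigma> > 0"
      using less s' by (metis \<sigma>_def is_singular_numbers_def le_less_trans)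
    have fin: "finite {i. s i = \<sigma>}" and card: "card {i. s i = \<sigma>} = card {i. s' i = \<sigma>}"
      using s s' \<sigma> by (auto simp: is_singular_numbers_def)
    have "i < n" if "s' i = \<sigma>" for i
    proof (rule ccontr)
      assume "\<not> i < n"
      then have "s' i \<le> s' n"
        using s' by (auto simp: is_singular_numbers_def decseq_def)
      then show False
        using less that by (simp add: \<sigma>_def)
    qed
    then have "{i. s' i = \<sigma>} \<subseteq> {i. s i = \<sigma>} - {n}"
      using eq by auto
    then have "card {i. s' i = \<sigma>} \<le> card ({i. s i = \<sigma>} - {n})"
      using fin by (intro card_mono) auto
    also have "\<dots> < card {i. s i = \<sigma>}"
      using fin by (intro card_Diff1_less) (auto simp: \<sigma>_def)
    finally show False
      using card by simp
  qed
  have "s n = s' n" for n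
  proof (induction n rule: less_induct)
    case (less n)
    then have "\<not> s' n < s n" "\<not> s n < s' n"
      by (intro not_less[OF s s'] not_less[OF s' s]; simp)+
    then show ?case by simp
  qed
  then show ?thesis by blast
qed

section \<open>Estimating singular numbers from above and from below\<close>

context injective_compact_operator
begin

lemma singular_numbers_eq: "singular_numbers T = sing"
  unfolding singular_numbers_def
  using is_singular_numbers_sing is_singular_numbers_unique by (intro the_equality) blast+

text \<open>The Courant-Fischer argument: some nonzero combination of the first N + 1 eigenvectors
  has its first N coefficients zero; on it \<open>T\<close> expands by at least
  \<open>sing N\<close> and by at most B.\<close>

lemma singular_number_le:
  assumes B: "\<And>f. (\<And>k. k < N \<Longrightarrow> hcoeff f k = 0) \<Longrightarrow> norm (T f) \<le> B * norm f"
  shows "singular_numbers T N \<le> B"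
proof -
  obtain c where c: "\<exists>j\<le>N. c j \<noteq> 0" "\<forall>i<N. (\<Sum>j\<le>N. c j * hcoeff (eigenvector j) i) = 0"
    using homogeneous_system_nontrivial_solution[of N "\<lambda>i j. hcoeff (eigenvector j) i"] by blast
  define f where "f = (\<Sum>j\<le>N. cscale (c j) (eigenvector j))"
  have fj: "cinner f (eigenvector j) = (if j \<le> N then c j else 0)" for j
    by (simp add: f_def cinner_sum_left cinner_cscale_left cinner_eigenvector if_distrib cong: if_cong)
  have "f \<noteq> 0"
    using c(1) fj by (metis cinner_zero_left)
  have "tail (Suc N) f = 0"
    unfolding tail_def lessThan_Suc_atMost by (simp add: fj) (simp add: f_def)
  then have nf: "(norm f)\<^sup>2 = (\<Sum>n<Suc N. (cmod (cinner f (eigenvector n)))\<^sup>2)"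
    and nTf: "(norm (T f))\<^sup>2 = (\<Sum>n<Suc N. (sing n)\<^sup>2 * (cmod (cinner f (eigenvector n)))\<^sup>2)"
    using norm_sq_decomp[of f "Suc N"] norm_T_sq_decomp[of f "Suc N"] by (simp_all add: zero)
  have "(sing N * norm f)\<^sup>2 \<le> (norm (T f))\<^sup>2"
    unfolding power_mult_distrib nf nTf sum_distrib_left
    using decseq_sing sing_pos[of N] by (intro sum_mono mult_right_mono power_mono) (auto simp: decseq_def)
  then have "sing N * norm f \<le> norm (T f)"
    by (rule power2_le_imp_le) simp
  also have "\<dots> \<le> B * norm f"
    using c(2) by (intro B) (simp add: f_def)
  finally show ?thesis
    using \<open>f \<noteq> 0\<close> by (simp add: singular_numbers_eq)
qed

lemma Bessel_sum:
  fixes e :: "nat \<Rightarrow> hardy2"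
  assumes e: "\<And>m n. cinner (e m) (e n) = (if m = n then 1 else 0)"
  shows "(\<Sum>m<M. (cmod (cinner (e m) f))\<^sup>2) \<le> (norm f)\<^sup>2"
proof -
  define p where "p = (\<Sum>m<M. cscale (cinner f (e m)) (e m))"
  have pp: "cinner f p = of_real (\<Sum>m<M. (cmod (cinner (e m) f))\<^sup>2)"
    unfolding p_def cinner_sum_right cinner_cscale_right of_real_sum complex_norm_square
    using cinner_commute[of f] by (simp add: mult.commute)
  have "cinner p p = cinner f p"
    unfolding p_def cinner_sum_left cinner_sum_right cinner_cscale_left cinner_cscale_right e
    by (intro sum.cong refl) (simp add: if_distrib cong: if_cong)
  then have "(norm p)\<^sup>2 = (\<Sum>m<M. (cmod (cinner (e m) f))\<^sup>2)"
    by (simp add: norm_sq_Re_cinner pp)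
  moreover have "cinner (f - p) p = 0"
    using \<open>cinner p p = cinner f p\<close> by (simp add: cinner_diff_left)
  then have "(norm f)\<^sup>2 = (norm (f - p))\<^sup>2 + (norm p)\<^sup>2"
    using norm_add_sq_orthogonal[of "f - p" p] by simp
  ultimately show ?thesis
    by simp
qed

text \<open>The tangent line of \<open>x \<mapsto> x ^ q\<close> at \<open>\<parallel>T e\<parallel>\<^sup>2\<close> gives the instance of Jensen's inequality
  needed here.\<close>

lemma norm_T_power_le_suminf:
  assumes sum: "summable (\<lambda>n. (sing n) ^ (2 * q))" and q: "q \<ge> 1" and e: "norm e = 1"
  shows "summable (\<lambda>n. sing n ^ (2 * q) * (cmod (cinner e (eigenvector n)))\<^sup>2)"
    and "((norm (T e))\<^sup>2) ^ q \<le> (\<Sum>n. sing n ^ (2 * q) * (cmod (cinner e (eigenvector n)))\<^sup>2)"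
proof -
  define w where "w n = (cmod (cinner e (eigenvector n)))\<^sup>2" for n
  define b where "b = (norm (T e))\<^sup>2"
  have w1: "w n \<le> 1" for n
    using cinner_Cauchy_Schwarz[of e "eigenvector n"]
    by (simp add: w_def e norm_eigenvector abs_square_le_1)
  have wle: "(\<Sum>n<N. w n) \<le> 1" for N
    using norm_sq_decomp[of e N] zero_le_power2[of "norm (tail N e)"] unfolding w_def e one_power2 by linarith
  have sw: "summable w"
    by (rule summableI_nonneg_bounded[of _ 1]) (use wle in \<open>auto simp: w_def\<close>)
  have W: "suminf w \<le> 1"
    by (rule suminf_le_const[OF sw wle])
  show s1: "summable (\<lambda>n. sing n ^ (2 * q) * (cmod (cinner e (eigenvector n)))\<^sup>2)"
  proof (rule summable_comparison_test'[OF sum])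
    show "norm (sing n ^ (2 * q) * (cmod (cinner e (eigenvector n)))\<^sup>2) \<le> sing n ^ (2 * q)" for n
      using w1[of n] sing_pos[of n] by (simp add: w_def mult_left_le power_mult)
  qed
  have b: "(\<lambda>n. (sing n)\<^sup>2 * w n) sums b"
    unfolding b_def w_def by (rule norm_T_sums)
  have tangent: "b ^ q + q * b ^ (q - 1) * (x - b) \<le> x ^ q" if "x \<ge> 0" for x :: real
  proof (cases "b = 0")
    case True
    then show ?thesis
      using that q by (cases "q = 1") (auto simp: power_0_left)
  next
    case False
    then have b0: "b > 0"
      by (simp add: b_def)
    have "1 + of_nat q * (x / b - 1) \<le> (1 + (x / b - 1)) ^ q"
      using that b0 by (intro Bernoulli_inequality) (simp add: field_simps)
    then have "b ^ q * (1 + q * (x / b - 1)) \<le> b ^ q * (x / b) ^ q"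
      using b0 by (intro mult_left_mono) auto
    also have "b ^ q * (x / b) ^ q = x ^ q"
      using b0 by (simp add: power_divide)
    also have "b ^ q * (1 + q * (x / b - 1)) = b ^ q + q * b ^ (q - 1) * (x - b)"
    proof -
      have "b ^ q = b ^ (q - 1) * b"
        using q by (simp add: power_eq_if)
      then show ?thesis
        using b0 by (simp add: field_simps)
    qed
    finally show ?thesis .
  qed
  have "(\<lambda>n. (b ^ q - q * b ^ q) * w n + q * b ^ (q - 1) * ((sing n)\<^sup>2 * w n))
      sums ((b ^ q - q * b ^ q) * suminf w + q * b ^ (q - 1) * b)"
    by (intro sums_add sums_mult b summable_sums sw)
  moreover have "(\<Sum>n. sing n ^ (2 * q) * w n) \<ge> suminf (\<lambda>n. (b ^ q - q * b ^ q) * w n + q * b ^ (q - 1) * ((sing n)\<^sup>2 * w n))"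
  proof (rule suminf_le)
    show "summable (\<lambda>n. sing n ^ (2 * q) * w n)"
      using s1 by (simp add: w_def)
    show "summable (\<lambda>n. (b ^ q - q * b ^ q) * w n + q * b ^ (q - 1) * ((sing n)\<^sup>2 * w n))"
      using calculation by (auto simp: sums_iff)
    show "(b ^ q - q * b ^ q) * w n + q * b ^ (q - 1) * ((sing n)\<^sup>2 * w n) \<le> sing n ^ (2 * q) * w n" for n
    proof -
      have "b ^ q = b ^ (q - 1) * b"
        using q by (simp add: power_eq_if)
      then have "(b ^ q - q * b ^ q) * w n + q * b ^ (q - 1) * ((sing n)\<^sup>2 * w n)
          = (b ^ q + q * b ^ (q - 1) * ((sing n)\<^sup>2 - b)) * w n"
        by (simp add: algebra_simps)
      also have "\<dots> \<le> ((sing n)\<^sup>2) ^ q * w n"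
        by (intro mult_right_mono tangent) (auto simp: w_def)
      finally show ?thesis
        by (simp add: power_mult)
    qed
  qed
  ultimately have "(b ^ q - q * b ^ q) * suminf w + q * b ^ (q - 1) * b \<le> (\<Sum>n. sing n ^ (2 * q) * w n)"
    by (simp add: sums_iff)
  moreover have "b ^ q = b ^ (q - 1) * b"
    using q by (simp add: power_eq_if)
  \<comment> \<open>Only \<open>suminf w \<le> 1\<close> is known; as q >= 1, a deficit acts in
    favour of the claimed inequality.\<close>
  moreover have "(q * b ^ q - b ^ q) * suminf w \<le> (q * b ^ q - b ^ q) * 1"
  proof (rule mult_left_mono[OF W])
    have "1 * b ^ q \<le> q * b ^ q"
      using q by (intro mult_right_mono) (auto simp: b_def)
    then show "0 \<le> q * b ^ q - b ^ q"
      by simp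
  qed
  ultimately have "b ^ q \<le> (\<Sum>n. sing n ^ (2 * q) * w n)"
    by (simp add: algebra_simps)
  then show "((norm (T e))\<^sup>2) ^ q \<le> (\<Sum>n. sing n ^ (2 * q) * (cmod (cinner e (eigenvector n)))\<^sup>2)"
    by (simp add: b_def w_def)
qed

text \<open>After the two sums are exchanged, Bessel's inequality for \<open>e\<close> applied to
  the n-th eigenvector bounds the total weight of its singular number by 1.\<close>

lemma summable_norm_T_orthonormal:
  assumes sum: "summable (\<lambda>n. (sing n) ^ (2 * q))" and q: "q \<ge> 1"
    and e: "\<And>m n. cinner (e m) (e n) = (if m = n then 1 else 0)"
  shows "summable (\<lambda>m. ((norm (T (e m)))\<^sup>2) ^ q)"
proof (rule summableI_nonneg_bounded)
  have norm_e: "norm (e m) = 1" for m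
    using norm_sq_Re_cinner[of "e m"] e[of m m] norm_ge_zero[of "e m"] by (auto simp: power2_eq_1_iff)
  fix M
  let ?c = "\<lambda>m n. (cmod (cinner (e m) (eigenvector n)))\<^sup>2"
  have "(\<Sum>m<M. ((norm (T (e m)))\<^sup>2) ^ q) \<le> (\<Sum>m<M. \<Sum>n. sing n ^ (2 * q) * ?c m n)"
    by (intro sum_mono norm_T_power_le_suminf[OF sum q norm_e])
  also have "\<dots> = (\<Sum>n. \<Sum>m<M. sing n ^ (2 * q) * ?c m n)"
    by (intro suminf_sum[symmetric] norm_T_power_le_suminf(1)[OF sum q norm_e])
  also have "\<dots> \<le> (\<Sum>n. sing n ^ (2 * q))"
  proof (rule suminf_le[OF _ summable_sum sum])
    show "(\<Sum>m<M. sing n ^ (2 * q) * ?c m n) \<le> sing n ^ (2 * q)" for n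
      unfolding sum_distrib_left[symmetric]
      using Bessel_sum[OF e, where M = M and f = "eigenvector n"] sing_pos[of n]
      by (intro mult_left_le) (auto simp: norm_eigenvector)
  qed (rule norm_T_power_le_suminf(1)[OF sum q norm_e])
  finally show "(\<Sum>m<M. ((norm (T (e m)))\<^sup>2) ^ q) \<le> (\<Sum>n. sing n ^ (2 * q))" .
qed (rule zero_le_power, simp)

text \<open>Singular numbers are eventually below 1, so p may be raised to an even integer 2 q, for
  which the tangent line argument works with ordinary powers.\<close>

lemma schatten_summable_norm_orthonormal:
  assumes "T \<in> schatten_class p" "p > 0"
    and q: "q \<ge> 1" "p \<le> 2 * real q"
    and e: "\<And>m n. cinner (e m) (e n) = (if m = n then 1 else 0)"
  shows "summable (\<lambda>m. ((norm (T (e m)))\<^sup>2) ^ q)"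
proof (rule summable_norm_T_orthonormal[OF _ q(1) e])
  have s: "summable (\<lambda>n. sing n powr p)"
    using assms(1) by (simp add: schatten_class_def singular_numbers_eq)
  have "\<forall>\<^sub>F n in sequentially. sing n < 1"
    using sing_tendsto_0 by (intro order_tendstoD) auto
  then have "\<forall>\<^sub>F n in sequentially. norm (sing n ^ (2 * q)) \<le> sing n powr p"
  proof eventually_elim
    case (elim n)
    have "sing n ^ (2 * q) = sing n powr (2 * q)"
      using sing_pos[of n] by (subst powr_realpow) auto
    also have "\<dots> \<le> sing n powr p"
      using q(2) sing_pos[of n] elim by (intro powr_mono') auto
    finally show ?case
      using sing_pos[of n] by simp
  qed
  then show "summable (\<lambda>n. sing n ^ (2 * q))"
    by (rule summable_comparison_test_ev) (rule s)
qed

end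


section \<open>Boundary values and composition operators\<close>

text \<open>Angles in [-pi, pi] put the contact point 1 at the interior point 0 and make t -> - t a
  symmetry. The measure is not normalised, hence the factors 2 pi.\<close>

definition circle_measure :: "real measure" where
  "circle_measure = restrict_space lborel {-pi..pi}"

lemma space_circle_measure [simp]: "space circle_measure = {-pi..pi}"
  by (simp add: circle_measure_def space_restrict_space)

lemma emeasure_circle_measure: "emeasure circle_measure {-pi..pi} = ennreal (2 * pi)"
  by (simp add: circle_measure_def emeasure_restrict_space)

lemma finite_measure_circle: "finite_measure circle_measure"
  by (rule finite_measureI) (simp add: emeasure_circle_measure)

lemma continuous_on_measurable_circle:
  fixes f :: "real \<Rightarrow> 'b::topological_space"
  shows "continuous_on {-pi..pi} f \<Longrightarrow> f \<in> borel_measurable circle_measure"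
  unfolding circle_measure_def using borel_measurable_continuous_on_restrict
  by (metis measurable_lborel1 measurable_cong_sets sets_lborel sets_restrict_space_cong)

lemma borel_measurable_circle:
  "f \<in> borel_measurable borel \<Longrightarrow> f \<in> borel_measurable circle_measure"
  unfolding circle_measure_def by (intro measurable_restrict_space1) simp

lemma integrable_circle_bounded:
  fixes f :: "real \<Rightarrow> 'b::{banach, second_countable_topology}"
  assumes "f \<in> borel_measurable circle_measure" "\<And>t. t \<in> {-pi..pi} \<Longrightarrow> norm (f t) \<le> B"
  shows "integrable circle_measure f"
proof -
  interpret finite_measure circle_measure by (rule finite_measure_circle)
  show ?thesis
    by (rule integrable_const_bound[of _ B]) (use assms in auto)
qed

lemma integral_cis_circle:
  "(\<integral>t. cis (of_int k * t) \<partial>circle_measure) = (if k = 0 then of_real (2 * pi) else 0)"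
proof (cases "k = 0")
  case True
  then show ?thesis
    by (simp add: measure_def emeasure_circle_measure scaleR_conv_of_real)
next
  case False
  have "(\<integral>t. cis (of_int k * t) \<partial>circle_measure)
      = (\<integral>t. indicator {-pi..pi} t *\<^sub>R cis (of_int k * t) \<partial>lborel)"
    unfolding circle_measure_def by (subst integral_restrict_space) auto
  also have "\<dots> = cis (of_int k * pi) / (\<i> * of_int k) - cis (of_int k * (- pi)) / (\<i> * of_int k)"
  proof (rule integral_FTC_atLeastAtMost)
    fix t
    have "((\<lambda>z. exp (\<i> * of_int k * z) / (\<i> * of_int k)) has_field_derivative exp (\<i> * of_int k * of_real t))
        (at (of_real t))"
      using False by (auto intro!: derivative_eq_intros)
    from has_vector_derivative_real_field[OF this, of "{-pi..pi}"]
    show "((\<lambda>t. cis (of_int k * t) / (\<i> * of_int k)) has_vector_derivative cis (of_int k * t))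
        (at t within {-pi..pi})"
      by (simp add: cis_conv_exp mult.assoc)
  next
    show "continuous_on {-pi..pi} (\<lambda>t. cis (of_int k * t))"
      by (intro continuous_intros)
  qed simp
  also have "cis (of_int k * (- pi)) = cis (of_int k * pi)"
    by (simp add: complex_eq_iff sin_times_pi_eq_0)
  finally show ?thesis
    using False by simp
qed

lemma integral_norm_sq_trig_poly:
  "(\<integral>t. (cmod (\<Sum>n<N. c n * cis (real n * t)))\<^sup>2 \<partial>circle_measure) = 2 * pi * (\<Sum>n<N. (cmod (c n))\<^sup>2)"
proof -
  have int: "integrable circle_measure (\<lambda>t. a * cis (of_int k * t))" for a k
    by (rule integrable_circle_bounded[of _ "cmod a"])
       (auto simp: norm_mult intro!: continuous_on_measurable_circle continuous_intros)
  have eq: "of_real ((cmod (\<Sum>n<N. c n * cis (real n * t)))\<^sup>2)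
      = (\<Sum>m<N. \<Sum>n<N. (c m * cnj (c n)) * cis (of_int (int m - int n) * t))" for t
    unfolding complex_norm_square cnj_sum sum_product
  proof (intro sum.cong refl)
    fix m n
    have "cis (real m * t) * cnj (cis (real n * t)) = cis (of_int (int m - int n) * t)"
      by (simp add: cis_cnj cis_mult left_diff_distrib)
    then show "c m * cis (real m * t) * cnj (c n * cis (real n * t))
        = c m * cnj (c n) * cis (of_int (int m - int n) * t)"
      by (simp add: mult_ac)
  qed
  have "of_real (\<integral>t. (cmod (\<Sum>n<N. c n * cis (real n * t)))\<^sup>2 \<partial>circle_measure)
      = (\<integral>t. of_real ((cmod (\<Sum>n<N. c n * cis (real n * t)))\<^sup>2) \<partial>circle_measure :: complex)"
    by (rule integral_complex_of_real[symmetric])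
  also have "\<dots> = (\<Sum>m<N. \<Sum>n<N. (c m * cnj (c n)) * (if int m - int n = 0 then of_real (2 * pi) else 0))"
  proof -
    have "(\<integral>t. (\<Sum>m<N. \<Sum>n<N. (c m * cnj (c n)) * cis (of_int (int m - int n) * t)) \<partial>circle_measure)
        = (\<Sum>m<N. \<integral>t. (\<Sum>n<N. (c m * cnj (c n)) * cis (of_int (int m - int n) * t)) \<partial>circle_measure)"
      by (intro Bochner_Integration.integral_sum Bochner_Integration.integrable_sum int)
    also have "\<dots> = (\<Sum>m<N. \<Sum>n<N. \<integral>t. (c m * cnj (c n)) * cis (of_int (int m - int n) * t) \<partial>circle_measure)"
      by (intro sum.cong refl Bochner_Integration.integral_sum int)
    finally show ?thesis
      unfolding eq by (simp only: integral_mult_right_zero integral_cis_circle)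
  qed
  also have "\<dots> = of_real (2 * pi * (\<Sum>n<N. (cmod (c n))\<^sup>2))"
    unfolding of_real_mult of_real_sum complex_norm_square
    by (simp add: if_distrib[of "\<lambda>x. _ * x"] sum_distrib_left mult_ac cong: if_cong)
  finally show ?thesis
    unfolding of_real_eq_iff .
qed

lemma Parseval_circle:
  assumes g: "g holomorphic_on ball 0 1" and r: "0 \<le> r" "r < 1"
  shows "(\<lambda>n. (cmod (taylor_coeff g n))\<^sup>2 * r ^ (2 * n))
    sums ((\<integral>t. (cmod (g (of_real r * cis t)))\<^sup>2 \<partial>circle_measure) / (2 * pi))"
proof -
  define c where "c n = taylor_coeff g n * of_real r ^ n" for n
  have gs: "(\<lambda>n. taylor_coeff g n * z ^ n) sums g z" if "cmod z < 1" for z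
    using holomorphic_power_series[OF g, of z] that by (simp add: taylor_coeff_def)
  have cs: "(\<lambda>n. c n * cis (real n * t)) sums g (of_real r * cis t)" for t
    using gs[of "of_real r * cis t"] r by (simp add: c_def norm_mult power_mult_distrib Complex.DeMoivre mult.assoc)
  have sc: "summable (\<lambda>n. cmod (c n))"
  proof -
    \<comment> \<open>A radius strictly between r and 1: convergence there gives absolute
      convergence at r.\<close>
    define z :: complex where "z = of_real ((r + 1) / 2)"
    have "summable (\<lambda>n. taylor_coeff g n * z ^ n)"
      using gs[of z] r by (auto simp: z_def sums_iff simp del: of_real_divide of_real_add)
    from powser_insidea[OF this, of "of_real r"] show ?thesis
      using r by (simp add: z_def c_def del: of_real_divide of_real_add)
  qed
  have le: "cmod (\<Sum>n<N. c n * cis (real n * t)) \<le> (\<Sum>n. cmod (c n))" for N t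
  proof -
    have "cmod (\<Sum>n<N. c n * cis (real n * t)) \<le> (\<Sum>n<N. cmod (c n))"
      by (rule order_trans[OF norm_sum]) (simp add: norm_mult)
    also have "\<dots> \<le> (\<Sum>n. cmod (c n))"
      by (rule sum_le_suminf[OF sc]) auto
    finally show ?thesis .
  qed
  have "(\<lambda>N. \<integral>t. (cmod (\<Sum>n<N. c n * cis (real n * t)))\<^sup>2 \<partial>circle_measure)
      \<longlonglongrightarrow> (\<integral>t. (cmod (g (of_real r * cis t)))\<^sup>2 \<partial>circle_measure)"
  proof (rule integral_dominated_convergence[where w = "\<lambda>_. (\<Sum>n. cmod (c n))\<^sup>2"])
    show "(\<lambda>t. (cmod (g (of_real r * cis t)))\<^sup>2) \<in> borel_measurable circle_measure"
    proof (intro continuous_on_measurable_circle continuous_intros)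
      have "continuous_on (ball 0 1) g"
        using g by (rule holomorphic_on_imp_continuous_on)
      then show "continuous_on {-pi..pi} (\<lambda>t. g (of_real r * cis t))"
        by (rule continuous_on_compose2) (use r in \<open>auto intro!: continuous_intros simp: norm_mult\<close>)
    qed
    show "(\<lambda>t. (cmod (\<Sum>n<N. c n * cis (real n * t)))\<^sup>2) \<in> borel_measurable circle_measure" for N
      by (intro continuous_on_measurable_circle continuous_intros)
    show "integrable circle_measure (\<lambda>_. (\<Sum>n. cmod (c n))\<^sup>2)"
      by (rule integrable_circle_bounded[of _ "norm ((\<Sum>n. cmod (c n))\<^sup>2)"]) auto
    show "AE t in circle_measure. (\<lambda>N. (cmod (\<Sum>n<N. c n * cis (real n * t)))\<^sup>2) \<longlonglongrightarrow> (cmod (g (of_real r * cis t)))\<^sup>2"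
      using cs unfolding sums_def by (intro AE_I2 tendsto_intros)
    show "AE t in circle_measure. norm ((cmod (\<Sum>n<N. c n * cis (real n * t)))\<^sup>2) \<le> (\<Sum>n. cmod (c n))\<^sup>2" for N
      using le by (intro AE_I2) (simp add: power_mono)
  qed
  then have "(\<lambda>N. 2 * pi * (\<Sum>n<N. (cmod (c n))\<^sup>2) / (2 * pi))
      \<longlonglongrightarrow> (\<integral>t. (cmod (g (of_real r * cis t)))\<^sup>2 \<partial>circle_measure) / (2 * pi)"
    unfolding integral_norm_sq_trig_poly by (intro tendsto_intros) auto
  then show ?thesis
    using r by (simp add: sums_def c_def norm_mult norm_power power_mult_distrib power_mult mult.commute)
qed

text \<open>Parseval on circles of radius \<open>r k\<close> tending to 1: the integrals converge by
  dominated convergence, finite coefficient sums converge termwise, and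
  \<open>r k ^ (2 * n) \<le> 1\<close> gives the opposite inequality.\<close>

lemma boundary_norm_sums:
  assumes g: "g holomorphic_on ball 0 1" and bd: "\<And>z. cmod z < 1 \<Longrightarrow> cmod (g z) \<le> B"
    and lim: "AE t in circle_measure. ((\<lambda>r. g (of_real r * cis t)) \<longlongrightarrow> G t) (at_left 1)"
    and G: "G \<in> borel_measurable circle_measure"
  shows "(\<lambda>n. (cmod (taylor_coeff g n))\<^sup>2) sums ((\<integral>t. (cmod (G t))\<^sup>2 \<partial>circle_measure) / (2 * pi))"
proof -
  define r where "r k = 1 - 1 / (real k + 2)" for k
  have r: "0 \<le> r k" "r k < 1" for k
    by (auto simp: r_def field_simps)
  have r1: "r \<longlonglongrightarrow> 1"
    unfolding r_def by real_asymp
  have rl: "filterlim r (at_left 1) sequentially"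
    using r1 r(2) by (intro filterlim_at_withinI) auto
  define A where "A = (\<integral>t. (cmod (G t))\<^sup>2 \<partial>circle_measure) / (2 * pi)"
  define Ak where "Ak k = (\<integral>t. (cmod (g (of_real (r k) * cis t)))\<^sup>2 \<partial>circle_measure) / (2 * pi)" for k
  have P: "(\<lambda>n. (cmod (taylor_coeff g n))\<^sup>2 * r k ^ (2 * n)) sums Ak k" for k
    unfolding Ak_def by (rule Parseval_circle[OF g r])
  have Ak: "Ak \<longlonglongrightarrow> A"
    unfolding Ak_def A_def
  proof (intro tendsto_divide tendsto_const)
    show "(\<lambda>k. \<integral>t. (cmod (g (of_real (r k) * cis t)))\<^sup>2 \<partial>circle_measure)
        \<longlonglongrightarrow> (\<integral>t. (cmod (G t))\<^sup>2 \<partial>circle_measure)"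
    proof (rule integral_dominated_convergence[where w = "\<lambda>_. B\<^sup>2"])
      show "(\<lambda>t. (cmod (G t))\<^sup>2) \<in> borel_measurable circle_measure"
        using G by measurable
      show "(\<lambda>t. (cmod (g (of_real (r k) * cis t)))\<^sup>2) \<in> borel_measurable circle_measure" for k
      proof (intro continuous_on_measurable_circle continuous_intros)
        have "continuous_on (ball 0 1) g"
          using g by (rule holomorphic_on_imp_continuous_on)
        then show "continuous_on {-pi..pi} (\<lambda>t. g (of_real (r k) * cis t))"
          by (rule continuous_on_compose2) (use r in \<open>auto intro!: continuous_intros simp: norm_mult\<close>)
      qed
      show "integrable circle_measure (\<lambda>_. B\<^sup>2)"
        by (rule integrable_circle_bounded[of _ "norm (B\<^sup>2)"]) auto
      show "AE t in circle_measure. (\<lambda>k. (cmod (g (of_real (r k) * cis t)))\<^sup>2) \<longlonglongrightarrow> (cmod (G t))\<^sup>2"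
        using lim
      proof eventually_elim
        case (elim t)
        show ?case
          by (intro tendsto_intros filterlim_compose[OF elim rl])
      qed
      show "AE t in circle_measure. norm ((cmod (g (of_real (r k) * cis t)))\<^sup>2) \<le> B\<^sup>2" for k
      proof (intro AE_I2)
        fix t
        have "cmod (g (of_real (r k) * cis t)) \<le> B"
          using r by (intro bd) (simp add: norm_mult)
        then show "norm ((cmod (g (of_real (r k) * cis t)))\<^sup>2) \<le> B\<^sup>2"
          by (simp add: power_mono)
      qed
    qed
  qed auto
  have partial: "(\<Sum>n<N. (cmod (taylor_coeff g n))\<^sup>2) \<le> A" for N
  proof (rule LIMSEQ_le[OF _ Ak])
    have "(\<lambda>k. \<Sum>n<N. (cmod (taylor_coeff g n))\<^sup>2 * r k ^ (2 * n))
        \<longlonglongrightarrow> (\<Sum>n<N. (cmod (taylor_coeff g n))\<^sup>2 * 1 ^ (2 * n))"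
      by (intro tendsto_intros r1)
    then show "(\<lambda>k. \<Sum>n<N. (cmod (taylor_coeff g n))\<^sup>2 * r k ^ (2 * n))
        \<longlonglongrightarrow> (\<Sum>n<N. (cmod (taylor_coeff g n))\<^sup>2)"
      by simp
    have "(\<Sum>n<N. (cmod (taylor_coeff g n))\<^sup>2 * r k ^ (2 * n)) \<le> Ak k" for k
    proof -
      have "(\<Sum>n<N. (cmod (taylor_coeff g n))\<^sup>2 * r k ^ (2 * n))
          \<le> (\<Sum>n. (cmod (taylor_coeff g n))\<^sup>2 * r k ^ (2 * n))"
        using P[of k] r(1)[of k] by (intro sum_le_suminf) (auto simp: sums_iff)
      then show ?thesis
        using P[of k] by (simp add: sums_iff)
    qed
    then show "\<exists>M. \<forall>k\<ge>M. (\<Sum>n<N. (cmod (taylor_coeff g n))\<^sup>2 * r k ^ (2 * n)) \<le> Ak k"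
      by blast
  qed
  have s: "summable (\<lambda>n. (cmod (taylor_coeff g n))\<^sup>2)"
    by (rule summableI_nonneg_bounded[OF _ partial]) simp
  have "Ak k \<le> (\<Sum>n. (cmod (taylor_coeff g n))\<^sup>2)" for k
    using P[of k] r[of k] unfolding sums_iff
    by (metis (no_types, lifting) s suminf_le mult_left_le power_le_one less_imp_le zero_le_power2)
  then have "A \<le> (\<Sum>n. (cmod (taylor_coeff g n))\<^sup>2)"
    by (intro LIMSEQ_le_const2[OF Ak]) auto
  moreover have "(\<Sum>n. (cmod (taylor_coeff g n))\<^sup>2) \<le> A"
    by (rule suminf_le_const[OF s partial])
  ultimately show ?thesis
    using s by (simp add: A_def sums_iff)
qed

section \<open>Composition operators computed from boundary values\<close>

lemma Rep_hardy2_add: "Rep_hardy2 (f + g) z = Rep_hardy2 f z + Rep_hardy2 g z"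
  by (simp add: plus_hardy2.rep_eq)

lemma Rep_hardy2_diff: "Rep_hardy2 (f - g) z = Rep_hardy2 f z - Rep_hardy2 g z"
  using Rep_hardy2_add[of "f - g" g z] by simp

lemma Rep_hardy2_sum: "Rep_hardy2 (\<Sum>i\<in>A. f i) z = (\<Sum>i\<in>A. Rep_hardy2 (f i) z)"
  by (induction A rule: infinite_finite_induct) (auto simp: Rep_hardy2_add zero_hardy2.rep_eq)

lemma tendsto_Rep_hardy2:
  assumes "X \<longlonglongrightarrow> f" "cmod z < 1"
  shows "(\<lambda>n. Rep_hardy2 (X n) z) \<longlonglongrightarrow> Rep_hardy2 f z"
proof -
  have "(\<lambda>n. norm (X n - f) / (1 - cmod z)) \<longlonglongrightarrow> 0"
    using assms(1) by (intro tendsto_divide_zero) (simp add: LIM_zero_iff tendsto_norm_zero)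
  then have "(\<lambda>n. Rep_hardy2 (X n) z - Rep_hardy2 f z) \<longlonglongrightarrow> 0"
    by (rule Lim_null_comparison[rotated])
       (use hardy2_eval_bound[OF assms(2)] in \<open>auto simp flip: Rep_hardy2_diff\<close>)
  then show ?thesis
    by (simp add: LIM_zero_iff)
qed

definition hpoly :: "(nat \<Rightarrow> complex) \<Rightarrow> nat \<Rightarrow> hardy2" where
  "hpoly a n = (\<Sum>k<n. cscale (a k) (hmonom k))"

lemma Rep_hpoly: "cmod z < 1 \<Longrightarrow> Rep_hardy2 (hpoly a n) z = (\<Sum>k<n. a k * z ^ k)"
  by (simp add: hpoly_def Rep_hardy2_sum cscale.rep_eq Rep_hmonom)

lemma hcoeff_hpoly: "hcoeff (hpoly a n) k = (if k < n then a k else 0)"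
  by (simp add: hpoly_def if_distrib cong: if_cong)

lemma norm_hpoly: "(norm (hpoly a n))\<^sup>2 = (\<Sum>k<n. (cmod (a k))\<^sup>2)"
  unfolding hardy2_norm_sq hcoeff_hpoly by (subst suminf_finite[of "{..<n}"]) auto

lemma hpoly_tendsto: "hpoly (hcoeff f) \<longlonglongrightarrow> f"
  using hardy2_partial_sums[of f] by (simp add: hpoly_def[abs_def])

text \<open>\<open>\<Phi>\<close> is the boundary function in the angle t. Only polynomials in it
  are integrated over the circle; general f are reached by density of polynomials.\<close>

locale boundary_map =
  fixes \<phi> :: "complex \<Rightarrow> complex" and \<Phi> :: "real \<Rightarrow> complex"
  assumes holo: "\<phi> holomorphic_on ball 0 1"
    and self_map: "\<And>z. cmod z < 1 \<Longrightarrow> cmod (\<phi> z) < 1"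
    and radial: "AE t in circle_measure. ((\<lambda>r. \<phi> (of_real r * cis t)) \<longlongrightarrow> \<Phi> t) (at_left 1)"
    and meas: "\<Phi> \<in> borel_measurable circle_measure"
begin

abbreviation "composite f \<equiv> (\<lambda>z. if z \<in> ball 0 1 then Rep_hardy2 f (\<phi> z) else 0)"

lemma composite_hpoly:
  "composite (hpoly a n) \<in> hardy_space"
  "(norm (composition_operator \<phi> (hpoly a n)))\<^sup>2
     = (\<integral>t. (cmod (\<Sum>k<n. a k * \<Phi> t ^ k))\<^sup>2 \<partial>circle_measure) / (2 * pi)"
proof -
  have eq: "composite (hpoly a n) z = (\<Sum>k<n. a k * \<phi> z ^ k)" if "cmod z < 1" for z
    using that self_map by (simp add: Rep_hpoly)
  have h: "composite (hpoly a n) holomorphic_on ball 0 1"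
  proof (rule holomorphic_transform)
    show "(\<lambda>z. \<Sum>k<n. a k * \<phi> z ^ k) holomorphic_on ball 0 1"
      by (intro holomorphic_intros holo)
  qed (use eq in auto)
  have sums: "(\<lambda>j. (cmod (taylor_coeff (composite (hpoly a n)) j))\<^sup>2)
      sums ((\<integral>t. (cmod (\<Sum>k<n. a k * \<Phi> t ^ k))\<^sup>2 \<partial>circle_measure) / (2 * pi))"
  proof (rule boundary_norm_sums[OF h])
    show "cmod (composite (hpoly a n) z) \<le> (\<Sum>k<n. cmod (a k))" if "cmod z < 1" for z
    proof -
      have "cmod (a k * \<phi> z ^ k) \<le> cmod (a k)" for k
        using self_map[OF that] by (simp add: norm_mult norm_power mult_left_le power_le_one)
      then show ?thesis
        unfolding eq[OF that] by (intro order_trans[OF norm_sum] sum_mono)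
    qed
    show "AE t in circle_measure. ((\<lambda>r. composite (hpoly a n) (of_real r * cis t)) \<longlongrightarrow> (\<Sum>k<n. a k * \<Phi> t ^ k)) (at_left 1)"
      using radial
    proof eventually_elim
      case (elim t)
      have "((\<lambda>r. \<Sum>k<n. a k * \<phi> (of_real r * cis t) ^ k) \<longlongrightarrow> (\<Sum>k<n. a k * \<Phi> t ^ k)) (at_left 1)"
        by (intro tendsto_intros elim)
      moreover have "\<forall>\<^sub>F r in at_left (1::real). r \<in> {0<..<1}"
        by (rule eventually_at_left_real) auto
      then have "\<forall>\<^sub>F r in at_left 1. (\<Sum>k<n. a k * \<phi> (of_real r * cis t) ^ k)
          = composite (hpoly a n) (of_real r * cis t)"
        by eventually_elim (subst eq, auto simp: norm_mult)
      ultimately show ?case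
        by (rule Lim_transform_eventually)
    qed
    show "(\<lambda>t. \<Sum>k<n. a k * \<Phi> t ^ k) \<in> borel_measurable circle_measure"
      using meas by measurable
  qed
  show in_hardy: "composite (hpoly a n) \<in> hardy_space"
    using h sums unfolding hardy_space_def mem_Collect_eq sums_iff by auto
  show "(norm (composition_operator \<phi> (hpoly a n)))\<^sup>2
     = (\<integral>t. (cmod (\<Sum>k<n. a k * \<Phi> t ^ k))\<^sup>2 \<partial>circle_measure) / (2 * pi)"
    using sums unfolding hardy2_norm_sq composition_operator_def hcoeff.rep_eq Abs_hardy2_inverse[OF in_hardy]
    by (simp only: sums_iff)
qed

end

text \<open>The added inequality says that the composition operator is bounded on polynomials, with
  squared norm at most \<open>B0\<close>; the Schur test will provide it.\<close>

locale bounded_boundary_map = boundary_map +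
  fixes B0 :: real
  assumes B0: "B0 \<ge> 0"
    and bound: "\<And>a n. (\<integral>t. (cmod (\<Sum>k<n. a k * \<Phi> t ^ k))\<^sup>2 \<partial>circle_measure) \<le> 2 * pi * B0 * (\<Sum>k<n. (cmod (a k))\<^sup>2)"
begin

lemma composition_hpoly_diff:
  assumes "n \<le> m"
  shows "composition_operator \<phi> (hpoly a m) - composition_operator \<phi> (hpoly a n)
    = composition_operator \<phi> (hpoly (\<lambda>k. if k < n then 0 else a k) m)"
proof (rule hardy2_ext)
  fix z :: complex assume z: "cmod z < 1"
  have "(\<Sum>k<m. a k * \<phi> z ^ k) - (\<Sum>k<n. a k * \<phi> z ^ k) = (\<Sum>k\<in>{..<m} - {..<n}. a k * \<phi> z ^ k)"
    using assms by (intro sum_diff[symmetric]) auto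
  also have "\<dots> = (\<Sum>k<m. (if k < n then 0 else a k) * \<phi> z ^ k)"
    by (rule sum.mono_neutral_cong_left) auto
  finally show "Rep_hardy2 (composition_operator \<phi> (hpoly a m) - composition_operator \<phi> (hpoly a n)) z
      = Rep_hardy2 (composition_operator \<phi> (hpoly (\<lambda>k. if k < n then 0 else a k) m)) z"
    using z self_map[OF z] unfolding Rep_hardy2_diff composition_operator_def Abs_hardy2_inverse[OF composite_hpoly(1)]
    by (simp add: Rep_hpoly)
qed

lemma norm_composition_hpoly: "norm (composition_operator \<phi> (hpoly a n)) \<le> sqrt B0 * norm (hpoly a n)"
proof (rule power2_le_imp_le)
  show "(norm (composition_operator \<phi> (hpoly a n)))\<^sup>2 \<le> (sqrt B0 * norm (hpoly a n))\<^sup>2"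
    unfolding composite_hpoly power_mult_distrib norm_hpoly
    using bound[where a = a and n = n] B0 by (simp add: field_simps)
qed (use B0 in auto)

text \<open>The images of the Taylor polynomials are Cauchy, and continuity of point evaluations
  identifies their limit with the composite. This justifies \<open>Abs_hardy2\<close> in the
  definition of \<open>composition_operator\<close>.\<close>

lemma composition_operator_tendsto:
  shows "composite f \<in> hardy_space"
    and "(\<lambda>n. composition_operator \<phi> (hpoly (hcoeff f) n)) \<longlonglongrightarrow> composition_operator \<phi> f"
proof -
  let ?X = "\<lambda>n. composition_operator \<phi> (hpoly (hcoeff f) n)"
  have le: "norm (?X m - ?X n) \<le> sqrt B0 * norm (hpoly (hcoeff f) m - hpoly (hcoeff f) n)" if "n \<le> m" for m n
  proof -
    have "hpoly (hcoeff f) m - hpoly (hcoeff f) n = hpoly (\<lambda>k. if k < n then 0 else hcoeff f k) m"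
      by (rule hardy2_eqI) (use that in \<open>auto simp: hcoeff_hpoly\<close>)
    then show ?thesis
      using that norm_composition_hpoly by (simp add: composition_hpoly_diff)
  qed
  have "Cauchy ?X"
  proof (rule CauchyI)
    fix e :: real assume e: "e > 0"
    have "Cauchy (hpoly (hcoeff f))"
      using hpoly_tendsto by (rule LIMSEQ_imp_Cauchy)
    \<comment> \<open>The summand 1 avoids a division by zero when \<open>B0\<close> is 0.\<close>
    moreover have "e / (sqrt B0 + 1) > 0"
      using e B0 by (simp add: add_nonneg_pos)
    ultimately obtain M where M: "\<And>m n. m \<ge> M \<Longrightarrow> n \<ge> M \<Longrightarrow>
        norm (hpoly (hcoeff f) m - hpoly (hcoeff f) n) < e / (sqrt B0 + 1)"
      by (meson CauchyD)
    have *: "norm (?X m - ?X n) < e" if "m \<ge> M" "n \<ge> M" "n \<le> m" for m n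
    proof -
      have "norm (?X m - ?X n) \<le> sqrt B0 * norm (hpoly (hcoeff f) m - hpoly (hcoeff f) n)"
        by (rule le[OF that(3)])
      also have "\<dots> \<le> (sqrt B0 + 1) * norm (hpoly (hcoeff f) m - hpoly (hcoeff f) n)"
        by (intro mult_right_mono) auto
      also have "\<dots> < e"
        using M[OF that(1,2)] B0 by (simp add: pos_less_divide_eq add_nonneg_pos mult.commute)
      finally show ?thesis .
    qed
    then show "\<exists>M. \<forall>m\<ge>M. \<forall>n\<ge>M. norm (?X m - ?X n) < e"
      by (metis nle_le norm_minus_commute)
  qed
  then obtain G where G: "?X \<longlonglongrightarrow> G"
    using Cauchy_convergent_iff convergent_def by blast
  have "Rep_hardy2 G z = composite f z" for z
  proof (cases "z \<in> ball 0 1")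
    case True
    then have z: "cmod z < 1" by simp
    have "(\<lambda>n. Rep_hardy2 (?X n) z) \<longlonglongrightarrow> Rep_hardy2 G z"
      by (rule tendsto_Rep_hardy2[OF G z])
    moreover have "Rep_hardy2 (?X n) z = Rep_hardy2 (hpoly (hcoeff f) n) (\<phi> z)" for n
      unfolding composition_operator_def Abs_hardy2_inverse[OF composite_hpoly(1)] using z by simp
    moreover have "(\<lambda>n. Rep_hardy2 (hpoly (hcoeff f) n) (\<phi> z)) \<longlonglongrightarrow> Rep_hardy2 f (\<phi> z)"
      by (rule tendsto_Rep_hardy2[OF hpoly_tendsto self_map[OF z]])
    ultimately show ?thesis
      using True LIMSEQ_unique by auto
  qed (use Rep_hardy2[of G] in \<open>auto simp: hardy_space_def\<close>)
  then have R: "Rep_hardy2 G = composite f"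
    by blast
  then show "composite f \<in> hardy_space"
    using Rep_hardy2[of G] by simp
  have "composition_operator \<phi> f = G"
    unfolding composition_operator_def R[symmetric] by (rule Rep_hardy2_inverse)
  then show "?X \<longlonglongrightarrow> composition_operator \<phi> f"
    using G by simp
qed

lemma Rep_composition_operator:
  "cmod z < 1 \<Longrightarrow> Rep_hardy2 (composition_operator \<phi> f) z = Rep_hardy2 f (\<phi> z)"
  unfolding composition_operator_def Abs_hardy2_inverse[OF composition_operator_tendsto(1)] by simp

lemma linear_composition_operator: "Vector_Spaces.linear cscale cscale (composition_operator \<phi>)"
proof -
  have "composition_operator \<phi> (f + g) = composition_operator \<phi> f + composition_operator \<phi> g" for f g
    by (rule hardy2_ext) (simp add: Rep_composition_operator Rep_hardy2_add)
  moreover have "composition_operator \<phi> (cscale c f) = cscale c (composition_operator \<phi> f)" for c f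
    by (rule hardy2_ext) (simp add: Rep_composition_operator cscale.rep_eq)
  ultimately show ?thesis
    by (simp add: Vector_Spaces.linear_iff hardy2.vector_space_axioms)
qed

lemma norm_composition_le:
  assumes B: "B \<ge> 0"
    and bound: "\<And>a n. (\<And>k. k < N \<Longrightarrow> a k = 0) \<Longrightarrow>
      (\<integral>t. (cmod (\<Sum>k<n. a k * \<Phi> t ^ k))\<^sup>2 \<partial>circle_measure) \<le> 2 * pi * B * (\<Sum>k<n. (cmod (a k))\<^sup>2)"
    and f: "\<And>k. k < N \<Longrightarrow> hcoeff f k = 0"
  shows "norm (composition_operator \<phi> f) \<le> sqrt B * norm f"
proof (rule LIMSEQ_le)
  show "(\<lambda>n. norm (composition_operator \<phi> (hpoly (hcoeff f) n))) \<longlonglongrightarrow> norm (composition_operator \<phi> f)"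
    by (intro tendsto_norm composition_operator_tendsto)
  show "(\<lambda>n. sqrt B * norm (hpoly (hcoeff f) n)) \<longlonglongrightarrow> sqrt B * norm f"
    by (intro tendsto_intros hpoly_tendsto)
  have "norm (composition_operator \<phi> (hpoly (hcoeff f) n)) \<le> sqrt B * norm (hpoly (hcoeff f) n)" for n
  proof (rule power2_le_imp_le)
    show "(norm (composition_operator \<phi> (hpoly (hcoeff f) n)))\<^sup>2 \<le> (sqrt B * norm (hpoly (hcoeff f) n))\<^sup>2"
      unfolding composite_hpoly power_mult_distrib norm_hpoly
      using bound[OF f, where n = n] B by (simp add: field_simps)
  qed (use B in auto)
  then show "\<exists>M. \<forall>n\<ge>M. norm (composition_operator \<phi> (hpoly (hcoeff f) n)) \<le> sqrt B * norm (hpoly (hcoeff f) n)"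
    by blast
qed

text \<open>The image of a nonconstant symbol is open, and a function that vanishes on it vanishes
  on the disc by the identity theorem.\<close>

lemma composition_operator_inj:
  assumes nonconst: "\<not> \<phi> constant_on ball 0 1" and f: "composition_operator \<phi> f = 0"
  shows "f = 0"
proof (rule hardy2_ext)
  fix w :: complex assume w: "cmod w < 1"
  have open_image: "open (\<phi> ` ball 0 1)"
    using holo nonconst by (intro open_mapping_thm[of _ "ball 0 1" "ball 0 1"]) auto
  have zero: "Rep_hardy2 f v = 0" if "v \<in> \<phi> ` ball 0 1" for v
  proof -
    from that obtain z where z: "cmod z < 1" "v = \<phi> z"
      by auto
    then show ?thesis
      using f Rep_composition_operator[OF z(1), of f] by (simp add: zero_hardy2.rep_eq)
  qed
  have "Rep_hardy2 f w = 0"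
  proof (rule analytic_continuation_open[where f = "Rep_hardy2 f" and g = "\<lambda>_. 0" and z = w,
        OF open_image open_ball[of 0 1]])
    show "\<phi> ` ball 0 1 \<noteq> {}"
      by simp
    show "Rep_hardy2 f holomorphic_on ball 0 1"
      using Rep_hardy2[of f] by (simp add: hardy_space_def)
    show "connected (ball (0::complex) 1)"
      by (rule connected_ball)
    show "\<phi> ` ball 0 1 \<subseteq> ball 0 1"
      using self_map by auto
    show "Rep_hardy2 f v = 0" if "v \<in> \<phi> ` ball 0 1" for v
      by (rule zero[OF that])
    show "w \<in> ball 0 1"
      using w by simp
  qed (rule holomorphic_on_const)
  then show "Rep_hardy2 f w = Rep_hardy2 0 w"
    by (simp add: zero_hardy2.rep_eq)
qed

end

text \<open>Up to a small error \<open>T\<close> sees only the Taylor polynomial of degree below N,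
  whose image lies in the compact set \<open>K N\<close>, the image of a polydisc. So the image of
  the unit ball is totally bounded.\<close>

lemma compact_operatorI:
  assumes lin: "Vector_Spaces.linear cscale cscale T"
    and small: "\<And>e. e > 0 \<Longrightarrow> \<exists>N. \<forall>f. (\<forall>k<N. hcoeff f k = 0) \<longrightarrow> norm (T f) \<le> e * norm f"
  shows "compact_operator T"
proof -
  have add: "T (f + g) = T f + T g" and scale: "T (cscale c f) = cscale c (T f)" for f g c
    using lin by (simp_all add: Vector_Spaces.linear_iff)
  have zero: "T 0 = 0"
    using add[of 0 0] by simp
  have sum: "T (\<Sum>i\<in>A. f i) = (\<Sum>i\<in>A. T (f i))" for f and A :: "nat set"
    by (induction A rule: infinite_finite_induct) (auto simp: add zero)
  define K where "K N = {\<Sum>k<N. cscale (a k) (T (hmonom k)) | a. \<forall>k. cmod (a k) \<le> 1}" for N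
  have K: "compact (K N)" for N
  proof (induction N)
    case 0
    have "K 0 = {0}"
      by (auto simp: K_def intro!: exI[of _ "\<lambda>_. 0"])
    then show ?case by simp
  next
    case (Suc N)
    have "K (Suc N) = (\<lambda>(x, c). x + cscale c (T (hmonom N))) ` (K N \<times> cball 0 1)"
    proof safe
      fix x assume "x \<in> K (Suc N)"
      then obtain a where a: "x = (\<Sum>k<Suc N. cscale (a k) (T (hmonom k)))" "\<forall>k. cmod (a k) \<le> 1"
        by (auto simp: K_def)
      show "x \<in> (\<lambda>(x, c). x + cscale c (T (hmonom N))) ` (K N \<times> cball 0 1)"
        by (rule image_eqI[of _ _ "(\<Sum>k<N. cscale (a k) (T (hmonom k)), a N)"])
           (use a in \<open>auto simp: K_def\<close>)
    next
      fix x c assume "x \<in> K N" and c: "c \<in> cball (0::complex) 1"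
      then obtain a where a: "x = (\<Sum>k<N. cscale (a k) (T (hmonom k)))" "\<forall>k. cmod (a k) \<le> 1"
        by (auto simp: K_def)
      show "x + cscale c (T (hmonom N)) \<in> K (Suc N)"
        unfolding K_def by (intro CollectI exI[of _ "a(N := c)"]) (use a c in auto)
    qed
    moreover have "continuous_on (K N \<times> cball 0 1) (\<lambda>(x, c). x + cscale c (T (hmonom N)))"
    proof -
      have "norm (cscale c h - cscale d h) \<le> cmod (c - d) * norm h" for c d h
        by (simp flip: hardy2.scale_left_diff_distrib)
      then have "continuous_on UNIV (\<lambda>c. cscale c (T (hmonom N)))"
        by (intro lipschitz_on_continuous_on[of "norm (T (hmonom N))"] lipschitz_onI)
           (auto simp: dist_norm mult.commute)
      then have "continuous_on (K N \<times> cball 0 1) (\<lambda>p. cscale (snd p) (T (hmonom N)))"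
        by (rule continuous_on_compose2) (auto intro!: continuous_intros)
      then show ?thesis
        unfolding case_prod_unfold by (intro continuous_intros)
    qed
    ultimately show ?case
      using Suc by (metis compact_Times compact_cball compact_continuous_image)
  qed
  have "\<exists>k. finite k \<and> closure (T ` cball 0 1) \<subseteq> (\<Union>x\<in>k. ball x e)" if e: "e > 0" for e
  proof -
    \<comment> \<open>The remainder has norm at most 2, so it contributes e / 4; the net of radius e
      / 4 makes this e / 2. Closed balls survive the passage to the closure and fit into open balls
      of radius e.\<close>
    obtain N where N: "\<And>f. (\<forall>k<N. hcoeff f k = 0) \<Longrightarrow> norm (T f) \<le> e / 8 * norm f"
      using small[of "e / 8"] e by auto
    obtain C where C: "finite C" "K N \<subseteq> (\<Union>x\<in>C. ball x (e / 4))"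
      using K[of N] e unfolding compact_eq_totally_bounded by (metis divide_pos_pos zero_less_numeral)
    have "T ` cball 0 1 \<subseteq> (\<Union>x\<in>C. cball x (e / 2))"
    proof safe
      fix f :: hardy2 assume "f \<in> cball 0 1"
      then have f: "norm f \<le> 1" by simp
      define p where "p = hpoly (hcoeff f) N"
      have "norm p \<le> norm f"
      proof (rule power2_le_imp_le)
        show "(norm p)\<^sup>2 \<le> (norm f)\<^sup>2"
          unfolding p_def norm_hpoly hardy2_norm_sq[of f] by (rule sum_le_suminf[OF summable_hcoeff]) auto
      qed auto
      then have fp: "norm (f - p) \<le> 2"
        using f norm_triangle_ineq4[of f p] by linarith
      have "norm (T (f - p)) \<le> e / 8 * norm (f - p)"
        by (rule N) (simp add: p_def hcoeff_hpoly)
      also have "\<dots> \<le> e / 8 * 2"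
        using fp e by (intro mult_left_mono) auto
      finally have small: "norm (T (f - p)) \<le> e / 4"
        by simp
      have Tf: "T f = T (f - p) + T p"
        using add[of "f - p" p] by simp
      have "T p \<in> K N"
        unfolding K_def p_def hpoly_def sum scale
        using f norm_hcoeff_le[of f] by (intro CollectI exI[of _ "hcoeff f"]) (auto intro: order_trans)
      then obtain x where x: "x \<in> C" "dist x (T p) < e / 4"
        using C(2) by auto
      have "dist x (T f) \<le> e / 2"
        using small x(2) dist_triangle[of x "T f" "T p"] by (simp add: Tf dist_norm norm_minus_commute)
      then show "T f \<in> (\<Union>x\<in>C. cball x (e / 2))"
        using x(1) by auto
    qed
    then have "closure (T ` cball 0 1) \<subseteq> (\<Union>x\<in>C. cball x (e / 2))"
      using C(1) by (intro closure_minimal closed_UN) auto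
    also have "\<dots> \<subseteq> (\<Union>x\<in>C. ball x e)"
      using e by (intro UN_mono) auto
    finally show ?thesis
      using C(1) by blast
  qed
  then have "compact (closure (T ` cball 0 1))"
    unfolding compact_eq_totally_bounded by (auto simp: complete_eq_closed)
  then show ?thesis
    using lin by (simp add: compact_operator_def)
qed


section \<open>A Schur test\<close>

text \<open>The bound is uniform in the upper limit, so the Schur test covers all degrees at once;
  the power of |q| is the gain from vanishing low coefficients.\<close>

lemma norm_sum_power_interval_le:
  fixes q :: complex
  assumes q: "cmod q < 1"
  shows "cmod (\<Sum>n\<in>{N..<n'}. q ^ n) \<le> 2 * (cmod q ^ N / cmod (1 - q))"
proof (cases "N \<le> n'")
  case True
  have "(1 - q) * (\<Sum>n\<in>{N..<n'}. q ^ n) = q ^ N - q ^ n'"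
    using True
  proof (induction n' rule: dec_induct)
    case (step m)
    then have "(1 - q) * (\<Sum>n\<in>{N..<Suc m}. q ^ n) = (1 - q) * (\<Sum>n\<in>{N..<m}. q ^ n) + (1 - q) * q ^ m"
      by (simp add: distrib_left)
    then show ?case
      by (simp only: step.IH) (simp add: left_diff_distrib)
  qed simp
  then have "cmod (1 - q) * cmod (\<Sum>n\<in>{N..<n'}. q ^ n) = cmod (q ^ N - q ^ n')"
    by (metis norm_mult)
  also have "\<dots> \<le> cmod q ^ N + cmod q ^ n'"
    using norm_triangle_ineq4[of "q ^ N" "q ^ n'"] by (simp add: norm_power)
  also have "\<dots> \<le> cmod q ^ N + cmod q ^ N"
    using q True by (intro add_mono power_decreasing) auto
  finally have "cmod (1 - q) * cmod (\<Sum>n\<in>{N..<n'}. q ^ n) \<le> 2 * cmod q ^ N"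
    by simp
  moreover have "cmod (1 - q) > 0"
    using q by auto
  ultimately show ?thesis
    by (simp add: field_simps)
qed simp

text \<open>The operator \<open>(a\<^sub>n) \<mapsto> \<Sum>a\<^sub>n \<Phi>\<^sup>n\<close> from sequences to \<open>L\<^sup>2\<close> is bounded through its adjoint, whose
  composition with it has the kernel \<open>\<Sum>(\<Phi>(t) cnj \<Phi>(t'))\<^sup>n\<close>.\<close>

lemma schur_test:
  fixes \<Phi> :: "'a \<Rightarrow> complex" and w :: "'a \<Rightarrow> real"
  assumes fin: "finite_measure M"
    and meas [measurable]: "\<Phi> \<in> borel_measurable M" "w \<in> borel_measurable M"
    and lt: "\<And>t. t \<in> space M \<Longrightarrow> cmod (\<Phi> t) < 1"
    and w: "\<And>t. t \<in> space M \<Longrightarrow> w t > 0"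
    and B: "B \<ge> 0"
    and schur: "\<And>t. t \<in> space M \<Longrightarrow>
      (\<integral>\<^sup>+t'. ennreal (cmod (\<Phi> t * \<Phi> t') ^ N / cmod (1 - \<Phi> t * cnj (\<Phi> t')) * w t') \<partial>M) \<le> ennreal (B * w t)"
    and a: "\<And>k. k < N \<Longrightarrow> a k = 0"
  shows "(\<integral>t. (cmod (\<Sum>k<n. a k * \<Phi> t ^ k))\<^sup>2 \<partial>M) \<le> 2 * B * (\<Sum>k<n. (cmod (a k))\<^sup>2)"
proof -
  interpret finite_measure M by fact
  interpret P: pair_sigma_finite M M ..
  have [measurable]: "cnj \<in> borel_measurable borel"
    by (intro borel_measurable_continuous_onI continuous_intros)
  define g where "g t = (\<Sum>k<n. a k * \<Phi> t ^ k)" for t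
  define C where "C = (\<Sum>k<n. cmod (a k))"
  have g_meas [measurable]: "g \<in> borel_measurable M"
    unfolding g_def by measurable
  have gC: "cmod (g t) \<le> C" if "t \<in> space M" for t
  proof -
    have "cmod (a k * \<Phi> t ^ k) \<le> cmod (a k)" for k
      using lt[OF that] by (simp add: norm_mult norm_power mult_left_le power_le_one)
    then show ?thesis
      unfolding g_def C_def by (intro order_trans[OF norm_sum] sum_mono)
  qed
  have pow1: "cmod (\<Phi> t) ^ k \<le> 1" if "t \<in> space M" for t k
    using lt[OF that] by (simp add: power_le_one)
  have int_bd: "integrable M h" if "h \<in> borel_measurable M" "\<And>t. t \<in> space M \<Longrightarrow> norm (h t) \<le> D"
    for h :: "'a \<Rightarrow> complex" and D
    by (rule integrable_const_bound[of _ D]) (use that in auto)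
  \<comment> \<open>The conjugates of the coefficients of the adjoint applied to
    \<open>g\<close>.\<close>
  define b where "b k = (\<integral>t. \<Phi> t ^ k * cnj (g t) \<partial>M)" for k
  have int_b: "integrable M (\<lambda>t. \<Phi> t ^ k * cnj (g t))" for k
  proof (rule int_bd[of _ C])
    fix t assume t: "t \<in> space M"
    then show "norm (\<Phi> t ^ k * cnj (g t)) \<le> C"
      using mult_mono[OF pow1[OF t, of k] gC[OF t]] by (simp add: norm_mult norm_power)
  qed measurable
  define K where "K t t' = cmod (\<Phi> t * \<Phi> t') ^ N / cmod (1 - \<Phi> t * cnj (\<Phi> t'))" for t t'
  have K_meas [measurable]: "(\<lambda>p. K (fst p) (snd p)) \<in> borel_measurable (M \<Otimes>\<^sub>M M)"
    unfolding K_def by measurable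
  have K_nonneg: "K t t' \<ge> 0" for t t'
    by (simp add: K_def)
  have K_sym: "K t t' = K t' t" for t t'
  proof -
    have "cmod (1 - \<Phi> t * cnj (\<Phi> t')) = cmod (cnj (1 - \<Phi> t * cnj (\<Phi> t')))"
      by (simp only: complex_mod_cnj)
    then show ?thesis
      by (simp add: K_def mult.commute)
  qed
  define I where "I = (\<integral>t. (cmod (g t))\<^sup>2 \<partial>M)"
  have I_int: "integrable M (\<lambda>t. (cmod (g t))\<^sup>2)"
    by (rule integrable_const_bound[of _ "C\<^sup>2"]) (use gC in \<open>auto intro!: AE_I2 power_mono\<close>)
  have I0: "I \<ge> 0"
    by (simp add: I_def)
  have "of_real I = (\<integral>t. of_real ((cmod (g t))\<^sup>2) \<partial>M :: complex)"
    unfolding I_def by (rule integral_complex_of_real[symmetric])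
  also have "\<dots> = (\<integral>t. (\<Sum>k<n. a k * (\<Phi> t ^ k * cnj (g t))) \<partial>M)"
    unfolding complex_norm_square by (simp add: g_def sum_distrib_right mult.assoc)
  also have "\<dots> = (\<Sum>k<n. a k * b k)"
    unfolding b_def by (subst Bochner_Integration.integral_sum) (auto intro!: integrable_mult_right int_b)
  finally have I_eq: "of_real I = (\<Sum>k<n. a k * b k)" .
  have "I = cmod (\<Sum>k<n. a k * b k)"
    using I0 by (simp flip: I_eq)
  also have "\<dots> = cmod (\<Sum>k\<in>{N..<n}. a k * b k)"
    using a by (intro arg_cong[of _ _ cmod] sum.mono_neutral_right) auto
  also have "\<dots> \<le> (\<Sum>k\<in>{N..<n}. cmod (a k) * cmod (b k))"
    by (rule order_trans[OF norm_sum]) (simp add: norm_mult)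
  finally have "I\<^sup>2 \<le> (\<Sum>k\<in>{N..<n}. cmod (a k) * cmod (b k))\<^sup>2"
    using I0 by (intro power_mono)
  also have "\<dots> \<le> (\<Sum>k\<in>{N..<n}. (cmod (a k))\<^sup>2) * (\<Sum>k\<in>{N..<n}. (cmod (b k))\<^sup>2)"
    by (rule Cauchy_Schwarz_ineq_sum)
  also have "\<dots> \<le> (\<Sum>k<n. (cmod (a k))\<^sup>2) * (\<Sum>k\<in>{N..<n}. (cmod (b k))\<^sup>2)"
    by (intro mult_right_mono sum_mono2 sum_nonneg) auto
  finally have I_sq: "I\<^sup>2 \<le> (\<Sum>k<n. (cmod (a k))\<^sup>2) * (\<Sum>k\<in>{N..<n}. (cmod (b k))\<^sup>2)" .
  define G where "G t = (\<Sum>k\<in>{N..<n}. \<Phi> t ^ k * cnj (b k))" for t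
  have G_meas [measurable]: "G \<in> borel_measurable M"
    unfolding G_def by measurable
  have G_int: "integrable M (\<lambda>t. cnj (g t) * G t)"
  proof (rule int_bd[of _ "C * (\<Sum>k\<in>{N..<n}. cmod (b k))"])
    fix t assume t: "t \<in> space M"
    have "cmod (G t) \<le> (\<Sum>k\<in>{N..<n}. cmod (b k))"
      unfolding G_def using pow1[OF t]
      by (intro order_trans[OF norm_sum] sum_mono) (simp add: norm_mult norm_power mult_left_le_one_le)
    then show "norm (cnj (g t) * G t) \<le> C * (\<Sum>k\<in>{N..<n}. cmod (b k))"
      using gC[OF t] by (auto simp: norm_mult intro!: mult_mono sum_nonneg order_trans[OF norm_ge_zero gC[OF t]])
  qed measurable
  have "of_real (\<Sum>k\<in>{N..<n}. (cmod (b k))\<^sup>2) = (\<Sum>k\<in>{N..<n}. b k * cnj (b k))"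
    by (simp only: of_real_sum complex_norm_square)
  also have "\<dots> = (\<Sum>k\<in>{N..<n}. \<integral>t. \<Phi> t ^ k * cnj (g t) * cnj (b k) \<partial>M)"
    by (simp add: b_def)
  also have "\<dots> = (\<integral>t. (\<Sum>k\<in>{N..<n}. \<Phi> t ^ k * cnj (g t) * cnj (b k)) \<partial>M)"
    by (subst Bochner_Integration.integral_sum) (auto intro!: integrable_mult_left int_b)
  also have "\<dots> = (\<integral>t. cnj (g t) * G t \<partial>M)"
    by (simp add: G_def sum_distrib_left mult_ac)
  finally have b_eq: "of_real (\<Sum>k\<in>{N..<n}. (cmod (b k))\<^sup>2) = (\<integral>t. cnj (g t) * G t \<partial>M)" .
  have G_bound: "ennreal (cmod (G t)) \<le> (\<integral>\<^sup>+t'. ennreal (2 * K t t' * cmod (g t')) \<partial>M)" if t: "t \<in> space M" for t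
  proof -
    have "G t = (\<Sum>k\<in>{N..<n}. \<Phi> t ^ k * (\<integral>t'. cnj (\<Phi> t' ^ k * cnj (g t')) \<partial>M))"
      by (simp only: G_def b_def Bochner_Integration.integral_cnj)
    also have "\<dots> = (\<integral>t'. (\<Sum>k\<in>{N..<n}. \<Phi> t ^ k * cnj (\<Phi> t' ^ k * cnj (g t'))) \<partial>M)"
    proof (subst Bochner_Integration.integral_sum)
      have "integrable M (\<lambda>t'. cnj (\<Phi> t' ^ k * cnj (g t')))" for k
        using int_b[of k] by (rule integrable_cnj)
      then show "integrable M (\<lambda>t'. \<Phi> t ^ k * cnj (\<Phi> t' ^ k * cnj (g t')))" for k
        by (rule integrable_mult_right)
    qed simp
    also have "\<dots> = (\<integral>t'. g t' * (\<Sum>k\<in>{N..<n}. (\<Phi> t * cnj (\<Phi> t')) ^ k) \<partial>M)"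
      by (simp add: sum_distrib_left power_mult_distrib mult_ac)
    finally have "ennreal (cmod (G t)) \<le> (\<integral>\<^sup>+t'. ennreal (cmod (g t' * (\<Sum>k\<in>{N..<n}. (\<Phi> t * cnj (\<Phi> t')) ^ k))) \<partial>M)"
      using integral_norm_bound_ennreal[of M "\<lambda>t'. g t' * (\<Sum>k\<in>{N..<n}. (\<Phi> t * cnj (\<Phi> t')) ^ k)"]
      by (cases "integrable M (\<lambda>t'. g t' * (\<Sum>k\<in>{N..<n}. (\<Phi> t * cnj (\<Phi> t')) ^ k))")
         (auto simp: not_integrable_integral_eq)
    also have "\<dots> \<le> (\<integral>\<^sup>+t'. ennreal (2 * K t t' * cmod (g t')) \<partial>M)"
    proof (intro nn_integral_mono ennreal_leI)
      fix t' assume t': "t' \<in> space M"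
      have "cmod (\<Phi> t) * cmod (\<Phi> t') < 1 * 1"
        using lt[OF t] lt[OF t'] by (intro mult_strict_mono') auto
      then have "cmod (\<Phi> t * cnj (\<Phi> t')) < 1"
        by (simp add: norm_mult)
      from norm_sum_power_interval_le[OF this, of N n]
      show "cmod (g t' * (\<Sum>k\<in>{N..<n}. (\<Phi> t * cnj (\<Phi> t')) ^ k)) \<le> 2 * K t t' * cmod (g t')"
        unfolding norm_mult[of "g t'"] K_def
        by (subst mult.commute) (intro mult_right_mono, auto simp: norm_mult)
    qed
    finally show ?thesis .
  qed
  \<comment> \<open>The weight enters through 2 |g(t)| |g(t')| <= |g(t)|^2 w(t') / w(t) + |g(t')|^2
    w(t) / w(t'); by symmetry of \<open>K\<close> the two halves have equal double
    integrals.\<close>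
  define L where "L t t' = ennreal (K t t' * ((cmod (g t))\<^sup>2 * w t' / w t))" for t t'
  have [measurable]: "(\<lambda>p. L (fst p) (snd p)) \<in> borel_measurable (M \<Otimes>\<^sub>M M)"
    unfolding L_def by measurable
  have [measurable]: "(\<lambda>p. L (snd p) (fst p)) \<in> borel_measurable (M \<Otimes>\<^sub>M M)"
    unfolding L_def K_def by measurable
  have row: "(\<integral>\<^sup>+t'. L t t' \<partial>M) \<le> ennreal (B * (cmod (g t))\<^sup>2)" if t: "t \<in> space M" for t
  proof -
    have "(\<integral>\<^sup>+t'. L t t' \<partial>M) = (\<integral>\<^sup>+t'. ennreal ((cmod (g t))\<^sup>2 / w t) * ennreal (K t t' * w t') \<partial>M)"
      using w[OF t] w K_nonneg
      by (intro nn_integral_cong) (simp add: L_def less_imp_le flip: ennreal_mult)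
    also have "\<dots> = ennreal ((cmod (g t))\<^sup>2 / w t) * (\<integral>\<^sup>+t'. ennreal (K t t' * w t') \<partial>M)"
      using t by (intro nn_integral_cmult) (simp add: K_def)
    also have "\<dots> \<le> ennreal ((cmod (g t))\<^sup>2 / w t) * ennreal (B * w t)"
      using schur[OF t] by (intro mult_left_mono) (auto simp: K_def)
    also have "\<dots> = ennreal (B * (cmod (g t))\<^sup>2)"
      using w[OF t] B by (simp flip: ennreal_mult add: less_imp_le)
    finally show ?thesis .
  qed
  have L_int: "(\<integral>\<^sup>+t. \<integral>\<^sup>+t'. L t t' \<partial>M \<partial>M) \<le> ennreal (B * I)"
  proof -
    have "(\<integral>\<^sup>+t. \<integral>\<^sup>+t'. L t t' \<partial>M \<partial>M) \<le> (\<integral>\<^sup>+t. ennreal (B * (cmod (g t))\<^sup>2) \<partial>M)"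
      by (intro nn_integral_mono row)
    also have "\<dots> = ennreal (\<integral>t. B * (cmod (g t))\<^sup>2 \<partial>M)"
      using B by (intro nn_integral_eq_integral integrable_mult_right I_int) auto
    also have "\<dots> = ennreal (B * I)"
      by (simp add: I_def)
    finally show ?thesis .
  qed
  have "ennreal (\<Sum>k\<in>{N..<n}. (cmod (b k))\<^sup>2) = ennreal (cmod (\<integral>t. cnj (g t) * G t \<partial>M))"
    by (subst b_eq[symmetric]) (simp add: sum_nonneg del: of_real_sum)
  also have "\<dots> \<le> (\<integral>\<^sup>+t. ennreal (cmod (cnj (g t) * G t)) \<partial>M)"
    by (rule integral_norm_bound_ennreal[OF G_int])
  also have "\<dots> = (\<integral>\<^sup>+t. ennreal (cmod (g t)) * ennreal (cmod (G t)) \<partial>M)"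
    by (simp add: norm_mult ennreal_mult)
  also have "\<dots> \<le> (\<integral>\<^sup>+t. ennreal (cmod (g t)) * (\<integral>\<^sup>+t'. ennreal (2 * K t t' * cmod (g t')) \<partial>M) \<partial>M)"
    by (intro nn_integral_mono mult_left_mono G_bound) auto
  also have "\<dots> = (\<integral>\<^sup>+t. \<integral>\<^sup>+t'. ennreal (cmod (g t)) * ennreal (2 * K t t' * cmod (g t')) \<partial>M \<partial>M)"
    by (intro nn_integral_cong nn_integral_cmult[symmetric]) (simp add: K_def)
  also have "\<dots> \<le> (\<integral>\<^sup>+t. \<integral>\<^sup>+t'. L t t' + L t' t \<partial>M \<partial>M)"
  proof (intro nn_integral_mono)
    fix t t' assume t: "t \<in> space M" "t' \<in> space M"
    note wt = w[OF t(1)] w[OF t(2)]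
    define p q where "p = cmod (g t) * sqrt (w t' / w t)" and "q = cmod (g t') * sqrt (w t / w t')"
    have "sqrt (w t' / w t) * sqrt (w t / w t') = 1"
      using wt by (simp flip: real_sqrt_mult)
    then have "p * q = cmod (g t) * cmod (g t')"
      unfolding p_def q_def by (metis (no_types, opaque_lifting) mult.assoc mult.commute mult.right_neutral)
    then have "2 * (cmod (g t) * cmod (g t')) \<le> p\<^sup>2 + q\<^sup>2"
      using sum_squares_bound[of p q] by simp
    also have "\<dots> = (cmod (g t))\<^sup>2 * w t' / w t + (cmod (g t'))\<^sup>2 * w t / w t'"
      using wt by (simp add: p_def q_def power_mult_distrib)
    finally have "K t t' * (2 * (cmod (g t) * cmod (g t')))
        \<le> K t t' * ((cmod (g t))\<^sup>2 * w t' / w t + (cmod (g t'))\<^sup>2 * w t / w t')"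
      by (intro mult_left_mono K_nonneg)
    then have "cmod (g t) * (2 * K t t' * cmod (g t'))
        \<le> K t t' * ((cmod (g t))\<^sup>2 * w t' / w t) + K t' t * ((cmod (g t'))\<^sup>2 * w t / w t')"
      unfolding K_sym[of t' t] by (simp add: algebra_simps)
    then show "ennreal (cmod (g t)) * ennreal (2 * K t t' * cmod (g t')) \<le> L t t' + L t' t"
      using wt K_nonneg
      by (simp add: L_def ennreal_leI less_imp_le flip: ennreal_mult ennreal_plus)
  qed
  also have "\<dots> = (\<integral>\<^sup>+t. \<integral>\<^sup>+t'. L t t' \<partial>M \<partial>M) + (\<integral>\<^sup>+t. \<integral>\<^sup>+t'. L t' t \<partial>M \<partial>M)"
  proof -
    have "(\<integral>\<^sup>+t. \<integral>\<^sup>+t'. L t t' + L t' t \<partial>M \<partial>M) = (\<integral>\<^sup>+t. (\<integral>\<^sup>+t'. L t t' \<partial>M) + (\<integral>\<^sup>+t'. L t' t \<partial>M) \<partial>M)"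
      by (intro nn_integral_cong nn_integral_add) (auto simp: L_def K_def)
    also have "\<dots> = (\<integral>\<^sup>+t. \<integral>\<^sup>+t'. L t t' \<partial>M \<partial>M) + (\<integral>\<^sup>+t. \<integral>\<^sup>+t'. L t' t \<partial>M \<partial>M)"
      by (intro nn_integral_add borel_measurable_nn_integral) (simp_all add: split_def)
    finally show ?thesis .
  qed
  also have "(\<integral>\<^sup>+t. \<integral>\<^sup>+t'. L t' t \<partial>M \<partial>M) = (\<integral>\<^sup>+t. \<integral>\<^sup>+t'. L t t' \<partial>M \<partial>M)"
    by (rule P.Fubini') (simp add: split_def)
  also have "(\<integral>\<^sup>+t. \<integral>\<^sup>+t'. L t t' \<partial>M \<partial>M) + (\<integral>\<^sup>+t. \<integral>\<^sup>+t'. L t t' \<partial>M \<partial>M) \<le> ennreal (B * I) + ennreal (B * I)"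
    by (intro add_mono L_int)
  also have "\<dots> = ennreal (2 * B * I)"
    using B I0 by (simp flip: ennreal_plus)
  finally have "(\<Sum>k\<in>{N..<n}. (cmod (b k))\<^sup>2) \<le> 2 * B * I"
    using B I0 by simp
  \<comment> \<open>Cauchy-Schwarz bounded I^2 by the norms of \<open>a\<close> and
    \<open>b\<close>, and the norm of \<open>b\<close> is now bounded by I again, so one factor I
    cancels.\<close>
  then have "I\<^sup>2 \<le> (\<Sum>k<n. (cmod (a k))\<^sup>2) * (2 * B * I)"
    by (intro order_trans[OF I_sq] mult_left_mono sum_nonneg) auto
  then have "I * I \<le> I * (2 * B * (\<Sum>k<n. (cmod (a k))\<^sup>2))"
    by (simp add: power2_eq_square mult_ac)
  then have "I \<le> 2 * B * (\<Sum>k<n. (cmod (a k))\<^sup>2)"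
    using I0 B by (cases "I = 0") (auto intro!: mult_nonneg_nonneg sum_nonneg)
  then show ?thesis
    by (simp add: I_def g_def)
qed


section \<open>The logarithm of the symbol\<close>

text \<open>The symbol is \<open>exp (- F (cayley z))\<close> where \<open>F(s) = \<Sum>c\<^sub>k 2\<^sup>-\<^sup>k Ln (1 + 2\<^sup>k s)\<close>. On the imaginary axis
  the \<open>k\<close>-th term of \<open>Im F\<close> increases with slope about \<open>c\<^sub>k\<close> up to the scale \<open>2\<^sup>-\<^sup>k\<close> and is almost constant
  afterwards, so that the slope of \<open>Im F\<close> at the scale \<open>2\<^sup>-\<^sup>m\<close> is about \<open>\<Sum>\<^sub>k\<^sub><\<^sub>m c\<^sub>k\<close>, of order \<open>(ln m)\<^sup>2\<close>. It tends to
  infinity, which makes the operator compact, but so slowly that no power of it is summable.\<close>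

definition slope_incr :: "nat \<Rightarrow> real" where
  "slope_incr k = (ln (real k + 4))\<^sup>2 - (ln (real k + 3))\<^sup>2"

definition slope :: "nat \<Rightarrow> real" where
  "slope m = (\<Sum>k<m. slope_incr k)"

text \<open>A telescoping sum; the shift by 3 keeps all logarithms at least 1.\<close>

lemma slope_eq: "slope m = (ln (real m + 3))\<^sup>2 - (ln 3)\<^sup>2"
  by (induction m) (simp_all add: slope_def slope_incr_def add.commute)

lemma ln_ge_one: "x \<ge> 3 \<Longrightarrow> ln x \<ge> (1::real)"
  using exp_le ln_ge_iff[of x 1] by simp

text \<open>The true order is ln k / k. Dropping the logarithm is harmless: the modulus at scale
  2^-k may be smaller than 2^-k by a factor of order k.\<close>

lemma slope_incr_ge: "slope_incr k \<ge> 1 / (real k + 4)"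
proof -
  let ?a = "ln (real k + 4)" and ?b = "ln (real k + 3)"
  have "1 - inverse ((real k + 4) / (real k + 3)) \<le> ln ((real k + 4) / (real k + 3))"
    using ln_ge_iff ln_le_minus_one[of "(real k + 3) / (real k + 4)"] ln_div[of "real k + 3" "real k + 4"]
      ln_div[of "real k + 4" "real k + 3"] by simp
  also have "1 - inverse ((real k + 4) / (real k + 3)) = 1 / (real k + 4)"
    by (simp add: field_simps)
  finally have d: "1 / (real k + 4) \<le> ?a - ?b"
    by (simp add: ln_div)
  have "?a \<ge> 1" "?b \<ge> 1"
    by (auto intro: ln_ge_one)
  then have "(?a - ?b) * 1 \<le> (?a - ?b) * (?a + ?b)"
    using d by (intro mult_left_mono) (auto intro: order_trans[rotated])
  also have "\<dots> = slope_incr k"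
    by (simp add: slope_incr_def power2_eq_square algebra_simps)
  finally show ?thesis
    using d by simp
qed

lemma slope_incr_pos: "slope_incr k > 0"
  by (rule less_le_trans[OF _ slope_incr_ge]) simp

lemma slope_incr_le: "slope_incr k \<le> 2"
proof -
  let ?a = "ln (real k + 4)" and ?b = "ln (real k + 3)"
  have "ln ((real k + 4) / (real k + 3)) \<le> (real k + 4) / (real k + 3) - 1"
    by (rule ln_le_minus_one) simp
  also have "\<dots> = 1 / (real k + 3)"
    by (simp add: field_simps)
  finally have d: "?a - ?b \<le> 1 / (real k + 3)"
    by (simp add: ln_div)
  have "?a \<le> real k + 3" "?b \<le> real k + 2"
    using ln_le_minus_one[of "real k + 4"] ln_le_minus_one[of "real k + 3"] by simp_all
  then have "?a + ?b \<le> (real k + 3) + (real k + 2)"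
    by (rule add_mono)
  then have s: "?a + ?b \<le> 2 * (real k + 3)"
    by simp
  moreover have "?b \<ge> 1" "?a \<ge> 1"
    by (auto intro: ln_ge_one)
  ultimately have "(?a - ?b) * (?a + ?b) \<le> 1 / (real k + 3) * (2 * (real k + 3))"
    using d by (intro mult_mono[OF d s]) auto
  also have "\<dots> = 2"
    by (simp add: field_simps)
  finally show ?thesis
    by (simp add: slope_incr_def power2_eq_square algebra_simps)
qed

lemma slope_nonneg: "slope m \<ge> 0"
  unfolding slope_def using slope_incr_pos by (intro sum_nonneg) (auto intro: less_imp_le)

lemma slope_mono: "m \<le> n \<Longrightarrow> slope m \<le> slope n"
  unfolding slope_def using slope_incr_pos by (intro sum_mono2) (auto intro: less_imp_le)

lemma ln_one_plus_le_sqrt: "x \<ge> 0 \<Longrightarrow> ln (1 + x) \<le> 2 * sqrt (x::real)"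
proof -
  assume x: "x \<ge> 0"
  have "ln (1 + x) \<le> ln ((1 + sqrt x)\<^sup>2)"
    using x by (intro ln_mono) (auto simp: power2_sum)
  also have "\<dots> = 2 * ln (1 + sqrt x)"
    using x by (subst ln_realpow) (auto intro: add_pos_nonneg)
  also have "\<dots> \<le> 2 * sqrt x"
    using x by (intro mult_left_mono ln_add_one_self_le_self) auto
  finally show ?thesis .
qed

text \<open>The linear bound serves the terms with 2^k |s| small, the square root bound those with
  2^k |s| large, where it leaves a geometric series.\<close>

lemma
  assumes w: "Re w \<ge> 0"
  shows norm_Ln_one_plus_le: "cmod (Ln (1 + w)) \<le> 2 * cmod w"
    and norm_Ln_one_plus_le_sqrt: "cmod (Ln (1 + w)) \<le> 4 * sqrt (cmod w)"
proof -
  have nz: "1 + w \<noteq> 0" and re: "Re (1 + w) \<ge> 1"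
    using w by (auto simp: complex_eq_iff)
  have n1: "cmod (1 + w) \<ge> 1"
    using complex_Re_le_cmod[of "1 + w"] re by linarith
  then have Re0: "0 \<le> Re (Ln (1 + w))"
    using nz by simp
  have le: "Re (Ln (1 + w)) \<le> ln (1 + cmod w)"
    using nz n1 norm_triangle_ineq[of 1 w] by (simp add: ln_mono)
  have im: "Im (Ln (1 + w)) = arctan (Im (1 + w) / Re (1 + w))"
    using re nz arg_conv_arctan[of "1 + w"] Arg_eq_Im_Ln[of "1 + w"] by simp
  have "\<bar>Im (Ln (1 + w))\<bar> \<le> \<bar>Im (1 + w) / Re (1 + w)\<bar>"
    unfolding im by (rule abs_arctan_le)
  also have "\<dots> \<le> \<bar>Im (1 + w)\<bar>"
    using re by (simp add: field_simps mult_left_le)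
  also have "\<dots> \<le> cmod w"
    using abs_Im_le_cmod[of w] by simp
  finally have im_le: "\<bar>Im (Ln (1 + w))\<bar> \<le> cmod w" .
  have im_le2: "\<bar>Im (Ln (1 + w))\<bar> \<le> 2"
    unfolding im using arctan_bounded[of "Im (1 + w) / Re (1 + w)"] pi_less_4 by linarith
  have le1: "ln (1 + cmod w) \<le> cmod w"
    by (rule ln_add_one_self_le_self) simp
  show "cmod (Ln (1 + w)) \<le> 2 * cmod w"
    using cmod_le[of "Ln (1 + w)"] im_le le le1 Re0 by linarith
  have "\<bar>Im (Ln (1 + w))\<bar> \<le> 2 * sqrt (cmod w)"
  proof (cases "cmod w \<le> 1")
    case True
    then have "cmod w * cmod w \<le> 1 * cmod w"
      by (intro mult_right_mono) auto
    then have "cmod w \<le> sqrt (cmod w)"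
      by (intro real_le_rsqrt) (simp add: power2_eq_square)
    then show ?thesis
      using im_le real_sqrt_ge_zero[OF norm_ge_zero[of w]] by linarith
  next
    case False
    then have "1 \<le> sqrt (cmod w)"
      by simp
    then show ?thesis
      using im_le2 by linarith
  qed
  then show "cmod (Ln (1 + w)) \<le> 4 * sqrt (cmod w)"
    using cmod_le[of "Ln (1 + w)"] le ln_one_plus_le_sqrt[OF norm_ge_zero[of w]] Re0 by linarith
qed

definition log_term :: "nat \<Rightarrow> complex \<Rightarrow> complex" where
  "log_term k s = (slope_incr k / 2 ^ k) *\<^sub>R Ln (1 + 2 ^ k *\<^sub>R s)"

definition log_symbol :: "complex \<Rightarrow> complex" where
  "log_symbol s = (\<Sum>k. log_term k s)"

lemma norm_log_term_le:
  assumes "Re s \<ge> 0"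
  shows "cmod (log_term k s) \<le> 2 * slope_incr k * cmod s"
    and "cmod (log_term k s) \<le> 8 * sqrt (cmod s) * (1 / sqrt 2) ^ k"
proof -
  have re: "Re (2 ^ k *\<^sub>R s) \<ge> 0"
    using assms by simp
  have "cmod (log_term k s) = slope_incr k / 2 ^ k * cmod (Ln (1 + 2 ^ k *\<^sub>R s))"
    using slope_incr_pos[of k] by (simp add: log_term_def)
  moreover have "slope_incr k / 2 ^ k * cmod (Ln (1 + 2 ^ k *\<^sub>R s)) \<le> slope_incr k / 2 ^ k * (2 * cmod (2 ^ k *\<^sub>R s))"
    using slope_incr_pos[of k] by (intro mult_left_mono norm_Ln_one_plus_le re) auto
  moreover have "slope_incr k / 2 ^ k * (2 * cmod (2 ^ k *\<^sub>R s)) = 2 * slope_incr k * cmod s"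
    by simp
  ultimately show "cmod (log_term k s) \<le> 2 * slope_incr k * cmod s"
    by simp
  have "slope_incr k / 2 ^ k * cmod (Ln (1 + 2 ^ k *\<^sub>R s)) \<le> 2 / 2 ^ k * (4 * sqrt (cmod (2 ^ k *\<^sub>R s)))"
    using slope_incr_pos[of k] slope_incr_le[of k]
    by (intro mult_mono norm_Ln_one_plus_le_sqrt re divide_right_mono) auto
  also have "\<dots> = 8 * sqrt (cmod s) * (sqrt (2 ^ k) / 2 ^ k)"
    by (simp add: real_sqrt_mult)
  also have "sqrt (2 ^ k) / 2 ^ k = (1 / sqrt 2) ^ k"
  proof -
    have "(2::real) ^ k = sqrt 2 ^ k * sqrt 2 ^ k"
      by (simp flip: power_mult_distrib)
    then show ?thesis
      by (simp add: real_sqrt_power power_divide)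
  qed
  finally show "cmod (log_term k s) \<le> 8 * sqrt (cmod s) * (1 / sqrt 2) ^ k"
    using \<open>cmod (log_term k s) = _\<close> by simp
qed

lemma summable_inverse_sqrt2_powers: "summable (\<lambda>k. (1 / sqrt 2) ^ k)"
  by (rule summable_geometric) simp

text \<open>The square root bound provides the summable majorant. The closed half plane is included
  because the circle is mapped to its edge.\<close>

lemma log_term_uniform:
  "uniform_limit {s. Re s \<ge> 0 \<and> cmod s \<le> R} (\<lambda>n s. \<Sum>k<n. log_term k s) log_symbol sequentially"
  unfolding log_symbol_def
proof (rule Weierstrass_m_test)
  show "summable (\<lambda>k. 8 * sqrt R * (1 / sqrt 2) ^ k)"
    by (intro summable_mult summable_inverse_sqrt2_powers)
  show "norm (log_term k s) \<le> 8 * sqrt R * (1 / sqrt 2) ^ k" if "s \<in> {s. Re s \<ge> 0 \<and> cmod s \<le> R}" for k s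
    using that by (intro order_trans[OF norm_log_term_le(2)] mult_right_mono mult_left_mono) auto
qed

lemma summable_log_term: "Re s \<ge> 0 \<Longrightarrow> summable (\<lambda>k. log_term k s)"
  by (rule summable_comparison_test'[OF summable_mult[OF summable_inverse_sqrt2_powers]])
     (rule norm_log_term_le(2))

lemma one_plus_notin_nonpos_Reals: "Re s \<ge> 0 \<Longrightarrow> 1 + 2 ^ k *\<^sub>R s \<notin> \<real>\<^sub>\<le>\<^sub>0"
proof -
  assume "Re s \<ge> 0"
  then have "Re (1 + 2 ^ k *\<^sub>R s) > 0"
    by (simp add: add_pos_nonneg)
  then show ?thesis
    by (auto simp: complex_nonpos_Reals_iff)
qed

lemma continuous_on_log_symbol: "continuous_on {s. Re s \<ge> 0 \<and> cmod s \<le> R} log_symbol"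
proof (rule uniform_limit_theorem[OF _ log_term_uniform])
  show "\<forall>\<^sub>F n in sequentially. continuous_on {s. Re s \<ge> 0 \<and> cmod s \<le> R} (\<lambda>s. \<Sum>k<n. log_term k s)"
    unfolding log_term_def
    by (intro always_eventually allI continuous_intros) (use one_plus_notin_nonpos_Reals in auto)
qed simp

lemma holomorphic_log_symbol: "log_symbol holomorphic_on {s. Re s > 0}"
proof (rule holomorphic_uniform_sequence)
  show "open {s. Re s > 0}"
    by (rule open_halfspace_Re_gt)
  show "(\<lambda>s. \<Sum>k<n. log_term k s) holomorphic_on {s. 0 < Re s}" for n
    unfolding log_term_def scaleR_conv_of_real
    by (intro holomorphic_intros) (use one_plus_notin_nonpos_Reals[unfolded scaleR_conv_of_real] in auto)
  fix x assume x: "x \<in> {s. 0 < Re s}"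
  then obtain d where d: "d > 0" "cball x d \<subseteq> {s. 0 < Re s}"
    using open_contains_cball[of "{s. 0 < Re s}"] open_halfspace_Re_gt[of 0] by auto
  have "cmod s \<le> cmod x + d" if "s \<in> cball x d" for s
    using that norm_triangle_ineq2[of s x] by (simp add: dist_norm norm_minus_commute)
  then have "cball x d \<subseteq> {s. Re s \<ge> 0 \<and> cmod s \<le> cmod x + d}"
    using d(2) by force
  then show "\<exists>d>0. cball x d \<subseteq> {s. 0 < Re s} \<and>
      uniform_limit (cball x d) (\<lambda>n s. \<Sum>k<n. log_term k s) log_symbol sequentially"
    using d uniform_limit_on_subset[OF log_term_uniform] by blast
qed

text \<open>The first m terms are estimated linearly, the others by the geometric tail. At |s| of
  order 2^-m both parts are of order 2^-m, the first with the additional factor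
  \<open>slope m\<close>. The constant 32 is 8 times the bound 4 for the geometric sum.\<close>

lemma norm_log_symbol_le:
  assumes "Re s \<ge> 0"
  shows "cmod (log_symbol s) \<le> 2 * slope m * cmod s + 32 * sqrt (cmod s) * (1 / sqrt 2) ^ m"
proof -
  have s: "summable (\<lambda>k. log_term k s)"
    by (rule summable_log_term[OF assms])
  have q: "1 / (1 - 1 / sqrt 2) \<le> 4"
  proof -
    have "4 / 3 \<le> sqrt (2::real)"
      by (rule real_le_rsqrt) (simp add: power2_eq_square)
    then show ?thesis
      by (simp add: field_simps)
  qed
  have "log_symbol s = (\<Sum>k. log_term (k + m) s) + (\<Sum>k<m. log_term k s)"
    unfolding log_symbol_def by (rule suminf_split_initial_segment[OF s])
  then have "cmod (log_symbol s) \<le> cmod (\<Sum>k. log_term (k + m) s) + cmod (\<Sum>k<m. log_term k s)"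
    by (simp add: norm_triangle_ineq)
  moreover have "cmod (\<Sum>k<m. log_term k s) \<le> (\<Sum>k<m. 2 * slope_incr k * cmod s)"
    by (intro order_trans[OF norm_sum] sum_mono norm_log_term_le assms)
  moreover have "\<dots> = 2 * slope m * cmod s"
    by (simp add: slope_def sum_distrib_left sum_distrib_right)
  moreover have "cmod (\<Sum>k. log_term (k + m) s) \<le> (\<Sum>k. 8 * sqrt (cmod s) * (1 / sqrt 2) ^ m * (1 / sqrt 2) ^ k)"
  proof (rule norm_suminf_le)
    show "summable (\<lambda>k. 8 * sqrt (cmod s) * (1 / sqrt 2) ^ m * (1 / sqrt 2) ^ k)"
      by (intro summable_mult summable_inverse_sqrt2_powers)
    show "cmod (log_term (k + m) s) \<le> 8 * sqrt (cmod s) * (1 / sqrt 2) ^ m * (1 / sqrt 2) ^ k" for k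
      using norm_log_term_le(2)[OF assms, of "k + m"] by (simp add: power_add mult_ac)
  qed
  moreover have "(\<Sum>k. 8 * sqrt (cmod s) * (1 / sqrt 2) ^ m * (1 / sqrt 2) ^ k)
      = 8 * sqrt (cmod s) * (1 / sqrt 2) ^ m * (1 / (1 - 1 / sqrt 2))"
    by (subst suminf_mult[OF summable_inverse_sqrt2_powers]) (subst suminf_geometric, auto)
  moreover have "\<dots> \<le> 8 * sqrt (cmod s) * (1 / sqrt 2) ^ m * 4"
    using q by (intro mult_left_mono) auto
  ultimately show ?thesis
    by simp
qed

text \<open>If w is nonzero with nonnegative real part then |1 + w| > 1, so every term has positive
  real part, even on the imaginary axis.\<close>

lemma Re_log_symbol_pos:
  assumes "Re s \<ge> 0" "s \<noteq> 0"
  shows "Re (log_symbol s) > 0"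
proof -
  have s: "summable (\<lambda>k. Re (log_term k s))"
    by (rule summable_Re[OF summable_log_term[OF assms(1)]])
  have pos: "Re (log_term k s) > 0" for k
  proof -
    let ?w = "2 ^ k *\<^sub>R s"
    have re: "Re ?w \<ge> 0" and w: "?w \<noteq> 0"
      using assms by auto
    have "(cmod (1 + ?w))\<^sup>2 = (1 + Re ?w)\<^sup>2 + (Im ?w)\<^sup>2"
      by (simp add: cmod_power2)
    also have "\<dots> = 1 + 2 * Re ?w + ((Re ?w)\<^sup>2 + (Im ?w)\<^sup>2)"
      by (simp add: power2_sum)
    also have "(Re ?w)\<^sup>2 + (Im ?w)\<^sup>2 = (cmod ?w)\<^sup>2"
      by (rule cmod_power2[symmetric])
    also have "1 + 2 * Re ?w + (cmod ?w)\<^sup>2 > 1"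
    proof -
      have "(cmod ?w)\<^sup>2 > 0"
        using w by simp
      then show ?thesis
        using re by linarith
    qed
    finally have "cmod (1 + ?w) > 1"
      by (metis abs_norm_cancel abs_square_le_1 not_le)
    moreover from this have "1 + ?w \<noteq> 0"
      by auto
    ultimately have "Re (Ln (1 + ?w)) > 0"
      by (simp add: ln_gt_zero)
    then show ?thesis
      using slope_incr_pos[of k] by (simp add: log_term_def)
  qed
  have "Re (log_symbol s) = (\<Sum>k. Re (log_term k s))"
    unfolding log_symbol_def by (rule Re_suminf[OF summable_log_term[OF assms(1)]])
  then show ?thesis
    using suminf_pos[OF s pos] by simp
qed

text \<open>The variable y is tan (t / 2), since \<open>cayley (cis t)\<close> is - i y. There
  \<open>log_mod\<close> is minus the logarithm of the modulus of the first symbol, and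
  \<open>log_arg\<close> is its argument.\<close>

definition log_mod :: "real \<Rightarrow> real" where
  "log_mod y = Re (log_symbol (- \<i> * of_real y))"

definition log_arg :: "real \<Rightarrow> real" where
  "log_arg y = - Im (log_symbol (- \<i> * of_real y))"

lemma log_term_imaginary:
  "Re (log_term k (- \<i> * of_real y)) = slope_incr k / 2 ^ k * (ln (1 + (2 ^ k * y)\<^sup>2) / 2)"
  "- Im (log_term k (- \<i> * of_real y)) = slope_incr k / 2 ^ k * arctan (2 ^ k * y)"
proof -
  let ?z = "1 + 2 ^ k *\<^sub>R (- \<i> * of_real y)"
  have z: "?z = Complex 1 (- (2 ^ k * y))"
    by (simp add: complex_eq_iff)
  have nz: "?z \<noteq> 0"
    unfolding z by (simp add: complex_eq_iff)
  have "Re (Ln ?z) = ln (sqrt (1 + (2 ^ k * y)\<^sup>2))"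
    using nz by (subst Re_Ln) (auto simp: z cmod_def)
  also have "\<dots> = ln (1 + (2 ^ k * y)\<^sup>2) / 2"
    by (rule ln_sqrt) (simp add: add_pos_nonneg)
  finally show "Re (log_term k (- \<i> * of_real y)) = slope_incr k / 2 ^ k * (ln (1 + (2 ^ k * y)\<^sup>2) / 2)"
    by (simp only: log_term_def scaleR_complex.simps)
  have "Im (Ln ?z) = arctan (- (2 ^ k * y))"
    using nz arg_conv_arctan[of ?z] Arg_eq_Im_Ln[of ?z] by (simp add: z)
  then show "- Im (log_term k (- \<i> * of_real y)) = slope_incr k / 2 ^ k * arctan (2 ^ k * y)"
    by (simp only: log_term_def scaleR_complex.simps arctan_minus mult_minus_right minus_minus)
qed

lemma log_mod_sums: "(\<lambda>k. slope_incr k / 2 ^ k * (ln (1 + (2 ^ k * y)\<^sup>2) / 2)) sums log_mod y"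
  and log_arg_sums: "(\<lambda>k. slope_incr k / 2 ^ k * arctan (2 ^ k * y)) sums log_arg y"
proof -
  have "(\<lambda>k. log_term k (- \<i> * of_real y)) sums log_symbol (- \<i> * of_real y)"
    unfolding log_symbol_def by (intro summable_sums summable_log_term) simp
  then have "(\<lambda>k. Re (log_term k (- \<i> * of_real y))) sums log_mod y"
    "(\<lambda>k. - Im (log_term k (- \<i> * of_real y))) sums log_arg y"
    unfolding log_mod_def log_arg_def by (intro sums_Re sums_minus sums_Im; assumption)+
  then show "(\<lambda>k. slope_incr k / 2 ^ k * (ln (1 + (2 ^ k * y)\<^sup>2) / 2)) sums log_mod y"
    "(\<lambda>k. slope_incr k / 2 ^ k * arctan (2 ^ k * y)) sums log_arg y"
    unfolding log_term_imaginary .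
qed

lemma log_mod_minus: "log_mod (- y) = log_mod y"
  using log_mod_sums[of "- y"] log_mod_sums[of y] by (simp add: sums_iff)

lemma log_arg_minus: "log_arg (- y) = - log_arg y"
proof -
  have "(\<lambda>k. slope_incr k / 2 ^ k * arctan (2 ^ k * (- y))) sums (- log_arg y)"
    using sums_minus[OF log_arg_sums[of y]] by (simp add: arctan_minus)
  then show ?thesis
    using log_arg_sums[of "- y"] sums_unique2 by blast
qed

lemma log_mod_pos: "y \<noteq> 0 \<Longrightarrow> log_mod y > 0"
  unfolding log_mod_def by (rule Re_log_symbol_pos) auto

lemma log_mod_nonneg: "log_mod y \<ge> 0"
  using log_mod_pos[of y] log_mod_sums[of 0] by (cases "y = 0") (auto simp: sums_iff)

text \<open>All terms are nonnegative, and the k-th alone suffices: (2^k y)^2 >= 1 / 4 and ln (5 /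
  4) >= 1 / 5.\<close>

lemma log_mod_ge:
  assumes "1 / 2 ^ Suc k \<le> \<bar>y\<bar>"
  shows "slope_incr k / (10 * 2 ^ k) \<le> log_mod y"
proof -
  have "(1 / 2 :: real) \<le> 2 ^ k * \<bar>y\<bar>"
    using assms by (simp add: field_simps)
  then have "(1 / 2 :: real)\<^sup>2 \<le> (2 ^ k * \<bar>y\<bar>)\<^sup>2"
    by (intro power_mono) auto
  then have "5 / 4 \<le> 1 + (2 ^ k * y)\<^sup>2"
    by (simp add: power2_eq_square)
  then have "ln (5 / 4) \<le> ln (1 + (2 ^ k * y)\<^sup>2)"
    by (intro ln_mono) auto
  moreover have "ln (5 / 4 :: real) \<ge> 1 / 5"
    using ln_le_minus_one[of "4 / 5 :: real"] ln_div[of 4 "5::real"] ln_div[of 5 "4::real"] by simp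
  ultimately have "slope_incr k / 2 ^ k * (1 / 5 / 2) \<le> slope_incr k / 2 ^ k * (ln (1 + (2 ^ k * y)\<^sup>2) / 2)"
    using slope_incr_pos[of k] by (intro mult_left_mono) auto
  also have "\<dots> = (\<Sum>j\<in>{k}. slope_incr j / 2 ^ j * (ln (1 + (2 ^ j * y)\<^sup>2) / 2))"
    by simp
  also have "\<dots> \<le> (\<Sum>j. slope_incr j / 2 ^ j * (ln (1 + (2 ^ j * y)\<^sup>2) / 2))"
    using log_mod_sums[of y] slope_incr_pos
    by (intro sum_le_suminf) (auto simp: sums_iff less_imp_le intro!: mult_nonneg_nonneg divide_nonneg_nonneg)
  also have "\<dots> = log_mod y"
    using log_mod_sums[of y] by (simp add: sums_iff)
  finally show ?thesis
    by simp
qed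

lemma arctan_diff_ge:
  fixes a b :: real
  assumes "0 \<le> a" "a \<le> b" "b \<le> 1"
  shows "(b - a) / 2 \<le> arctan b - arctan a"
proof (cases "a = b")
  case False
  then have ab: "a < b" using assms by simp
  have "\<exists>z>a. z < b \<and> arctan b - arctan a = (b - a) * inverse (1 + z\<^sup>2)"
    by (rule MVT2[OF ab]) (auto intro!: derivative_eq_intros)
  then obtain z where z: "a < z" "z < b" "arctan b - arctan a = (b - a) * inverse (1 + z\<^sup>2)"
    by blast
  have "z\<^sup>2 \<le> 1"
    using z assms by (simp add: abs_square_le_1)
  then have "1 / 2 \<le> inverse (1 + z\<^sup>2)"
    by (simp add: field_simps add_pos_nonneg)
  then have "(b - a) * (1 / 2) \<le> (b - a) * inverse (1 + z\<^sup>2)"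
    using ab by (intro mult_left_mono) auto
  then show ?thesis
    using z(3) by simp
qed simp

lemma log_arg_diff_ge:
  assumes "0 \<le> x" "x \<le> y" "2 ^ K * y \<le> 1"
  shows "slope (Suc K) / 2 * (y - x) \<le> log_arg y - log_arg x"
proof -
  have diff: "(\<lambda>k. slope_incr k / 2 ^ k * (arctan (2 ^ k * y) - arctan (2 ^ k * x))) sums (log_arg y - log_arg x)"
    using sums_diff[OF log_arg_sums[of y] log_arg_sums[of x]] by (simp add: algebra_simps)
  have "slope (Suc K) / 2 * (y - x) = (\<Sum>k<Suc K. slope_incr k / 2 ^ k * ((2 ^ k * y - 2 ^ k * x) / 2))"
    unfolding slope_def sum_divide_distrib sum_distrib_right
    by (intro sum.cong refl) (simp add: field_simps)
  also have "\<dots> \<le> (\<Sum>k<Suc K. slope_incr k / 2 ^ k * (arctan (2 ^ k * y) - arctan (2 ^ k * x)))"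
  proof (intro sum_mono mult_left_mono arctan_diff_ge)
    fix k assume k: "k \<in> {..<Suc K}"
    have "2 ^ k * y \<le> 2 ^ K * y"
      using k assms by (intro mult_right_mono power_increasing) auto
    then show "2 ^ k * y \<le> 1"
      using assms(3) by simp
    show "slope_incr k / 2 ^ k \<ge> 0"
      using slope_incr_pos[of k] by simp
  qed (use assms in auto)
  also have "\<dots> \<le> (\<Sum>k. slope_incr k / 2 ^ k * (arctan (2 ^ k * y) - arctan (2 ^ k * x)))"
    using diff assms slope_incr_pos
    by (intro sum_le_suminf) (auto simp: sums_iff less_imp_le arctan_le_iff intro!: mult_nonneg_nonneg)
  also have "\<dots> = log_arg y - log_arg x"
    using diff by (simp add: sums_iff)
  finally show ?thesis .
qed

lemma log_arg_mono: "x \<le> y \<Longrightarrow> log_arg x \<le> log_arg y"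
proof -
  assume "x \<le> y"
  then have "arctan (2 ^ k * x) \<le> arctan (2 ^ k * y)" for k
    by (simp add: arctan_le_iff)
  then have "slope_incr k / 2 ^ k * arctan (2 ^ k * x) \<le> slope_incr k / 2 ^ k * arctan (2 ^ k * y)" for k
    using slope_incr_pos[of k] by (intro mult_left_mono) auto
  then show ?thesis
    by (rule sums_le[OF _ log_arg_sums log_arg_sums])
qed

lemma log_arg_zero: "log_arg 0 = 0"
  using log_arg_sums[of 0] by (simp add: sums_iff)

text \<open>Increments are at most 2 and arctan at most pi / 2. Boundedness of this argument lets
  the cotangent from the inner factor determine the position of the second symbol.\<close>

lemma log_arg_le: "log_arg y \<le> 2 * pi"
proof -
  have "log_arg y = (\<Sum>k. slope_incr k / 2 ^ k * arctan (2 ^ k * y))"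
    using log_arg_sums[of y] by (simp add: sums_iff)
  also have "\<dots> \<le> (\<Sum>k. 2 * (pi / 2) * (1 / 2) ^ k)"
  proof (rule suminf_le)
    fix k
    have "slope_incr k / 2 ^ k * arctan (2 ^ k * y) \<le> slope_incr k / 2 ^ k * (pi / 2)"
      using slope_incr_pos[of k] arctan_ubound[of "2 ^ k * y"] by (intro mult_left_mono) (auto simp: less_imp_le)
    also have "\<dots> \<le> 2 / 2 ^ k * (pi / 2)"
      using slope_incr_le[of k] by (intro mult_right_mono divide_right_mono) auto
    finally show "slope_incr k / 2 ^ k * arctan (2 ^ k * y) \<le> 2 * (pi / 2) * (1 / 2) ^ k"
      by (simp add: power_divide)
  qed (use log_arg_sums[of y] in \<open>auto simp: sums_iff intro!: summable_mult summable_geometric\<close>)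
  also have "\<dots> = 2 * pi"
    by (subst suminf_mult) (auto intro!: summable_geometric simp: suminf_geometric)
  finally show ?thesis .
qed

lemma measurable_log_mod [measurable]: "log_mod \<in> borel_measurable borel"
proof -
  have meas: "(\<lambda>y::real. \<Sum>k. slope_incr k / 2 ^ k * (ln (1 + (2 ^ k * y)\<^sup>2) / 2)) \<in> borel_measurable borel"
    by measurable
  have "log_mod = (\<lambda>y. \<Sum>k. slope_incr k / 2 ^ k * (ln (1 + (2 ^ k * y)\<^sup>2) / 2))"
    using log_mod_sums by (auto simp: sums_iff)
  then show ?thesis
    by (metis (no_types, lifting) meas)
qed

lemma measurable_log_arg [measurable]: "log_arg \<in> borel_measurable borel"
  by (rule borel_measurable_mono) (simp add: mono_def log_arg_mono)


section \<open>The two symbols\<close>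

definition cayley :: "complex \<Rightarrow> complex" where
  "cayley z = (1 - z) / (1 + z)"

lemma Re_cayley: "Re (cayley z) = (1 - (cmod z)\<^sup>2) / (cmod (1 + z))\<^sup>2"
  unfolding cayley_def Re_divide cmod_power2 by (simp add: power2_eq_square algebra_simps)

lemma one_plus_nonzero: "cmod z < 1 \<Longrightarrow> 1 + z \<noteq> 0"
  by (metis add_eq_0_iff less_irrefl norm_minus_cancel norm_one)

lemma Re_cayley_pos: "cmod z < 1 \<Longrightarrow> Re (cayley z) > 0"
proof -
  assume z: "cmod z < 1"
  then show ?thesis
    using one_plus_nonzero[OF z] unfolding Re_cayley by (intro divide_pos_pos) (simp_all add: abs_square_less_1)
qed

lemma Re_cayley_nonneg: "cmod z \<le> 1 \<Longrightarrow> Re (cayley z) \<ge> 0"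
  unfolding Re_cayley by (intro divide_nonneg_nonneg) (simp_all add: abs_square_le_1)

lemma cayley_nonzero: "z \<noteq> 1 \<Longrightarrow> z \<noteq> - 1 \<Longrightarrow> cayley z \<noteq> 0"
  by (auto simp: cayley_def add_eq_0_iff)

lemma cis_ne_minus_one: "t \<in> {-pi<..<pi} \<Longrightarrow> cis t \<noteq> - 1"
proof
  assume t: "t \<in> {-pi<..<pi}" and eq: "cis t = - 1"
  have "cos (t / 2) > 0"
    using t by (intro cos_gt_zero_pi) auto
  moreover have "cos t = 2 * (cos (t / 2))\<^sup>2 - 1"
    using cos_double_cos[of "t / 2"] by simp
  ultimately show False
    using eq by (simp add: complex_eq_iff)
qed

lemma cis_ne_one: "t \<in> {-pi<..<pi} \<Longrightarrow> t \<noteq> 0 \<Longrightarrow> cis t \<noteq> 1"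
proof
  assume t: "t \<in> {-pi<..<pi}" "t \<noteq> 0" and eq: "cis t = 1"
  have "sin (t / 2) \<noteq> 0"
    using t sin_gt_zero[of "t / 2"] sin_gt_zero[of "- (t / 2)"] by (cases "t > 0") auto
  moreover have "cos t = 1 - 2 * (sin (t / 2))\<^sup>2"
    using cos_double_sin[of "t / 2"] by simp
  ultimately show False
    using eq by (simp add: complex_eq_iff)
qed

lemma cayley_cis: "t \<in> {-pi<..<pi} \<Longrightarrow> cayley (cis t) = - \<i> * of_real (tan (t / 2))"
proof -
  assume t: "t \<in> {-pi<..<pi}"
  define a b where "a = cos (t / 2)" and "b = sin (t / 2)"
  have a: "a \<noteq> 0"
    using t cos_gt_zero_pi[of "t / 2"] by (simp add: a_def)
  have "1 = a\<^sup>2 + b\<^sup>2"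
    by (simp add: a_def b_def)
  moreover have "cos t = a\<^sup>2 - b\<^sup>2" "sin t = 2 * a * b"
    using cos_double[of "t / 2"] sin_double[of "t / 2"] by (simp_all add: a_def b_def)
  ultimately have "1 - cis t = - \<i> * of_real b * (2 * (a + \<i> * b))" "1 + cis t = of_real a * (2 * (a + \<i> * b))"
    by (auto simp: complex_eq_iff power2_eq_square)
  moreover have "2 * (a + \<i> * b) \<noteq> 0"
    using a by (simp add: complex_eq_iff)
  ultimately have "cayley (cis t) = - \<i> * of_real b / of_real a"
    unfolding cayley_def by (metis mult_divide_mult_cancel_right)
  then show ?thesis
    by (simp add: tan_def a_def b_def)
qed

section \<open>The symbols, their moduli and radial limits\<close>

definition symbol_phi :: "complex \<Rightarrow> complex" where
  "symbol_phi z = exp (- log_symbol (cayley z))"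

definition symbol_psi :: "complex \<Rightarrow> complex" where
  "symbol_psi z = symbol_phi z * exp (- (1 / cayley z))"

lemma holomorphic_cayley: "cayley holomorphic_on ball 0 1"
  unfolding cayley_def by (intro holomorphic_intros) (auto dest: one_plus_nonzero)

lemma holomorphic_symbol_phi: "symbol_phi holomorphic_on ball 0 1"
  unfolding symbol_phi_def
  by (intro holomorphic_intros holomorphic_on_compose_gen[OF holomorphic_cayley holomorphic_log_symbol, unfolded o_def])
     (auto dest: Re_cayley_pos)

lemma cayley_nonzero_disc: "cmod z < 1 \<Longrightarrow> cayley z \<noteq> 0"
  using Re_cayley_pos by fastforce

lemma holomorphic_symbol_psi: "symbol_psi holomorphic_on ball 0 1"
  unfolding symbol_psi_def
  by (intro holomorphic_intros holomorphic_symbol_phi holomorphic_cayley) (auto dest: cayley_nonzero_disc)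

text \<open>Both excluded points have \<open>cayley\<close> value 0, at - 1 through division by
  zero, and there \<open>symbol_phi\<close> takes the value 1.\<close>

lemma norm_symbol_phi_less: "cmod z \<le> 1 \<Longrightarrow> z \<noteq> 1 \<Longrightarrow> z \<noteq> - 1 \<Longrightarrow> cmod (symbol_phi z) < 1"
  using Re_log_symbol_pos[OF Re_cayley_nonneg cayley_nonzero, of z] by (simp add: symbol_phi_def)

lemma Re_inverse_nonneg: "Re s \<ge> 0 \<Longrightarrow> Re (1 / s) \<ge> 0"
  by (simp add: Re_divide)

lemma norm_symbol_phi_disc: "cmod z < 1 \<Longrightarrow> cmod (symbol_phi z) < 1"
  by (rule norm_symbol_phi_less) auto

lemma norm_symbol_psi_le: "cmod z \<le> 1 \<Longrightarrow> cmod (symbol_psi z) \<le> cmod (symbol_phi z)"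
  using Re_inverse_nonneg[OF Re_cayley_nonneg, of z]
  by (simp add: symbol_psi_def norm_mult mult_left_le del: one_divide_eq_0_iff)

lemma norm_symbol_psi_disc: "cmod z < 1 \<Longrightarrow> cmod (symbol_psi z) < 1"
  using norm_symbol_psi_le[of z] norm_symbol_phi_disc[of z] by simp

lemma norm_symbol_psi_circle:
  assumes "cmod \<zeta> = 1"
  shows "cmod (symbol_psi \<zeta>) = cmod (symbol_phi \<zeta>)"
proof -
  have "Re (cayley \<zeta>) = 0"
    using assms by (simp add: Re_cayley)
  then have "Re (1 / cayley \<zeta>) = 0"
    by (simp add: Re_divide)
  then show ?thesis
    by (simp add: symbol_psi_def norm_mult del: one_divide_eq_0_iff)
qed

lemma symbol_radial:
  assumes \<zeta>: "cmod \<zeta> = 1" "\<zeta> \<noteq> - 1"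
  shows "((\<lambda>r. symbol_phi (of_real r * \<zeta>)) \<longlongrightarrow> symbol_phi \<zeta>) (at_left 1)"
    and "\<zeta> \<noteq> 1 \<Longrightarrow> ((\<lambda>r. symbol_psi (of_real r * \<zeta>)) \<longlongrightarrow> symbol_psi \<zeta>) (at_left 1)"
proof -
  have "((\<lambda>r. of_real r * \<zeta>) \<longlongrightarrow> of_real 1 * \<zeta>) (at_left 1)"
    by (intro tendsto_intros)
  then have lim: "((\<lambda>r. of_real r * \<zeta>) \<longlongrightarrow> \<zeta>) (at_left 1)"
    by simp
  have cay: "((\<lambda>r. cayley (of_real r * \<zeta>)) \<longlongrightarrow> cayley \<zeta>) (at_left 1)"
    unfolding cayley_def using \<zeta>(2) by (intro tendsto_intros lim) (simp add: add_eq_0_iff)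
  have "\<forall>\<^sub>F r in at_left (1::real). r \<in> {0<..<1}"
    by (rule eventually_at_left_real) auto
  moreover have "\<forall>\<^sub>F r in at_left 1. cmod (cayley (of_real r * \<zeta>)) < cmod (cayley \<zeta>) + 1"
    by (rule order_tendstoD[OF tendsto_norm[OF cay]]) simp
  \<comment> \<open>Continuity of \<open>log_symbol\<close> was established on bounded parts of the
    closed half plane, so the end of the radius has to be confined to one of them.\<close>
  ultimately have "\<forall>\<^sub>F r in at_left 1. cayley (of_real r * \<zeta>) \<in> {s. Re s \<ge> 0 \<and> cmod s \<le> cmod (cayley \<zeta>) + 1}"
  proof eventually_elim
    case (elim r)
    then show ?case
      using \<zeta> by (auto intro!: Re_cayley_nonneg simp: norm_mult)
  qed
  then have "((\<lambda>r. log_symbol (cayley (of_real r * \<zeta>))) \<longlongrightarrow> log_symbol (cayley \<zeta>)) (at_left 1)"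
    using \<zeta>(1) by (intro continuous_on_tendsto_compose[OF continuous_on_log_symbol cay]) (auto simp: Re_cayley_nonneg)
  then show phi: "((\<lambda>r. symbol_phi (of_real r * \<zeta>)) \<longlongrightarrow> symbol_phi \<zeta>) (at_left 1)"
    unfolding symbol_phi_def by (intro tendsto_intros)
  show "((\<lambda>r. symbol_psi (of_real r * \<zeta>)) \<longlongrightarrow> symbol_psi \<zeta>) (at_left 1)" if "\<zeta> \<noteq> 1"
    unfolding symbol_psi_def using cayley_nonzero[OF that \<zeta>(2)] by (intro tendsto_intros phi cay)
qed

lemma radial_limit_eq:
  assumes "cmod \<zeta> = 1" "\<zeta> \<noteq> - 1" "\<zeta> \<noteq> 1"
  shows "radial_limit symbol_phi \<zeta> = symbol_phi \<zeta>" "radial_limit symbol_psi \<zeta> = symbol_psi \<zeta>"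
  unfolding radial_limit_def using symbol_radial[OF assms(1,2)] assms(3)
  by (auto intro!: tendsto_Lim)

lemma ae_circleI:
  assumes "\<And>\<zeta>. cmod \<zeta> = 1 \<Longrightarrow> \<zeta> \<noteq> - 1 \<Longrightarrow> \<zeta> \<noteq> 1 \<Longrightarrow> P \<zeta>"
  shows "ae_circle P"
proof -
  have "AE t in lborel. t \<noteq> 0 \<and> t \<noteq> pi \<and> t \<noteq> 2 * pi"
    by (intro AE_conjI AE_lborel_singleton)
  then have "AE t in lebesgue. t \<noteq> 0 \<and> t \<noteq> pi \<and> t \<noteq> 2 * pi"
    by (rule AE_completion)
  then have "AE t in lebesgue. t \<in> {0..2 * pi} \<longrightarrow> P (cis t)"
  proof eventually_elim
    case (elim t)
    show ?case
    proof
      assume t: "t \<in> {0..2 * pi}"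
      have "sin t \<noteq> 0"
      proof (cases "t < pi")
        case True
        then show ?thesis
          using elim t sin_gt_zero[of t] by auto
      next
        case False
        then show ?thesis
          using elim t sin_lt_zero[of t] by auto
      qed
      then have "cis t \<noteq> 1" "cis t \<noteq> - 1"
        by (auto simp: complex_eq_iff)
      then show "P (cis t)"
        by (intro assms) auto
    qed
  qed
  then show ?thesis
    unfolding ae_circle_def by (subst AE_restrict_space_iff) auto
qed

lemma symbol_symbol_phi: "symbol symbol_phi"
  unfolding symbol_def
  using holomorphic_symbol_phi norm_symbol_phi_disc norm_symbol_phi_less
  by (auto intro!: ae_circleI simp: radial_limit_eq)

lemma symbol_symbol_psi: "symbol symbol_psi"
  unfolding symbol_def
  using holomorphic_symbol_psi norm_symbol_psi_disc norm_symbol_phi_less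
  by (auto intro!: ae_circleI simp: radial_limit_eq norm_symbol_psi_circle)

lemma same_modulus: "ae_circle (\<lambda>\<zeta>. cmod (radial_limit symbol_phi \<zeta>) = cmod (radial_limit symbol_psi \<zeta>))"
  by (rule ae_circleI) (simp add: radial_limit_eq norm_symbol_psi_circle)

text \<open>Written through \<open>log_mod\<close> and \<open>log_arg\<close>, it is Borel on the
  whole line; it agrees with \<open>symbol_phi (cis t)\<close> for |t| < pi.\<close>

definition bdry_phi :: "real \<Rightarrow> complex" where
  "bdry_phi t = exp (Complex (- log_mod (tan (t / 2))) (log_arg (tan (t / 2))))"

definition bdry_psi :: "real \<Rightarrow> complex" where
  "bdry_psi t = exp (Complex (- log_mod (tan (t / 2))) (log_arg (tan (t / 2)) - 1 / tan (t / 2)))"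

lemma log_symbol_imaginary: "log_symbol (- \<i> * of_real y) = Complex (log_mod y) (- log_arg y)"
  by (simp add: complex_eq_iff log_mod_def log_arg_def)

lemma symbol_phi_cis: "t \<in> {-pi<..<pi} \<Longrightarrow> symbol_phi (cis t) = bdry_phi t"
  unfolding symbol_phi_def bdry_phi_def cayley_cis log_symbol_imaginary
  by (rule arg_cong[of _ _ exp]) (simp add: complex_eq_iff)

lemma symbol_psi_cis: "t \<in> {-pi<..<pi} \<Longrightarrow> symbol_psi (cis t) = bdry_psi t"
proof -
  assume t: "t \<in> {-pi<..<pi}"
  let ?y = "tan (t / 2)"
  have "1 / cayley (cis t) = Complex 0 (1 / ?y)"
    unfolding cayley_cis[OF t] by (cases "?y = 0") (auto simp: complex_eq_iff Re_divide Im_divide power2_eq_square)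
  then have "symbol_psi (cis t) = exp (Complex (- log_mod ?y) (log_arg ?y)) * exp (- Complex 0 (1 / ?y))"
    using symbol_phi_cis[OF t] by (simp add: symbol_psi_def bdry_phi_def)
  also have "\<dots> = bdry_psi t"
    unfolding bdry_psi_def exp_add[symmetric] by (rule arg_cong[of _ _ exp]) (simp add: complex_eq_iff)
  finally show ?thesis .
qed

lemma measurable_tan_half [measurable]: "(\<lambda>t::real. tan (t / 2)) \<in> borel_measurable borel"
  unfolding tan_def by measurable

lemma measurable_exp_Complex:
  assumes [measurable]: "f \<in> borel_measurable M" "g \<in> borel_measurable M"
  shows "(\<lambda>x. exp (Complex (f x) (g x))) \<in> borel_measurable M"
proof -
  have "exp (Complex (f x) (g x)) = of_real (exp (f x)) * (of_real (cos (g x)) + \<i> * of_real (sin (g x)))" for x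
    by (simp add: complex_eq_iff Re_exp Im_exp)
  moreover have "(\<lambda>x. of_real (exp (f x)) * (of_real (cos (g x)) + \<i> * of_real (sin (g x))) :: complex) \<in> borel_measurable M"
    by measurable
  ultimately show ?thesis
    by (simp only:)
qed

lemma measurable_bdry_phi [measurable]: "bdry_phi \<in> borel_measurable borel"
  unfolding bdry_phi_def[abs_def] by (rule measurable_exp_Complex) measurable

lemma measurable_bdry_psi [measurable]: "bdry_psi \<in> borel_measurable borel"
  unfolding bdry_psi_def[abs_def] by (rule measurable_exp_Complex) measurable

lemma norm_bdry: "cmod (bdry_phi t) = exp (- log_mod (tan (t / 2)))" "cmod (bdry_psi t) = exp (- log_mod (tan (t / 2)))"
  by (simp_all add: bdry_phi_def bdry_psi_def)

lemma AE_circle_measure: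
  assumes "\<And>t. t \<in> {-pi<..<pi} \<Longrightarrow> t \<noteq> 0 \<Longrightarrow> P t"
  shows "AE t in circle_measure. P t"
proof -
  have "AE t in lborel. t \<noteq> 0 \<and> t \<noteq> pi \<and> t \<noteq> - pi"
    by (intro AE_conjI AE_lborel_singleton)
  then have "AE t in lborel. t \<in> {-pi..pi} \<longrightarrow> P t"
    by eventually_elim (use assms in force)
  then show ?thesis
    unfolding circle_measure_def by (subst AE_restrict_space_iff) auto
qed

interpretation phi: boundary_map symbol_phi bdry_phi
proof
  show "AE t in circle_measure. ((\<lambda>r. symbol_phi (of_real r * cis t)) \<longlongrightarrow> bdry_phi t) (at_left 1)"
    using symbol_radial(1)[OF _ cis_ne_minus_one] by (intro AE_circle_measure) (auto simp flip: symbol_phi_cis)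
qed (use holomorphic_symbol_phi norm_symbol_phi_disc in
      \<open>auto simp: norm_bdry log_mod_nonneg intro: borel_measurable_circle\<close>)

interpretation psi: boundary_map symbol_psi bdry_psi
proof
  show "AE t in circle_measure. ((\<lambda>r. symbol_psi (of_real r * cis t)) \<longlongrightarrow> bdry_psi t) (at_left 1)"
    using symbol_radial(2)[OF _ cis_ne_minus_one cis_ne_one] by (intro AE_circle_measure) (auto simp flip: symbol_psi_cis)
qed (use holomorphic_symbol_psi norm_symbol_psi_disc in
      \<open>auto simp: norm_bdry log_mod_nonneg intro: borel_measurable_circle\<close>)

lemma symbol_phi_one: "symbol_phi 1 = 1"
proof -
  have "log_symbol 0 = 0"
    using norm_log_symbol_le[of 0 0] by simp
  then show ?thesis
    by (simp add: symbol_phi_def cayley_def)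
qed

text \<open>The radial limit at 1 is 1, whereas a constant value would have modulus below 1.\<close>

lemma symbol_phi_nonconstant: "\<not> symbol_phi constant_on ball 0 1"
proof
  assume "symbol_phi constant_on ball 0 1"
  then obtain c where c: "\<And>z. cmod z < 1 \<Longrightarrow> symbol_phi z = c"
    by (auto simp: constant_on_def)
  have "\<forall>\<^sub>F r in at_left (1::real). r \<in> {0<..<1}"
    by (rule eventually_at_left_real) auto
  then have "\<forall>\<^sub>F r in at_left 1. symbol_phi (of_real r * 1) = c"
    by eventually_elim (auto intro!: c simp: norm_mult)
  then have "((\<lambda>r. c) \<longlongrightarrow> 1) (at_left (1::real))"
    using symbol_radial(1)[of 1] tendsto_cong by (force simp: symbol_phi_one)
  then have "c = 1"
    by (simp add: tendsto_const_iff)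
  then show False
    using c[of 0] norm_symbol_phi_disc[of 0] by simp
qed

text \<open>Along the radius to 1 the inner factor exp (- (1 + r) / (1 - r)) tends to 0, but the
  symbol is nonzero at the origin.\<close>

lemma symbol_psi_nonconstant: "\<not> symbol_psi constant_on ball 0 1"
proof
  assume "symbol_psi constant_on ball 0 1"
  then obtain c where c: "\<And>z. cmod z < 1 \<Longrightarrow> symbol_psi z = c"
    by (auto simp: constant_on_def)
  have "c \<noteq> 0"
    using c[of 0] by (auto simp: symbol_psi_def symbol_phi_def)
  have "cmod c \<le> exp (- (1 / (1 - r)))" if r: "r \<in> {0<..<1}" for r
  proof -
    have "cmod c = cmod (symbol_psi (of_real r))"
      using r c[of "of_real r"] by simp
    also have "\<dots> \<le> exp (- ((1 + r) / (1 - r)))"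
    proof -
      have "1 / cayley (of_real r) = of_real ((1 + r) / (1 - r))"
        by (simp add: cayley_def)
      then have "cmod (exp (- (1 / cayley (of_real r)))) = exp (- ((1 + r) / (1 - r)))"
        by (simp only: norm_exp_eq_Re uminus_complex.sel Re_complex_of_real)
      then show ?thesis
        using norm_symbol_phi_disc[of "of_real r"] r
        unfolding symbol_psi_def norm_mult by (simp add: mult_left_le_one_le)
    qed
    also have "\<dots> \<le> exp (- (1 / (1 - r)))"
      using r by (simp add: divide_right_mono)
    finally show ?thesis .
  qed
  moreover have "\<forall>\<^sub>F r in at_left (1::real). r \<in> {0<..<1}"
    by (rule eventually_at_left_real) auto
  ultimately have "\<forall>\<^sub>F r in at_left (1::real). cmod c \<le> exp (- (1 / (1 - r)))"
    by (auto elim: eventually_mono)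
  moreover have "((\<lambda>r::real. exp (- (1 / (1 - r)))) \<longlongrightarrow> 0) (at_left 1)"
    by real_asymp
  ultimately have "cmod c \<le> 0"
    by (intro tendsto_le[OF _ _ tendsto_const]) auto
  then show False
    using \<open>c \<noteq> 0\<close> by simp
qed


section \<open>Trigonometric estimates and integrals\<close>

lemma exp_minus_le_half:
  fixes a :: real
  assumes "0 \<le> a" "a \<le> 1"
  shows "a / 2 \<le> 1 - exp (- a)"
proof -
  have "exp (- a) = inverse (exp a)"
    by (rule exp_minus)
  also have "\<dots> \<le> inverse (1 + a)"
    using assms exp_ge_add_one_self[of a] by (intro le_imp_inverse_le) auto
  also have "\<dots> \<le> 1 - a / 2"
  proof -
    have "1 \<le> (1 - a / 2) * (1 + a)"
      using mult_left_mono[OF assms(2) assms(1)] by (simp add: algebra_simps)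
    then show ?thesis
      using assms by (simp add: inverse_eq_divide divide_le_eq)
  qed
  finally show ?thesis by simp
qed

lemma abs_sin_ge_half:
  fixes x :: real
  assumes "\<bar>x\<bar> \<le> pi / 2"
  shows "\<bar>x\<bar> / 2 \<le> \<bar>sin x\<bar>"
proof -
  have "y / 2 \<le> sin y" if y: "0 \<le> y" "y \<le> pi / 2" for y :: real
  proof -
    define z where "z = y / 2"
    have z: "0 \<le> z" "z \<le> pi / 4" "z < pi / 2"
      using y pi_gt_zero unfolding z_def by linarith+
    have cz: "cos z > 0"
      using z by (intro cos_gt_zero_pi) auto
    have "cos (pi / 4) \<le> cos z"
      using z by (intro cos_monotone_0_pi_le) auto
    then have "(cos (pi / 4))\<^sup>2 \<le> (cos z)\<^sup>2"
      by (intro power_mono) (auto simp: cos_45)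
    then have c2: "1 / 2 \<le> (cos z)\<^sup>2"
      by (simp add: cos_45 power_divide)
    have "z = arctan (tan z)"
      using z by (intro arctan_tan[symmetric]) auto
    also have "\<dots> \<le> tan z"
      using z cz by (intro arctan_le_self) (auto simp: tan_def intro!: divide_nonneg_pos sin_ge_zero)
    finally have "z * cos z \<le> sin z"
      using cz by (simp add: tan_def field_simps)
    then have "z * cos z * cos z \<le> sin z * cos z"
      using cz by (intro mult_right_mono) auto
    moreover have "z * (1 / 2) \<le> z * (cos z)\<^sup>2"
      using c2 z by (intro mult_left_mono) auto
    moreover have "sin y = 2 * sin z * cos z"
      using sin_double[of z] by (simp add: z_def)
    ultimately show ?thesis
      by (simp add: z_def power2_eq_square mult.assoc)
  qed
  from this[of "\<bar>x\<bar>"] show ?thesis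
    using assms by (cases "x \<ge> 0") auto
qed

lemma norm_one_minus_exp_ge_mod: "a \<ge> 0 \<Longrightarrow> 1 - exp (- a) \<le> cmod (1 - exp (Complex (- a) b))"
  using norm_triangle_ineq2[of 1 "exp (Complex (- a) b)"] by simp

text \<open>For r = exp (- a) the squared modulus is (1 - r)^2 + 4 r (sin (b / 2))^2, which is
  enough if r >= 1 / 4. For smaller r the modulus exceeds 3 / 4, while |b| / 8 is below 1 /
  2.\<close>

lemma norm_one_minus_exp_ge_arg:
  assumes "a \<ge> 0" "\<bar>b\<bar> \<le> pi"
  shows "\<bar>b\<bar> / 8 \<le> cmod (1 - exp (Complex (- a) b))"
proof (cases "exp (- a) \<ge> 1 / 4")
  case True
  define r where "r = exp (- a)"
  have r: "1 / 4 \<le> r"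
    using True by (simp add: r_def)
  have "(cmod (1 - exp (Complex (- a) b)))\<^sup>2 = (1 - r * cos b)\<^sup>2 + (r * sin b)\<^sup>2"
    by (simp add: cmod_power2 Re_exp Im_exp r_def)
  also have "\<dots> = 1 - 2 * r * cos b + r\<^sup>2 * ((cos b)\<^sup>2 + (sin b)\<^sup>2)"
    by algebra
  also have "\<dots> = (1 - r)\<^sup>2 + 4 * r * (sin (b / 2))\<^sup>2"
  proof -
    have "cos b = 1 - 2 * (sin (b / 2))\<^sup>2"
      using cos_double_sin[of "b / 2"] by simp
    then show ?thesis
      unfolding sin_cos_squared_add2 by algebra
  qed
  also have "\<dots> \<ge> 0 + 1 * (sin (b / 2))\<^sup>2"
    using r by (intro add_mono mult_right_mono) auto
  finally have "\<bar>sin (b / 2)\<bar>\<^sup>2 \<le> (cmod (1 - exp (Complex (- a) b)))\<^sup>2"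
    by simp
  then have "\<bar>sin (b / 2)\<bar> \<le> cmod (1 - exp (Complex (- a) b))"
    by (rule power2_le_imp_le) simp
  moreover have "\<bar>b / 2\<bar> / 2 \<le> \<bar>sin (b / 2)\<bar>"
    using assms by (intro abs_sin_ge_half) auto
  ultimately show ?thesis
    by simp
next
  case False
  then have "3 / 4 \<le> cmod (1 - exp (Complex (- a) b))"
    using norm_one_minus_exp_ge_mod[OF assms(1), of b] by simp
  then show ?thesis
    using assms(2) pi_less_4 by linarith
qed

text \<open>Here 10 = 2 + 8, from the bounds by modulus and by argument. It turns the Schur kernel
  into a multiple of 1 / (a + |b|).\<close>

lemma norm_one_minus_exp_ge_sum:
  assumes "0 \<le> a" "a \<le> 1" "\<bar>b\<bar> \<le> pi"
  shows "(a + \<bar>b\<bar>) / 10 \<le> cmod (1 - exp (Complex (- a) b))"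
proof -
  define M where "M = cmod (1 - exp (Complex (- a) b))"
  have "a \<le> 2 * M"
    using exp_minus_le_half[OF assms(1,2)] norm_one_minus_exp_ge_mod[OF assms(1), of b] by (simp add: M_def)
  moreover have "\<bar>b\<bar> \<le> 8 * M"
    using norm_one_minus_exp_ge_arg[OF assms(1,3)] by (simp add: M_def)
  ultimately have "a + \<bar>b\<bar> \<le> 2 * M + 8 * M"
    by (rule add_mono)
  then show ?thesis
    by (simp add: M_def)
qed

lemma tan_half_diff_ge:
  fixes s t :: real
  assumes "0 \<le> s" "s \<le> t" "t < pi"
  shows "(t - s) / 2 \<le> tan (t / 2) - tan (s / 2)"
proof (cases "s = t")
  case False
  then have st: "s / 2 < t / 2"
    using assms by simp
  have "\<exists>z>s / 2. z < t / 2 \<and> tan (t / 2) - tan (s / 2) = (t / 2 - s / 2) * inverse ((cos z)\<^sup>2)"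
  proof (rule MVT2[OF st])
    fix x assume x: "s / 2 \<le> x" "x \<le> t / 2"
    have "cos x > 0"
      using x assms by (intro cos_gt_zero_pi) auto
    then show "(tan has_real_derivative inverse ((cos x)\<^sup>2)) (at x)"
      by (intro DERIV_tan) simp
  qed
  then obtain z where z: "s / 2 < z" "z < t / 2" "tan (t / 2) - tan (s / 2) = (t / 2 - s / 2) * inverse ((cos z)\<^sup>2)"
    by blast
  have "cos z > 0"
    using z assms by (intro cos_gt_zero_pi) auto
  moreover have "(cos z)\<^sup>2 \<le> 1"
    by (simp add: abs_square_le_1)
  ultimately have "1 \<le> inverse ((cos z)\<^sup>2)"
    by (intro one_le_inverse) auto
  then have "(t / 2 - s / 2) * 1 \<le> (t / 2 - s / 2) * inverse ((cos z)\<^sup>2)"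
    using st by (intro mult_left_mono) auto
  then show ?thesis
    using z(3) by (simp add: diff_divide_distrib)
qed simp

lemma tan_half_ge: "0 \<le> t \<Longrightarrow> t < pi \<Longrightarrow> t / 2 \<le> tan (t / 2 :: real)"
  using tan_half_diff_ge[of 0 t] by simp

lemma tan_half_le:
  fixes t :: real
  assumes "0 \<le> t" "t \<le> 1"
  shows "tan (t / 2) \<le> t"
proof -
  have "cos (pi / 3) \<le> cos (t / 2)"
    using assms pi_gt3 by (intro cos_monotone_0_pi_le) auto
  then have c: "1 / 2 \<le> cos (t / 2)"
    by (simp add: cos_60)
  have "tan (t / 2) \<le> (t / 2) / cos (t / 2)"
    unfolding tan_def using c assms by (intro divide_right_mono sin_x_le_x) auto
  also have "\<dots> \<le> (t / 2) / (1 / 2)"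
    using c assms by (intro divide_left_mono) auto
  finally show ?thesis by simp
qed

lemma nn_integral_inverse_sqrt:
  assumes "c \<ge> 0"
  shows "(\<integral>\<^sup>+x. ennreal (1 / sqrt x) * indicator {0..c} x \<partial>lborel) = ennreal (2 * sqrt c)"
proof -
  have "((\<lambda>x. x powr (-1/2)) has_integral (c powr (-1/2 + 1) / (-1/2 + 1))) {0..c}"
    using assms by (intro has_integral_powr_from_0) auto
  moreover have "x powr (-1/2) = 1 / sqrt x" if "x \<in> {0..c}" for x
    using that by (simp add: powr_minus_divide powr_half_sqrt)
  moreover have "c powr (-1/2 + 1) / (-1/2 + 1) = 2 * sqrt c"
    using assms by (simp add: powr_half_sqrt)
  ultimately have "((\<lambda>x. 1 / sqrt x) has_integral (2 * sqrt c)) {0..c}"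
    using has_integral_eq by (metis (no_types, lifting))
  then show ?thesis
    using assms by (intro nn_integral_has_integral_lebesgue') auto
qed

lemma nn_integral_inverse_powr_three_halves:
  assumes "c > 0"
  shows "(\<integral>\<^sup>+x. ennreal (1 / (x * sqrt x)) * indicator {c..} x \<partial>lborel) = ennreal (2 / sqrt c)"
proof -
  have "((\<lambda>x. x powr (-3/2)) has_integral (- (c powr (-3/2 + 1)) / (-3/2 + 1))) {c..}"
    using assms by (intro has_integral_powr_to_inf) auto
  moreover have "- (c powr (-3/2 + 1)) / (-3/2 + 1) = 2 / sqrt c"
    using assms by (simp add: powr_minus_divide powr_half_sqrt)
  moreover have "x powr (-3/2) = 1 / (x * sqrt x)" if "x \<in> {c..}" for x
  proof -
    have "x powr (3/2) = x powr 1 * x powr (1/2)"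
      by (subst powr_add[symmetric]) simp
    then show ?thesis
      using that assms by (simp add: powr_minus_divide powr_half_sqrt)
  qed
  ultimately have "((\<lambda>x. 1 / (x * sqrt x)) has_integral (2 / sqrt c)) {c..}"
    using has_integral_eq by (metis (no_types, lifting))
  then show ?thesis
    using assms by (intro nn_integral_has_integral_lebesgue') auto
qed

text \<open>One antiderivative on each side of t. This is the source of the logarithm in
  \<open>schur_ratio\<close>.\<close>

lemma nn_integral_inverse_abs_diff:
  assumes a: "a > 0" and l: "l > 0" and d: "d \<ge> 0"
  shows "(\<integral>\<^sup>+x. ennreal (1 / (a + l * \<bar>t - x\<bar>)) * indicator {t - d..t + d} x \<partial>lborel) \<le> ennreal (2 / l * ln (1 + l * d / a))"
proof -
  have pos: "a + l * x > 0" if "x \<ge> 0" for x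
    using a l that by (simp add: add_pos_nonneg)
  have L: "ln (a + l * d) - ln a = ln (1 + l * d / a)"
  proof -
    have "ln ((a + l * d) / a) = ln (a + l * d) - ln a"
      using a pos[OF d] by (simp add: ln_div)
    then show ?thesis
      using a by (simp add: add_divide_distrib)
  qed
  have "((\<lambda>x. 1 / (a + l * \<bar>t - x\<bar>)) has_integral (ln (a + l * (t + d - t)) / l - ln (a + l * (t - t)) / l)) {t..t + d}"
  proof (rule fundamental_theorem_of_calculus)
    fix x assume x: "x \<in> {t..t + d}"
    have "((\<lambda>x. ln (a + l * (x - t)) / l) has_real_derivative (1 / (a + l * (x - t)))) (at x within {t..t + d})"
      using x pos[of "x - t"] l by (auto intro!: derivative_eq_intros)
    then show "((\<lambda>x. ln (a + l * (x - t)) / l) has_vector_derivative 1 / (a + l * \<bar>t - x\<bar>)) (at x within {t..t + d})"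
      using x by (simp add: has_real_derivative_iff_has_vector_derivative)
  qed (use d in simp)
  then have r: "(\<integral>\<^sup>+x. ennreal (1 / (a + l * \<bar>t - x\<bar>)) * indicator {t..t + d} x \<partial>lborel) = ennreal (ln (1 + l * d / a) / l)"
    using less_imp_le[OF pos]
    by (intro nn_integral_has_integral_lebesgue') (auto simp: L diff_divide_distrib[symmetric])
  have "((\<lambda>x. 1 / (a + l * \<bar>t - x\<bar>)) has_integral (- ln (a + l * (t - t)) / l - (- ln (a + l * (t - (t - d))) / l))) {t - d..t}"
  proof (rule fundamental_theorem_of_calculus)
    fix x assume x: "x \<in> {t - d..t}"
    have "((\<lambda>x. - ln (a + l * (t - x)) / l) has_real_derivative (1 / (a + l * (t - x)))) (at x within {t - d..t})"
      using x pos[of "t - x"] l by (auto intro!: derivative_eq_intros)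
    then show "((\<lambda>x. - ln (a + l * (t - x)) / l) has_vector_derivative 1 / (a + l * \<bar>t - x\<bar>)) (at x within {t - d..t})"
      using x by (simp add: has_real_derivative_iff_has_vector_derivative)
  qed (use d in simp)
  then have le: "(\<integral>\<^sup>+x. ennreal (1 / (a + l * \<bar>t - x\<bar>)) * indicator {t - d..t} x \<partial>lborel) = ennreal (ln (1 + l * d / a) / l)"
    using less_imp_le[OF pos]
    by (intro nn_integral_has_integral_lebesgue') (auto simp: L diff_divide_distrib[symmetric])
  have "(\<integral>\<^sup>+x. ennreal (1 / (a + l * \<bar>t - x\<bar>)) * indicator {t - d..t + d} x \<partial>lborel)
      \<le> (\<integral>\<^sup>+x. ennreal (1 / (a + l * \<bar>t - x\<bar>)) * indicator {t - d..t} x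
            + ennreal (1 / (a + l * \<bar>t - x\<bar>)) * indicator {t..t + d} x \<partial>lborel)"
    by (intro nn_integral_mono) (auto simp: indicator_def)
  also have "\<dots> = ennreal (ln (1 + l * d / a) / l) + ennreal (ln (1 + l * d / a) / l)"
    by (subst nn_integral_add) (auto simp: r le)
  also have "\<dots> = ennreal (2 / l * ln (1 + l * d / a))"
    using a l d by (simp flip: ennreal_plus)
  finally show ?thesis .
qed

section \<open>Splitting the circle\<close>

lemma integral_circle_split:
  fixes f :: "real \<Rightarrow> real"
  assumes f: "f \<in> borel_measurable borel" "\<And>t. t \<in> {-pi..pi} \<Longrightarrow> \<bar>f t\<bar> \<le> D"
    and A: "A \<in> sets borel" "B \<in> sets borel" "A \<inter> B = {}" "A \<union> B = {-pi<..<pi} - {0}"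
  shows "(\<integral>t. f t \<partial>circle_measure)
    = (\<integral>t. f t \<partial>restrict_space lborel A) + (\<integral>t. f t \<partial>restrict_space lborel B)"
proof -
  have "integrable circle_measure f"
    using f by (intro integrable_circle_bounded[of _ D] borel_measurable_circle) auto
  then have int: "integrable lborel (\<lambda>t. indicator {-pi..pi} t *\<^sub>R f t)"
    unfolding circle_measure_def by (subst (asm) integrable_restrict_space) auto
  have sub: "integrable lborel (\<lambda>t. indicator C t *\<^sub>R f t)" if C: "C \<in> sets borel" "C \<subseteq> {-pi<..<pi}" for C
  proof (rule Bochner_Integration.integrable_bound[OF int])
    show "(\<lambda>t. indicator C t *\<^sub>R f t) \<in> borel_measurable lborel"
      using C f by measurable
    show "AE t in lborel. norm (indicator C t *\<^sub>R f t) \<le> norm (indicator {-pi..pi} t *\<^sub>R f t)"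
      using C(2) by (intro AE_I2) (force simp: indicator_def)
  qed
  have AB: "A \<subseteq> {-pi<..<pi}" "B \<subseteq> {-pi<..<pi}"
    using A(4) by auto
  have "AE t in lborel. t \<noteq> 0 \<and> t \<noteq> pi \<and> t \<noteq> - pi"
    by (intro AE_conjI AE_lborel_singleton)
  then have ae: "AE t in lborel. indicator {-pi..pi} t *\<^sub>R f t = indicator A t *\<^sub>R f t + indicator B t *\<^sub>R f t"
  proof eventually_elim
    case (elim t)
    have "t \<in> {-pi..pi} \<longleftrightarrow> t \<in> A \<union> B"
      unfolding A(4) using elim by force
    then show ?case
      using A(3) by (auto simp: indicator_def)
  qed
  have "(\<integral>t. f t \<partial>circle_measure) = (\<integral>t. indicator {-pi..pi} t *\<^sub>R f t \<partial>lborel)"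
    unfolding circle_measure_def by (subst integral_restrict_space) auto
  also have "\<dots> = (\<integral>t. indicator A t *\<^sub>R f t + indicator B t *\<^sub>R f t \<partial>lborel)"
  proof (rule integral_cong_AE)
    show "(\<lambda>t. indicator {-pi..pi} t *\<^sub>R f t) \<in> borel_measurable lborel"
      using f by measurable
    show "(\<lambda>t. indicator A t *\<^sub>R f t + indicator B t *\<^sub>R f t) \<in> borel_measurable lborel"
      using f A by measurable
  qed (rule ae)
  also have "\<dots> = (\<integral>t. indicator A t *\<^sub>R f t \<partial>lborel) + (\<integral>t. indicator B t *\<^sub>R f t \<partial>lborel)"
    using A AB by (intro Bochner_Integration.integral_add sub)
  also have "\<dots> = (\<integral>t. f t \<partial>restrict_space lborel A) + (\<integral>t. f t \<partial>restrict_space lborel B)"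
    using A by (simp add: integral_restrict_space)
  finally show ?thesis .
qed

lemma finite_measure_restrict_circle:
  assumes "A \<in> sets borel" "A \<subseteq> {-pi..pi}"
  shows "finite_measure (restrict_space lborel A)" "emeasure (restrict_space lborel A) A \<le> ennreal (2 * pi)"
proof -
  have "emeasure lborel A \<le> emeasure lborel {-pi..pi}"
    using assms by (intro emeasure_mono) auto
  then show le: "emeasure (restrict_space lborel A) A \<le> ennreal (2 * pi)"
    using assms by (simp add: emeasure_restrict_space)
  show "finite_measure (restrict_space lborel A)"
    using le by (intro finite_measureI) (auto simp: space_restrict_space top_unique)
qed

text \<open>Away from the contact point no cancellation is used: Cauchy-Schwarz against a geometric
  series at each t gives a bound that tends to 0 as N grows with \<open>\<rho>\<close>
  fixed.\<close>

lemma integral_power_sum_le_of_norm_le: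
  fixes \<Phi> :: "real \<Rightarrow> complex"
  assumes A: "A \<in> sets borel" "A \<subseteq> {-pi..pi}"
    and \<rho>: "0 \<le> \<rho>" "\<rho> < 1" "\<And>t. t \<in> A \<Longrightarrow> cmod (\<Phi> t) \<le> \<rho>"
    and a: "\<And>k. k < N \<Longrightarrow> a k = 0"
  shows "(\<integral>t. (cmod (\<Sum>k<n. a k * \<Phi> t ^ k))\<^sup>2 \<partial>restrict_space lborel A)
    \<le> 2 * pi * (\<rho> ^ (2 * N) / (1 - \<rho>\<^sup>2)) * (\<Sum>k<n. (cmod (a k))\<^sup>2)"
proof -
  interpret finite_measure "restrict_space lborel A"
    by (rule finite_measure_restrict_circle[OF A])
  let ?D = "\<rho> ^ (2 * N) / (1 - \<rho>\<^sup>2) * (\<Sum>k<n. (cmod (a k))\<^sup>2)"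
  have r2: "\<rho>\<^sup>2 < 1"
    using \<rho> by (simp add: abs_square_less_1)
  have D: "?D \<ge> 0"
    using r2 \<rho> by (intro mult_nonneg_nonneg divide_nonneg_nonneg sum_nonneg) auto
  have pt: "(cmod (\<Sum>k<n. a k * \<Phi> t ^ k))\<^sup>2 \<le> ?D" if t: "t \<in> A" for t
  proof -
    have "cmod (\<Sum>k<n. a k * \<Phi> t ^ k) = cmod (\<Sum>k\<in>{N..<n}. a k * \<Phi> t ^ k)"
      using a by (intro arg_cong[of _ _ cmod] sum.mono_neutral_right) auto
    also have "\<dots> \<le> (\<Sum>k\<in>{N..<n}. cmod (a k) * \<rho> ^ k)"
      using \<rho>(3)[OF t] by (intro order_trans[OF norm_sum] sum_mono)
        (simp add: norm_mult norm_power mult_left_mono power_mono)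
    finally have "(cmod (\<Sum>k<n. a k * \<Phi> t ^ k))\<^sup>2 \<le> (\<Sum>k\<in>{N..<n}. cmod (a k) * \<rho> ^ k)\<^sup>2"
      by (intro power_mono) auto
    also have "\<dots> \<le> (\<Sum>k\<in>{N..<n}. (cmod (a k))\<^sup>2) * (\<Sum>k\<in>{N..<n}. (\<rho> ^ k)\<^sup>2)"
      by (rule Cauchy_Schwarz_ineq_sum)
    also have "\<dots> \<le> (\<Sum>k<n. (cmod (a k))\<^sup>2) * (\<rho> ^ (2 * N) / (1 - \<rho>\<^sup>2))"
    proof (intro mult_mono sum_mono2 sum_nonneg)
      have "(\<Sum>k\<in>{N..<n}. (\<rho> ^ k)\<^sup>2) \<le> (\<Sum>k\<in>(\<lambda>j. j + N) ` {..<n}. (\<rho> ^ k)\<^sup>2)"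
      proof (intro sum_mono2)
        show "{N..<n} \<subseteq> (\<lambda>j. j + N) ` {..<n}"
        proof
          fix k assume "k \<in> {N..<n}"
          then show "k \<in> (\<lambda>j. j + N) ` {..<n}"
            by (intro image_eqI[of _ _ "k - N"]) auto
        qed
      qed auto
      also have "\<dots> = (\<Sum>j<n. \<rho> ^ (2 * N) * (\<rho>\<^sup>2) ^ j)"
        by (subst sum.reindex) (auto simp: o_def power_add power_mult_distrib power_mult power2_eq_square mult_ac intro!: sum.cong)
      also have "\<dots> \<le> (\<Sum>j. \<rho> ^ (2 * N) * (\<rho>\<^sup>2) ^ j)"
        using r2 \<rho> by (intro sum_le_suminf summable_mult summable_geometric) auto
      also have "\<dots> = \<rho> ^ (2 * N) / (1 - \<rho>\<^sup>2)"
        using r2 by (subst suminf_mult) (auto simp: suminf_geometric)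
      finally show "(\<Sum>k\<in>{N..<n}. (\<rho> ^ k)\<^sup>2) \<le> \<rho> ^ (2 * N) / (1 - \<rho>\<^sup>2)" .
    qed auto
    finally show ?thesis
      by (simp add: mult.commute)
  qed
  have "(\<integral>t. (cmod (\<Sum>k<n. a k * \<Phi> t ^ k))\<^sup>2 \<partial>restrict_space lborel A) \<le> (\<integral>t. ?D \<partial>restrict_space lborel A)"
    using pt D by (intro integral_mono_AE') (auto intro!: AE_I2 simp: space_restrict_space)
  also have "\<dots> = measure (restrict_space lborel A) A * ?D"
    using A by (simp add: space_restrict_space)
  also have "\<dots> \<le> 2 * pi * ?D"
    using finite_measure_restrict_circle(2)[OF A] D
    by (intro mult_right_mono) (auto simp: measure_def enn2real_leI)
  finally show ?thesis
    by (simp add: mult.assoc)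
qed


section \<open>The first operator is compact\<close>

definition arg_phi :: "real \<Rightarrow> real" where
  "arg_phi t = log_arg (tan (t / 2))"

definition mod_phi :: "real \<Rightarrow> real" where
  "mod_phi t = log_mod (tan (t / 2))"

lemma measurable_arg_phi [measurable]: "arg_phi \<in> borel_measurable borel"
  and measurable_mod_phi [measurable]: "mod_phi \<in> borel_measurable borel"
  unfolding arg_phi_def[abs_def] mod_phi_def[abs_def] by measurable

lemma arg_phi_minus: "arg_phi (- t) = - arg_phi t"
  and mod_phi_minus: "mod_phi (- t) = mod_phi t"
  by (simp_all add: arg_phi_def mod_phi_def log_arg_minus log_mod_minus)

lemma mod_phi_nonneg: "mod_phi t \<ge> 0"
  by (simp add: mod_phi_def log_mod_nonneg)

lemma mod_phi_pos: "t \<in> {-pi<..<pi} \<Longrightarrow> t \<noteq> 0 \<Longrightarrow> mod_phi t > 0"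
proof -
  assume t: "t \<in> {-pi<..<pi}" "t \<noteq> 0"
  have "tan (\<bar>t\<bar> / 2) > 0"
    using t tan_half_ge[of "\<bar>t\<bar>"] by force
  then have "tan (t / 2) \<noteq> 0"
    by (cases "t \<ge> 0") auto
  then show ?thesis
    unfolding mod_phi_def by (rule log_mod_pos)
qed

lemma bdry_phi_eq: "bdry_phi t = exp (Complex (- mod_phi t) (arg_phi t))"
  by (simp add: bdry_phi_def mod_phi_def arg_phi_def)

lemma bdry_phi_product:
  "bdry_phi t * cnj (bdry_phi t') = exp (Complex (- (mod_phi t + mod_phi t')) (arg_phi t - arg_phi t'))"
  unfolding bdry_phi_eq exp_cnj exp_add[symmetric] by (rule arg_cong[of _ _ exp]) (simp add: complex_eq_iff)

lemma arg_phi_mono: "0 \<le> s \<Longrightarrow> s \<le> t \<Longrightarrow> t < pi \<Longrightarrow> arg_phi s \<le> arg_phi t"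
  unfolding arg_phi_def using tan_half_diff_ge[of s t] by (intro log_arg_mono) simp

lemma arg_phi_nonneg: "0 \<le> t \<Longrightarrow> t < pi \<Longrightarrow> arg_phi t \<ge> 0"
  using arg_phi_mono[of 0 t] by (simp add: arg_phi_def log_arg_zero)

text \<open>One factor 1 / 2 comes from \<open>log_arg_diff_ge\<close>, the other from the
  derivative of tan (t / 2).\<close>

lemma arg_phi_diff_ge:
  assumes "0 \<le> s" "s \<le> t" "t \<le> 1" "2 ^ K * t \<le> 1"
  shows "slope (Suc K) / 4 * (t - s) \<le> arg_phi t - arg_phi s"
proof -
  have "slope (Suc K) / 4 * (t - s) = slope (Suc K) / 2 * ((t - s) / 2)"
    by simp
  also have "\<dots> \<le> slope (Suc K) / 2 * (tan (t / 2) - tan (s / 2))"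
    using assms pi_gt3 slope_nonneg by (intro mult_left_mono tan_half_diff_ge) auto
  also have "\<dots> \<le> arg_phi t - arg_phi s"
    unfolding arg_phi_def
  proof (rule log_arg_diff_ge)
    show "0 \<le> tan (s / 2)" "tan (s / 2) \<le> tan (t / 2)"
      using assms pi_gt3 tan_half_ge[of s] tan_half_diff_ge[of s t] by auto
    have "2 ^ K * tan (t / 2) \<le> 2 ^ K * t"
      using assms by (intro mult_left_mono tan_half_le) auto
    then show "2 ^ K * tan (t / 2) \<le> 1"
      using assms(4) by linarith
  qed
  finally show ?thesis .
qed

text \<open>Only tan (|t| / 2) >= |t| / 2 is available, which is why \<open>log_mod_ge\<close>
  starts at half the scale.\<close>

lemma mod_phi_ge:
  assumes "1 / 2 ^ k \<le> \<bar>t\<bar>" "\<bar>t\<bar> < pi"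
  shows "slope_incr k / (10 * 2 ^ k) \<le> mod_phi t"
proof -
  have "1 / 2 ^ Suc k = (1 / 2 ^ k) / (2 :: real)"
    by simp
  also have "\<dots> \<le> \<bar>t\<bar> / 2"
    using assms(1) by (rule divide_right_mono) simp
  also have "\<dots> \<le> tan (\<bar>t\<bar> / 2)"
    by (rule tan_half_ge[OF abs_ge_zero assms(2)])
  also have "\<dots> \<le> \<bar>tan (t / 2)\<bar>"
    by (cases "t \<ge> 0") auto
  finally show ?thesis
    unfolding mod_phi_def by (rule log_mod_ge)
qed

text \<open>The radius 2^-12 solves 32 * sqrt r = 1 / 2. Two such points then have moduli with sum
  at most 1 and arguments within pi, as \<open>norm_one_minus_exp_ge_sum\<close> requires.\<close>

lemma mod_phi_le_arg_phi_le:
  assumes "\<bar>t\<bar> \<le> 1 / 2 ^ 12"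
  shows "mod_phi t \<le> 1 / 2" "\<bar>arg_phi t\<bar> \<le> 1 / 2"
proof -
  let ?s = "- \<i> * of_real (tan (t / 2))"
  have "tan (\<bar>t\<bar> / 2) \<le> \<bar>t\<bar>" "tan (\<bar>t\<bar> / 2) \<ge> 0"
    using assms pi_gt3 by (auto intro!: tan_half_le order_trans[OF _ tan_half_ge])
  then have "\<bar>tan (t / 2)\<bar> \<le> \<bar>t\<bar>"
    by (cases "t \<ge> 0") auto
  then have le: "\<bar>tan (t / 2)\<bar> \<le> 1 / 2 ^ 12"
    using assms by linarith
  have "cmod (log_symbol ?s) \<le> 32 * sqrt \<bar>tan (t / 2)\<bar>"
    using norm_log_symbol_le[of ?s 0] by (simp add: slope_def norm_mult)
  also have "\<dots> \<le> 32 * sqrt (1 / 2 ^ 12)"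
    using le by (intro mult_left_mono real_sqrt_le_mono) auto
  also have "sqrt (1 / 2 ^ 12) = (1 / 64 :: real)"
    by (rule real_sqrt_unique) (auto simp: power_divide)
  finally have "cmod (log_symbol ?s) \<le> 1 / 2"
    by simp
  then show "mod_phi t \<le> 1 / 2" "\<bar>arg_phi t\<bar> \<le> 1 / 2"
    using abs_Re_le_cmod[of "log_symbol ?s"] abs_Im_le_cmod[of "log_symbol ?s"]
    by (simp_all add: mod_phi_def arg_phi_def log_mod_def log_arg_def)
qed

text \<open>For t of size 2^-k, the cost of the points below t / 2 plus that of the points between t
  / 2 and 2 t. Its logarithm is of order ln k, smaller than \<open>slope k\<close>.\<close>

definition schur_ratio :: "nat \<Rightarrow> real" where
  "schur_ratio k = 16 / slope k + 12 / slope k * ln (1 + 5 * slope k * (real k + 5))"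

lemma slope_at_top: "filterlim slope at_top sequentially"
  unfolding slope_eq[abs_def] by real_asymp

lemma schur_ratio_tendsto_0: "schur_ratio \<longlonglongrightarrow> 0"
  unfolding schur_ratio_def[abs_def] slope_eq by real_asymp

lemma ex_dyadic:
  fixes t :: real
  assumes "0 < t" "t \<le> 1 / 2 ^ K"
  shows "\<exists>k\<ge>K. 1 / 2 ^ Suc k < t \<and> t \<le> 1 / 2 ^ k"
proof -
  have "(\<lambda>k. (1 / 2 :: real) ^ Suc k) \<longlonglongrightarrow> 0"
    by (intro LIMSEQ_Suc LIMSEQ_realpow_zero) auto
  then have "\<forall>\<^sub>F k in sequentially. (1 / 2) ^ Suc k < t"
    using assms(1) by (rule order_tendstoD)
  then have ex: "\<exists>k. (1 / 2) ^ Suc k < t"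
    by (auto simp: eventually_sequentially)
  define k where "k = (LEAST k. (1 / 2) ^ Suc k < t)"
  have k: "(1 / 2) ^ Suc k < t"
    unfolding k_def using ex by (rule LeastI_ex)
  have t_le: "t \<le> (1 / 2) ^ K"
    using assms(2) by (simp add: power_divide)
  have Kk: "K \<le> k"
  proof (rule ccontr)
    assume "\<not> K \<le> k"
    then have "(1 / 2 :: real) ^ K \<le> (1 / 2) ^ Suc k"
      by (intro power_decreasing) auto
    then show False
      using k t_le by linarith
  qed
  have "t \<le> (1 / 2) ^ k"
  proof (cases k)
    case 0
    then show ?thesis
      using Kk t_le by simp
  next
    case (Suc j)
    then have "\<not> (1 / 2) ^ Suc j < t"
      using not_less_Least[of j "\<lambda>k. (1 / 2) ^ Suc k < t"] by (simp add: k_def)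
    then show ?thesis
      using Suc by simp
  qed
  then show ?thesis
    using k Kk by (auto simp: power_divide)
qed

text \<open>The row integral of the Schur test with weight \<open>t\<^sup>-\<^sup>1\<^sup>/\<^sup>2\<close>. For \<open>t\<close> of size \<open>2\<^sup>-\<^sup>k\<close> the argument has slope at
  least \<open>slope k / 4\<close> below \<open>2 t\<close>, and \<open>mod_phi t\<close> is smaller than \<open>t\<close> by a factor of order \<open>k\<close> only, which
  costs the logarithm in \<open>schur_ratio\<close>.\<close>

lemma schur_row_half:
  assumes K: "K \<ge> 1" and t: "0 < t" "t \<le> 1 / 2 ^ K"
    and e: "\<And>k. k \<ge> K \<Longrightarrow> schur_ratio k \<le> e" and K_pos: "slope K > 0"
  shows "(\<integral>\<^sup>+t'. ennreal (1 / (mod_phi t + \<bar>arg_phi t - arg_phi t'\<bar>) * (1 / sqrt t')) * indicator {0<..1 / 2 ^ K} t' \<partial>lborel)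
    \<le> ennreal ((e + 16 / slope K) / sqrt t)"
proof -
  define c :: real where "c = 1 / 2 ^ K"
  have c1: "c \<le> 1"
    by (simp add: c_def)
  obtain k where k: "k \<ge> K" "1 / 2 ^ Suc k < t" "t \<le> 1 / 2 ^ k"
    using ex_dyadic[OF t] by blast
  have t1: "t \<le> c" "t \<le> 1" "t < pi"
    using t(2) c1 pi_gt3 unfolding c_def by linarith+
  have slope_k: "slope k > 0"
    using slope_mono[OF k(1)] K_pos by simp
  \<comment> \<open>\<open>l\<close> bounds the slope of the argument near t and \<open>a\<close>
    bounds the modulus, by \<open>mod_phi_ge\<close> at index k + 1. For t' >= 2 t the difference t'
    - t is at least t' / 2, which halves the slope in \<open>m\<close>.\<close>
  define l where "l = slope k / 4"
  define a where "a = t / (20 * (real k + 5))"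
  define m where "m = slope K / 8"
  have l: "l > 0" and a: "a > 0" and m: "m > 0"
    using slope_k t K_pos by (auto simp: l_def a_def m_def)
  have mod: "a \<le> mod_phi t"
  proof -
    have "a \<le> (1 / 2 ^ k) / (20 * (real k + 5))"
      unfolding a_def using k(3) by (intro divide_right_mono) auto
    also have "\<dots> = 1 / (real (Suc k) + 4) / (10 * 2 ^ Suc k)"
      by (simp add: field_simps)
    also have "\<dots> \<le> slope_incr (Suc k) / (10 * 2 ^ Suc k)"
      by (intro divide_right_mono slope_incr_ge) auto
    also have "\<dots> \<le> mod_phi t"
      using k(2) t(1) t1 by (intro mod_phi_ge) auto
    finally show ?thesis .
  qed
  have near: "l * \<bar>t - t'\<bar> \<le> \<bar>arg_phi t - arg_phi t'\<bar>" if t': "0 < t'" "t' \<le> 2 * t" "t' \<le> c" for t'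
  proof -
    \<comment> \<open>Points up to 2 t may exceed 2^-k but not 2^-j, and the slope for index j is
      \<open>slope (Suc j)\<close>, that is \<open>slope k\<close>.\<close>
    obtain j where j: "k = Suc j"
      using k(1) K by (cases k) auto
    have "2 ^ k * t \<le> 1"
      using k(3) by (simp add: field_simps)
    then have kt: "2 ^ j * (2 * t) \<le> 1"
      by (simp add: j mult_ac)
    have "2 ^ j * t \<le> 2 ^ j * (2 * t)" "2 ^ j * t' \<le> 2 ^ j * (2 * t)"
      using t(1) t' by (intro mult_left_mono; simp)+
    then have jt: "2 ^ j * t \<le> 1" "2 ^ j * t' \<le> 1"
      using kt by linarith+
    have "t' \<le> 1"
      using t' c1 by linarith
    then show ?thesis
      using arg_phi_diff_ge[of t t' j] arg_phi_diff_ge[of t' t j] t(1) t1 t' jt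
      by (cases "t \<le> t'") (auto simp: l_def j abs_if)
  qed
  \<comment> \<open>Here t' may be as large as 2^-K, where only \<open>slope K\<close> is available;
    this produces the extra term 16 / slope K.\<close>
  have far: "m * t' \<le> \<bar>arg_phi t - arg_phi t'\<bar>" if t': "2 * t \<le> t'" "t' \<le> c" for t'
  proof -
    obtain j where j: "K = Suc j"
      using K by (cases K) auto
    have "m * t' \<le> slope K / 4 * (t' - t)"
    proof -
      have "slope K / 4 * (t' / 2) \<le> slope K / 4 * (t' - t)"
        using t' K_pos by (intro mult_left_mono) auto
      then show ?thesis
        by (simp add: m_def)
    qed
    also have "\<dots> \<le> arg_phi t' - arg_phi t"
      unfolding j
    proof (rule arg_phi_diff_ge)
      show "2 ^ j * t' \<le> 1"
        using t' t by (auto simp: c_def j field_simps)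
    qed (use t t' c1 in auto)
    finally show ?thesis by simp
  qed
  have M_pos: "0 < mod_phi t + \<bar>arg_phi t - arg_phi x\<bar>" for x
    using a mod by (intro add_pos_nonneg) auto
  let ?G = "\<lambda>t'. 1 / (mod_phi t + \<bar>arg_phi t - arg_phi t'\<bar>) * (1 / sqrt t')"
  \<comment> \<open>For x <= t / 2 the distance to t is at least t / 2 and only the weight is
    integrated; in the middle the weight is frozen at t / 2; beyond 2 t the kernel is at most 1 / (m
    x).\<close>
  let ?A = "\<lambda>x. ennreal (1 / (l * t / 2)) * (ennreal (1 / sqrt x) * indicator {0..t / 2} x)"
  let ?B = "\<lambda>x. ennreal (1 / sqrt (t / 2)) * (ennreal (1 / (a + l * \<bar>t - x\<bar>)) * indicator {t - t..t + t} x)"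
  let ?C = "\<lambda>x. ennreal (1 / m) * (ennreal (1 / (x * sqrt x)) * indicator {2 * t..} x)"
  have pt: "ennreal (?G x) * indicator {0<..c} x \<le> ?A x + (?B x + ?C x)" for x
  proof (cases "x \<in> {0<..c}")
    case True
    then have x: "0 < x" "x \<le> c" by auto
    consider "x \<le> t / 2" | "t / 2 < x" "x \<le> 2 * t" | "2 * t < x" by linarith
    then show ?thesis
    proof cases
      case 1
      have "l * (t / 2) \<le> l * \<bar>t - x\<bar>"
        using l 1 x by (intro mult_left_mono) auto
      also have "\<dots> \<le> mod_phi t + \<bar>arg_phi t - arg_phi x\<bar>"
        using near[of x] 1 x t mod_phi_nonneg[of t] by auto
      finally have "?G x \<le> 1 / (l * t / 2) * (1 / sqrt x)"
        using l t x M_pos[of x] by (intro mult_right_mono divide_left_mono) auto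
      then have "ennreal (?G x) \<le> ?A x"
        using 1 x l t by (simp add: ennreal_leI flip: ennreal_mult)
      then show ?thesis
        using True by (simp add: add_increasing2)
    next
      case 2
      have den: "a + l * \<bar>t - x\<bar> \<le> mod_phi t + \<bar>arg_phi t - arg_phi x\<bar>"
        using near[of x] 2 x mod by (intro add_mono) auto
      have den0: "0 < a + l * \<bar>t - x\<bar>"
        using a l by (intro add_pos_nonneg) auto
      have "1 / (mod_phi t + \<bar>arg_phi t - arg_phi x\<bar>) \<le> 1 / (a + l * \<bar>t - x\<bar>)"
        by (intro divide_left_mono den mult_pos_pos M_pos den0) simp
      moreover have "1 / sqrt x \<le> 1 / sqrt (t / 2)"
        using 2 t x by (intro divide_left_mono real_sqrt_le_mono) auto
      ultimately have "?G x \<le> 1 / (a + l * \<bar>t - x\<bar>) * (1 / sqrt (t / 2))"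
        using den0 x by (intro mult_mono) auto
      then have "ennreal (?G x) \<le> ?B x"
        using 2 x l t a by (simp add: ennreal_leI mult.commute flip: ennreal_mult)
      then have "ennreal (?G x) \<le> ?B x + ?C x"
        by (rule add_increasing2[rotated]) simp
      then show ?thesis
        using True by (simp add: add_increasing)
    next
      case 3
      have "m * x \<le> mod_phi t + \<bar>arg_phi t - arg_phi x\<bar>"
        using far[of x] 3 x mod_phi_nonneg[of t] by auto
      then have "?G x \<le> 1 / (m * x) * (1 / sqrt x)"
        using m x M_pos[of x] by (intro mult_right_mono divide_left_mono) auto
      then have "ennreal (?G x) \<le> ?C x"
        using 3 x m by (simp add: ennreal_leI flip: ennreal_mult)
      then have "ennreal (?G x) \<le> ?B x + ?C x"
        by (rule add_increasing[rotated]) simp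
      then show ?thesis
        using True by (simp add: add_increasing)
    qed
  qed simp
  have "(\<integral>\<^sup>+x. ennreal (?G x) * indicator {0<..c} x \<partial>lborel) \<le> (\<integral>\<^sup>+x. ?A x + (?B x + ?C x) \<partial>lborel)"
    by (intro nn_integral_mono pt)
  also have "\<dots> = (\<integral>\<^sup>+x. ?A x \<partial>lborel) + ((\<integral>\<^sup>+x. ?B x \<partial>lborel) + (\<integral>\<^sup>+x. ?C x \<partial>lborel))"
    by (subst nn_integral_add; (subst nn_integral_add)?; measurable)
  also have "\<dots> \<le> ennreal (1 / (l * t / 2) * (2 * sqrt (t / 2))) + (ennreal (1 / sqrt (t / 2) * (2 / l * ln (1 + l * t / a)))
      + ennreal (1 / m * (2 / sqrt (2 * t))))"
  proof (intro add_mono)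
    show "(\<integral>\<^sup>+x. ?A x \<partial>lborel) \<le> ennreal (1 / (l * t / 2) * (2 * sqrt (t / 2)))"
      using l t by (subst nn_integral_cmult) (auto simp: nn_integral_inverse_sqrt simp flip: ennreal_mult)
    have "(\<integral>\<^sup>+x. ?B x \<partial>lborel) = ennreal (1 / sqrt (t / 2))
        * (\<integral>\<^sup>+x. ennreal (1 / (a + l * \<bar>t - x\<bar>)) * indicator {t - t..t + t} x \<partial>lborel)"
      by (rule nn_integral_cmult) measurable
    also have "\<dots> \<le> ennreal (1 / sqrt (t / 2)) * ennreal (2 / l * ln (1 + l * t / a))"
      using t(1) by (intro mult_left_mono nn_integral_inverse_abs_diff a l) auto
    finally show "(\<integral>\<^sup>+x. ?B x \<partial>lborel) \<le> ennreal (1 / sqrt (t / 2) * (2 / l * ln (1 + l * t / a)))"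
      using t l a by (subst ennreal_mult) auto
    show "(\<integral>\<^sup>+x. ?C x \<partial>lborel) \<le> ennreal (1 / m * (2 / sqrt (2 * t)))"
      using m t by (subst nn_integral_cmult) (auto simp: nn_integral_inverse_powr_three_halves simp flip: ennreal_mult)
  qed
  also have "\<dots> = ennreal (1 / (l * t / 2) * (2 * sqrt (t / 2)) + (1 / sqrt (t / 2) * (2 / l * ln (1 + l * t / a))
      + 1 / m * (2 / sqrt (2 * t))))"
    using l a m t by (simp flip: ennreal_plus)
  also have "\<dots> \<le> ennreal ((e + 16 / slope K) / sqrt t)"
  proof (rule ennreal_leI)
    \<comment> \<open>Rounding sqrt 2 turns the exact constants into the 16 and the 12 of
      \<open>schur_ratio\<close>.\<close>
    have s2: "sqrt 2 \<le> 3 / 2" "1 \<le> sqrt (2::real)"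
      by (rule real_le_lsqrt) (auto simp: power2_eq_square)
    have st: "sqrt t > 0" "t = sqrt t * sqrt t"
      using t by auto
    have "1 / (l * t / 2) * (2 * sqrt (t / 2)) = 4 / l / sqrt 2 / sqrt t"
      using st l by (simp add: real_sqrt_divide field_simps)
    also have "\<dots> \<le> 4 / l / 1 / sqrt t"
      using s2 l st by (intro divide_right_mono divide_left_mono) auto
    also have "\<dots> = (16 / slope k) / sqrt t"
      by (simp add: l_def)
    finally have A: "1 / (l * t / 2) * (2 * sqrt (t / 2)) \<le> (16 / slope k) / sqrt t" .
    have L: "ln (1 + l * t / a) = ln (1 + 5 * slope k * (real k + 5))"
    proof -
      have "l * t / a = 5 * slope k * (real k + 5)"
        using t(1) by (simp add: l_def a_def field_simps)
      then show ?thesis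
        by simp
    qed
    have L0: "ln (1 + 5 * slope k * (real k + 5)) \<ge> 0"
      using slope_k by simp
    have "1 / sqrt (t / 2) * (2 / l * ln (1 + l * t / a)) = sqrt 2 * (8 / slope k * ln (1 + 5 * slope k * (real k + 5))) / sqrt t"
      unfolding L using st by (simp add: real_sqrt_divide l_def)
    also have "\<dots> \<le> 3 / 2 * (8 / slope k * ln (1 + 5 * slope k * (real k + 5))) / sqrt t"
      using s2 st slope_k L0 by (intro divide_right_mono mult_right_mono) auto
    finally have B: "1 / sqrt (t / 2) * (2 / l * ln (1 + l * t / a)) \<le> (12 / slope k * ln (1 + 5 * slope k * (real k + 5))) / sqrt t"
      by simp
    have "1 / m * (2 / sqrt (2 * t)) = 16 / slope K / sqrt 2 / sqrt t"
      by (simp add: m_def real_sqrt_mult)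
    also have "\<dots> \<le> 16 / slope K / 1 / sqrt t"
      using s2 st K_pos by (intro divide_right_mono divide_left_mono) auto
    finally have C: "1 / m * (2 / sqrt (2 * t)) \<le> (16 / slope K) / sqrt t"
      by simp
    have "1 / (l * t / 2) * (2 * sqrt (t / 2)) + (1 / sqrt (t / 2) * (2 / l * ln (1 + l * t / a)) + 1 / m * (2 / sqrt (2 * t)))
        \<le> (16 / slope k) / sqrt t + ((12 / slope k * ln (1 + 5 * slope k * (real k + 5))) / sqrt t + (16 / slope K) / sqrt t)"
      by (intro add_mono A B C)
    also have "\<dots> = (schur_ratio k + 16 / slope K) / sqrt t"
      by (simp add: schur_ratio_def add_divide_distrib)
    also have "\<dots> \<le> (e + 16 / slope K) / sqrt t"
      using e[OF k(1)] st by (intro divide_right_mono) auto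
    finally show "1 / (l * t / 2) * (2 * sqrt (t / 2)) + (1 / sqrt (t / 2) * (2 / l * ln (1 + l * t / a)) + 1 / m * (2 / sqrt (2 * t)))
        \<le> (e + 16 / slope K) / sqrt t" .
  qed
  finally show ?thesis
    by (simp add: c_def)
qed

lemma nn_integral_reflect:
  fixes f :: "real \<Rightarrow> ennreal"
  assumes [measurable]: "f \<in> borel_measurable borel"
  shows "(\<integral>\<^sup>+x. f (- x) \<partial>lborel) = (\<integral>\<^sup>+x. f x \<partial>lborel)"
  using nn_integral_real_affine[of f "-1" 0] by simp

text \<open>Arguments of points on opposite sides of 1 have opposite signs and differ by more than
  those of the reflected points, so the kernel is dominated by its values at |t| and |t'|. Two half
  circles and the constant 10 give 20.\<close>

lemma schur_row_phi:
  assumes K: "K \<ge> 12" and e: "\<And>k. k \<ge> K \<Longrightarrow> schur_ratio k \<le> e" and K_pos: "slope K > 0"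
    and E: "E = {t. 0 < \<bar>t\<bar> \<and> \<bar>t\<bar> \<le> 1 / 2 ^ K}" and t: "t \<in> E"
  shows "(\<integral>\<^sup>+t'. ennreal (cmod (bdry_phi t * bdry_phi t') ^ 0 / cmod (1 - bdry_phi t * cnj (bdry_phi t')) * (1 / sqrt \<bar>t'\<bar>))
      \<partial>restrict_space lborel E) \<le> ennreal ((20 * (e + 16 / slope K)) * (1 / sqrt \<bar>t\<bar>))"
proof -
  define c :: real where "c = 1 / 2 ^ K"
  have "(1 / 2 :: real) ^ K \<le> (1 / 2) ^ 12"
    using K by (intro power_decreasing) auto
  then have c12: "c \<le> 1 / 2 ^ 12"
    by (simp add: c_def power_divide)
  have Em [measurable]: "E \<in> sets borel"
    unfolding E by measurable
  define s where "s = \<bar>t\<bar>"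
  have s: "0 < s" "s \<le> c"
    using t by (auto simp: E s_def c_def)
  define H where "H x = 1 / (mod_phi s + \<bar>arg_phi s - arg_phi x\<bar>) * (1 / sqrt x)" for x
  have H_meas [measurable]: "H \<in> borel_measurable borel"
    unfolding H_def[abs_def] by measurable
  have s_pi: "s \<in> {-pi<..<pi}"
    using s c12 pi_gt3 by auto
  have mod_s: "mod_phi t = mod_phi s" "mod_phi s > 0"
    using mod_phi_pos[OF s_pi] s by (auto simp: s_def abs_if mod_phi_minus)
  have pt: "1 / cmod (1 - bdry_phi t * cnj (bdry_phi t')) * (1 / sqrt \<bar>t'\<bar>) \<le> 10 * H \<bar>t'\<bar>" if t': "t' \<in> E" for t'
  proof -
    have "\<bar>t\<bar> \<le> c" "\<bar>t'\<bar> \<le> c"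
      using t t' by (auto simp: E c_def)
    then have tt': "\<bar>t\<bar> \<le> 1 / 2 ^ 12" "\<bar>t'\<bar> \<le> 1 / 2 ^ 12"
      using c12 by linarith+
    note b = mod_phi_le_arg_phi_le[OF tt'(1)] mod_phi_le_arg_phi_le[OF tt'(2)]
    let ?a = "mod_phi t + mod_phi t'" and ?b = "arg_phi t - arg_phi t'"
    have ab: "\<bar>?b\<bar> \<le> pi" "0 \<le> ?a" "?a \<le> 1"
      using b pi_gt3 mod_phi_nonneg[of t] mod_phi_nonneg[of t'] by auto
    have "mod_phi s + \<bar>arg_phi s - arg_phi \<bar>t'\<bar>\<bar> \<le> ?a + \<bar>?b\<bar>"
    proof (rule add_mono)
      show "mod_phi s \<le> ?a"
        using mod_phi_nonneg[of t'] by (simp add: mod_s)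
      have "arg_phi s \<ge> 0" "arg_phi \<bar>t'\<bar> \<ge> 0"
        using s s_pi tt' pi_gt3 by (auto intro!: arg_phi_nonneg)
      then show "\<bar>arg_phi s - arg_phi \<bar>t'\<bar>\<bar> \<le> \<bar>?b\<bar>"
        by (cases "t \<ge> 0"; cases "t' \<ge> 0") (auto simp: s_def arg_phi_minus)
    qed
    also have "\<dots> \<le> 10 * cmod (1 - bdry_phi t * cnj (bdry_phi t'))"
      using norm_one_minus_exp_ge_sum[OF ab(2,3,1)] by (simp add: bdry_phi_product)
    finally have *: "(mod_phi s + \<bar>arg_phi s - arg_phi \<bar>t'\<bar>\<bar>) / 10 \<le> cmod (1 - bdry_phi t * cnj (bdry_phi t'))"
      by simp
    have "1 / cmod (1 - bdry_phi t * cnj (bdry_phi t')) \<le> 1 / ((mod_phi s + \<bar>arg_phi s - arg_phi \<bar>t'\<bar>\<bar>) / 10)"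
      using * mod_s(2) by (intro divide_left_mono) (auto intro!: mult_pos_pos add_pos_nonneg intro: less_le_trans[OF _ *])
    then have "1 / cmod (1 - bdry_phi t * cnj (bdry_phi t')) * (1 / sqrt \<bar>t'\<bar>)
        \<le> 1 / ((mod_phi s + \<bar>arg_phi s - arg_phi \<bar>t'\<bar>\<bar>) / 10) * (1 / sqrt \<bar>t'\<bar>)"
      by (intro mult_right_mono) auto
    then show ?thesis
      by (simp add: H_def)
  qed
  let ?P = "\<lambda>x. ennreal (H x) * indicator {0<..c} x"
  have "(\<integral>\<^sup>+t'. ennreal (cmod (bdry_phi t * bdry_phi t') ^ 0 / cmod (1 - bdry_phi t * cnj (bdry_phi t')) * (1 / sqrt \<bar>t'\<bar>))
      \<partial>restrict_space lborel E)
      = (\<integral>\<^sup>+t'. ennreal (1 / cmod (1 - bdry_phi t * cnj (bdry_phi t')) * (1 / sqrt \<bar>t'\<bar>)) * indicator E t' \<partial>lborel)"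
    by (subst nn_integral_restrict_space) auto
  also have "\<dots> \<le> (\<integral>\<^sup>+t'. ennreal 10 * (?P t' + ?P (- t')) \<partial>lborel)"
  proof (rule nn_integral_mono)
    fix t'
    show "ennreal (1 / cmod (1 - bdry_phi t * cnj (bdry_phi t')) * (1 / sqrt \<bar>t'\<bar>)) * indicator E t'
        \<le> ennreal 10 * (?P t' + ?P (- t'))"
    proof (cases "t' \<in> E")
      case True
      then have "0 < \<bar>t'\<bar>" "\<bar>t'\<bar> \<le> c"
        by (auto simp: E c_def)
      then have "?P t' + ?P (- t') = ennreal (H \<bar>t'\<bar>)"
        by (cases "t' > 0") (simp_all add: indicator_def)
      then have "ennreal 10 * (?P t' + ?P (- t')) = ennreal (10 * H \<bar>t'\<bar>)"
        by (subst ennreal_mult') auto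
      then show ?thesis
        using pt[OF True] True by (simp add: ennreal_leI)
    qed simp
  qed
  also have "\<dots> = ennreal 10 * ((\<integral>\<^sup>+x. ?P x \<partial>lborel) + (\<integral>\<^sup>+x. ?P (- x) \<partial>lborel))"
    by (subst nn_integral_cmult, measurable, subst nn_integral_add, measurable)
  also have "(\<integral>\<^sup>+x. ?P (- x) \<partial>lborel) = (\<integral>\<^sup>+x. ?P x \<partial>lborel)"
    by (rule nn_integral_reflect) measurable
  also have "ennreal 10 * ((\<integral>\<^sup>+x. ?P x \<partial>lborel) + (\<integral>\<^sup>+x. ?P x \<partial>lborel))
      \<le> ennreal 10 * (ennreal ((e + 16 / slope K) / sqrt s) + ennreal ((e + 16 / slope K) / sqrt s))"
  proof (intro mult_left_mono add_mono)
    show "(\<integral>\<^sup>+x. ?P x \<partial>lborel) \<le> ennreal ((e + 16 / slope K) / sqrt s)"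
      unfolding H_def c_def using schur_row_half[of K s e] K s e K_pos by (simp add: c_def)
    then show "(\<integral>\<^sup>+x. ?P x \<partial>lborel) \<le> ennreal ((e + 16 / slope K) / sqrt s)" .
  qed auto
  also have "\<dots> = ennreal ((20 * (e + 16 / slope K)) * (1 / sqrt \<bar>t\<bar>))"
  proof -
    have "schur_ratio K \<ge> 0"
      unfolding schur_ratio_def using K_pos by (intro add_nonneg_nonneg mult_nonneg_nonneg) auto
    then have "(e + 16 / slope K) / sqrt s \<ge> 0"
      using e[of K] K_pos s by (intro divide_nonneg_nonneg add_nonneg_nonneg) auto
    then have "ennreal 10 * (ennreal ((e + 16 / slope K) / sqrt s) + ennreal ((e + 16 / slope K) / sqrt s))
        = ennreal (10 * ((e + 16 / slope K) / sqrt s + (e + 16 / slope K) / sqrt s))"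
      by (subst ennreal_mult') (simp_all only: ennreal_plus zero_le_numeral)
    then show ?thesis
      by (simp add: s_def field_simps)
  qed
  finally show ?thesis .
qed

text \<open>Near 1 the Schur test runs with exponent 0, so its smallness comes from K alone; once K
  is fixed, the rest of the circle is made small by N.\<close>

lemma phi_bound:
  assumes K: "K \<ge> 12" and e: "\<And>k. k \<ge> K \<Longrightarrow> schur_ratio k \<le> e" and K_pos: "slope K > 0"
    and a: "\<And>k. k < N \<Longrightarrow> a k = 0"
    and \<rho>: "\<rho> = exp (- (slope_incr K / (10 * 2 ^ K)))"
  shows "(\<integral>t. (cmod (\<Sum>k<n. a k * bdry_phi t ^ k))\<^sup>2 \<partial>circle_measure)
    \<le> (40 * (e + 16 / slope K) + 2 * pi * (\<rho> ^ (2 * N) / (1 - \<rho>\<^sup>2))) * (\<Sum>k<n. (cmod (a k))\<^sup>2)"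
proof -
  define c :: real where "c = 1 / 2 ^ K"
  have c: "0 < c" "c \<le> 1"
    by (auto simp: c_def)
  define E where "E = {t::real. 0 < \<bar>t\<bar> \<and> \<bar>t\<bar> \<le> c}"
  define G where "G = {t::real. c < \<bar>t\<bar> \<and> \<bar>t\<bar> < pi}"
  have Em: "E \<in> sets borel" "G \<in> sets borel"
    unfolding E_def G_def by measurable
  have E_sub: "E \<subseteq> {-pi..pi}" "G \<subseteq> {-pi..pi}"
    using c pi_gt3 by (auto simp: E_def G_def)
  have norm_le: "cmod (bdry_phi t) \<le> 1" for t
    by (simp add: norm_bdry log_mod_nonneg)
  have "(\<integral>t. (cmod (\<Sum>k<n. a k * bdry_phi t ^ k))\<^sup>2 \<partial>circle_measure)
    = (\<integral>t. (cmod (\<Sum>k<n. a k * bdry_phi t ^ k))\<^sup>2 \<partial>restrict_space lborel E)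
      + (\<integral>t. (cmod (\<Sum>k<n. a k * bdry_phi t ^ k))\<^sup>2 \<partial>restrict_space lborel G)"
  proof (rule integral_circle_split)
    show "(\<lambda>t. (cmod (\<Sum>k<n. a k * bdry_phi t ^ k))\<^sup>2) \<in> borel_measurable borel"
      by measurable
    fix t
    have "cmod (\<Sum>k<n. a k * bdry_phi t ^ k) \<le> (\<Sum>k<n. cmod (a k))"
      using norm_le[of t] by (intro order_trans[OF norm_sum] sum_mono)
        (simp add: norm_mult norm_power mult_left_le power_le_one)
    then show "\<bar>(cmod (\<Sum>k<n. a k * bdry_phi t ^ k))\<^sup>2\<bar> \<le> (\<Sum>k<n. cmod (a k))\<^sup>2"
      by (simp add: power_mono)
  next
    show "E \<union> G = {-pi<..<pi} - {0}"
      using c pi_gt3 by (auto simp: E_def G_def)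
  qed (use Em in \<open>auto simp: E_def G_def\<close>)
  also have "\<dots> \<le> 2 * (20 * (e + 16 / slope K)) * (\<Sum>k<n. (cmod (a k))\<^sup>2)
      + 2 * pi * (\<rho> ^ (2 * N) / (1 - \<rho>\<^sup>2)) * (\<Sum>k<n. (cmod (a k))\<^sup>2)"
  proof (rule add_mono)
    have "schur_ratio K \<ge> 0"
      unfolding schur_ratio_def using K_pos by (intro add_nonneg_nonneg mult_nonneg_nonneg) auto
    then have e0: "0 \<le> 20 * (e + 16 / slope K)"
      using e[of K] K_pos by (intro mult_nonneg_nonneg add_nonneg_nonneg) auto
    show "(\<integral>t. (cmod (\<Sum>k<n. a k * bdry_phi t ^ k))\<^sup>2 \<partial>restrict_space lborel E)
      \<le> 2 * (20 * (e + 16 / slope K)) * (\<Sum>k<n. (cmod (a k))\<^sup>2)"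
    proof (rule schur_test[where w = "\<lambda>t. 1 / sqrt \<bar>t\<bar>" and N = 0])
      show "finite_measure (restrict_space lborel E)"
        by (rule finite_measure_restrict_circle[OF Em(1) E_sub(1)])
      show "bdry_phi \<in> borel_measurable (restrict_space lborel E)"
        by (intro measurable_restrict_space1) simp
      show "(\<lambda>t. 1 / sqrt \<bar>t\<bar>) \<in> borel_measurable (restrict_space lborel E)"
        by (intro measurable_restrict_space1) simp
      fix t assume "t \<in> space (restrict_space lborel E)"
      then have t: "t \<in> E"
        by (simp add: space_restrict_space)
      then have "mod_phi t > 0"
        using c pi_gt3 by (intro mod_phi_pos) (auto simp: E_def)
      then show "cmod (bdry_phi t) < 1"
        by (simp add: bdry_phi_eq)
      show "0 < 1 / sqrt \<bar>t\<bar>"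
        using t by (simp add: E_def)
      show "(\<integral>\<^sup>+t'. ennreal (cmod (bdry_phi t * bdry_phi t') ^ 0 / cmod (1 - bdry_phi t * cnj (bdry_phi t')) * (1 / sqrt \<bar>t'\<bar>))
          \<partial>restrict_space lborel E) \<le> ennreal (20 * (e + 16 / slope K) * (1 / sqrt \<bar>t\<bar>))"
        by (rule schur_row_phi[OF K e K_pos _ t]) (auto simp: E_def c_def)
    qed (use e0 in auto)
    show "(\<integral>t. (cmod (\<Sum>k<n. a k * bdry_phi t ^ k))\<^sup>2 \<partial>restrict_space lborel G)
      \<le> 2 * pi * (\<rho> ^ (2 * N) / (1 - \<rho>\<^sup>2)) * (\<Sum>k<n. (cmod (a k))\<^sup>2)"
    proof (rule integral_power_sum_le_of_norm_le[OF Em(2) E_sub(2) _ _ _ a])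
      show "0 \<le> \<rho>" "\<rho> < 1"
        using slope_incr_pos[of K] by (auto simp: \<rho>)
      fix t assume "t \<in> G"
      then show "cmod (bdry_phi t) \<le> \<rho>"
        using mod_phi_ge[of K t] by (simp add: bdry_phi_eq \<rho> G_def c_def)
    qed
  qed
  also have "\<dots> = (40 * (e + 16 / slope K) + 2 * pi * (\<rho> ^ (2 * N) / (1 - \<rho>\<^sup>2))) * (\<Sum>k<n. (cmod (a k))\<^sup>2)"
    by (simp add: algebra_simps)
  finally show ?thesis .
qed

lemma phi_bound_small:
  assumes "e > 0"
  shows "\<exists>N. \<forall>a n. (\<forall>k<N. a k = 0) \<longrightarrow>
    (\<integral>t. (cmod (\<Sum>k<n. a k * bdry_phi t ^ k))\<^sup>2 \<partial>circle_measure) \<le> e * (\<Sum>k<n. (cmod (a k))\<^sup>2)"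
    and "\<exists>B\<ge>0. \<forall>a n. (\<integral>t. (cmod (\<Sum>k<n. a k * bdry_phi t ^ k))\<^sup>2 \<partial>circle_measure) \<le> 2 * pi * B * (\<Sum>k<n. (cmod (a k))\<^sup>2)"
proof -
  \<comment> \<open>The Schur part is at most 40 * (d + d), which equals e / 3.\<close>
  define d where "d = e / 240"
  have d: "d > 0"
    using assms by (simp add: d_def)
  have "\<forall>\<^sub>F k in sequentially. schur_ratio k < d"
    by (rule order_tendstoD(2)[OF schur_ratio_tendsto_0 d])
  moreover have "\<forall>\<^sub>F k in sequentially. 16 / d < slope k"
    using slope_at_top by (simp add: filterlim_at_top_dense)
  ultimately have "\<forall>\<^sub>F k in sequentially. schur_ratio k < d \<and> 16 / d < slope k"
    by (rule eventually_conj)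
  then obtain K0 where K0: "\<And>k. k \<ge> K0 \<Longrightarrow> schur_ratio k < d \<and> 16 / d < slope k"
    by (auto simp: eventually_sequentially)
  define K where "K = max 12 K0"
  have K: "K \<ge> 12" "\<And>k. k \<ge> K \<Longrightarrow> schur_ratio k \<le> d" "16 / d < slope K"
    using K0 by (auto simp: K_def less_imp_le)
  have K_pos: "slope K > 0"
    using K(3) d by (meson divide_pos_pos less_trans zero_less_numeral)
  have sl: "16 / slope K \<le> d"
    using K(3) d K_pos by (simp add: field_simps)
  define \<rho> where "\<rho> = exp (- (slope_incr K / (10 * 2 ^ K)))"
  have \<rho>: "0 < \<rho>" "\<rho> < 1"
    using slope_incr_pos[of K] by (auto simp: \<rho>_def)
  then have \<rho>2: "\<rho>\<^sup>2 < 1"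
    by (simp add: abs_square_less_1)
  have bound: "(\<integral>t. (cmod (\<Sum>k<n. a k * bdry_phi t ^ k))\<^sup>2 \<partial>circle_measure)
    \<le> (40 * (d + 16 / slope K) + 2 * pi * (\<rho> ^ (2 * N) / (1 - \<rho>\<^sup>2))) * (\<Sum>k<n. (cmod (a k))\<^sup>2)"
    if "\<And>k. k < N \<Longrightarrow> a k = 0" for N a n
    by (rule phi_bound[OF K(1) K(2) K_pos that \<rho>_def])
  have "(\<lambda>N. 2 * pi * ((\<rho>\<^sup>2) ^ N / (1 - \<rho>\<^sup>2))) \<longlonglongrightarrow> 2 * pi * (0 / (1 - \<rho>\<^sup>2))"
    using \<rho>2 by (intro tendsto_intros LIMSEQ_realpow_zero) auto
  then have "\<forall>\<^sub>F N in sequentially. 2 * pi * ((\<rho>\<^sup>2) ^ N / (1 - \<rho>\<^sup>2)) < e / 3"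
    using assms by (intro order_tendstoD) auto
  then obtain N where N: "2 * pi * (\<rho> ^ (2 * N) / (1 - \<rho>\<^sup>2)) < e / 3"
    by (auto simp: eventually_sequentially power_mult)
  have le: "40 * (d + 16 / slope K) \<le> e / 3"
    using sl by (simp add: d_def)
  have "(\<integral>t. (cmod (\<Sum>k<n. a k * bdry_phi t ^ k))\<^sup>2 \<partial>circle_measure) \<le> e * (\<Sum>k<n. (cmod (a k))\<^sup>2)"
    if a: "\<forall>k<N. a k = 0" for a n
  proof -
    have "(\<integral>t. (cmod (\<Sum>k<n. a k * bdry_phi t ^ k))\<^sup>2 \<partial>circle_measure)
        \<le> (40 * (d + 16 / slope K) + 2 * pi * (\<rho> ^ (2 * N) / (1 - \<rho>\<^sup>2))) * (\<Sum>k<n. (cmod (a k))\<^sup>2)"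
      using a by (intro bound) auto
    also have "\<dots> \<le> e * (\<Sum>k<n. (cmod (a k))\<^sup>2)"
      using le N assms by (intro mult_right_mono sum_nonneg) auto
    finally show ?thesis .
  qed
  then show "\<exists>N. \<forall>a n. (\<forall>k<N. a k = 0) \<longrightarrow>
    (\<integral>t. (cmod (\<Sum>k<n. a k * bdry_phi t ^ k))\<^sup>2 \<partial>circle_measure) \<le> e * (\<Sum>k<n. (cmod (a k))\<^sup>2)"
    by blast
  define B where "B = (40 * (d + 16 / slope K) + 2 * pi * (\<rho> ^ (2 * 0) / (1 - \<rho>\<^sup>2))) / (2 * pi)"
  have "B \<ge> 0"
    unfolding B_def using d K_pos \<rho>2 by (intro divide_nonneg_nonneg add_nonneg_nonneg mult_nonneg_nonneg) auto
  moreover have "(\<integral>t. (cmod (\<Sum>k<n. a k * bdry_phi t ^ k))\<^sup>2 \<partial>circle_measure) \<le> 2 * pi * B * (\<Sum>k<n. (cmod (a k))\<^sup>2)" for a n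
    using bound[of 0 a n] by (simp add: B_def)
  ultimately show "\<exists>B\<ge>0. \<forall>a n. (\<integral>t. (cmod (\<Sum>k<n. a k * bdry_phi t ^ k))\<^sup>2 \<partial>circle_measure) \<le> 2 * pi * B * (\<Sum>k<n. (cmod (a k))\<^sup>2)"
    by blast
qed

text \<open>The interpretation below needs a closed term for the bound, so one is fixed by
  choice.\<close>

definition bound_phi :: real where
  "bound_phi = (SOME B. B \<ge> 0 \<and> (\<forall>a n. (\<integral>t. (cmod (\<Sum>k<n. a k * bdry_phi t ^ k))\<^sup>2 \<partial>circle_measure)
     \<le> 2 * pi * B * (\<Sum>k<n. (cmod (a k))\<^sup>2)))"

interpretation phi: bounded_boundary_map symbol_phi bdry_phi bound_phi
proof -
  have "\<exists>B. B \<ge> 0 \<and> (\<forall>a n. (\<integral>t. (cmod (\<Sum>k<n. a k * bdry_phi t ^ k))\<^sup>2 \<partial>circle_measure)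
     \<le> 2 * pi * B * (\<Sum>k<n. (cmod (a k))\<^sup>2))"
    using phi_bound_small(2)[of 1] by auto
  from someI_ex[OF this]
  show "bounded_boundary_map symbol_phi bdry_phi bound_phi"
    unfolding bound_phi_def[symmetric] by unfold_locales auto
qed

lemma compact_composition_phi: "compact_operator (composition_operator symbol_phi)"
proof (rule compact_operatorI[OF phi.linear_composition_operator])
  fix e :: real assume e: "e > 0"
  then have "2 * pi * e\<^sup>2 > 0"
    by simp
  from phi_bound_small(1)[OF this] obtain N where N: "\<And>a n. (\<And>k. k < N \<Longrightarrow> a k = 0) \<Longrightarrow>
      (\<integral>t. (cmod (\<Sum>k<n. a k * bdry_phi t ^ k))\<^sup>2 \<partial>circle_measure) \<le> 2 * pi * e\<^sup>2 * (\<Sum>k<n. (cmod (a k))\<^sup>2)"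
    by blast
  have "norm (composition_operator symbol_phi f) \<le> sqrt (e\<^sup>2) * norm f" if "\<forall>k<N. hcoeff f k = 0" for f
    by (rule phi.norm_composition_le[OF _ N]) (use that in auto)
  then show "\<exists>N. \<forall>f. (\<forall>k<N. hcoeff f k = 0) \<longrightarrow> norm (composition_operator symbol_phi f) \<le> e * norm f"
    using e by auto
qed

interpretation phi: injective_compact_operator "composition_operator symbol_phi"
  by unfold_locales (use compact_composition_phi phi.composition_operator_inj[OF symbol_phi_nonconstant] in auto)


section \<open>The first operator is in no Schatten class\<close>

definition dyadic_coeff :: "nat \<Rightarrow> nat \<Rightarrow> complex" where
  "dyadic_coeff m k = (if 2 ^ m \<le> k then of_real (1 / sqrt (2 ^ m)) else 0)"

definition dyadic_block :: "nat \<Rightarrow> hardy2" where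
  "dyadic_block m = hpoly (dyadic_coeff m) (2 ^ Suc m)"

lemma hcoeff_dyadic_block:
  "hcoeff (dyadic_block m) k = (if k \<in> {2 ^ m..<2 ^ Suc m} then of_real (1 / sqrt (2 ^ m)) else 0)"
  by (auto simp: dyadic_block_def hcoeff_hpoly dyadic_coeff_def)

lemma cinner_dyadic_block: "cinner (dyadic_block m) (dyadic_block n) = (if m = n then 1 else 0)"
proof (cases "m = n")
  case True
  have "(norm (dyadic_block m))\<^sup>2 = (\<Sum>k<2 ^ Suc m. (cmod (dyadic_coeff m k))\<^sup>2)"
    unfolding dyadic_block_def by (rule norm_hpoly)
  also have "\<dots> = (\<Sum>k\<in>{2 ^ m..<2 ^ Suc m :: nat}. 1 / 2 ^ m)"
    by (rule sum.mono_neutral_cong_right) (auto simp: dyadic_coeff_def norm_divide power_divide)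
  also have "\<dots> = 1"
    by simp
  finally show ?thesis
    using True by (simp add: cinner_self)
next
  case False
  have z: "hcoeff (dyadic_block m) k * cnj (hcoeff (dyadic_block n) k) = 0" for k
  proof (rule ccontr)
    assume "\<not> ?thesis"
    then have k: "2 ^ m \<le> k" "k < 2 ^ Suc m" "2 ^ n \<le> k" "k < 2 ^ Suc n"
      by (auto simp: hcoeff_dyadic_block split: if_splits)
    then have "(2::nat) ^ m < 2 ^ Suc n" "(2::nat) ^ n < 2 ^ Suc m"
      by linarith+
    then have "m < Suc n" "n < Suc m"
      by (auto intro: power_less_imp_less_exp[of "2::nat"])
    then show False
      using False by simp
  qed
  then show ?thesis
    using False by (simp only: cinner_def z suminf_zero if_False)
qed

lemma Re_exp_ge_half:
  assumes "cmod z \<le> 1 / 4"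
  shows "1 / 2 \<le> Re (exp z)"
proof -
  have re: "\<bar>Re z\<bar> \<le> 1 / 4" and im: "\<bar>Im z\<bar> \<le> 1 / 4"
    using assms abs_Re_le_cmod[of z] abs_Im_le_cmod[of z] by linarith+
  have e: "3 / 4 \<le> exp (Re z)"
    using exp_ge_add_one_self[of "Re z"] re by linarith
  have "cos (pi / 4) \<le> cos \<bar>Im z\<bar>"
    using im pi_gt3 by (intro cos_monotone_0_pi_le) auto
  moreover have "2 / 3 \<le> sqrt 2 / (2::real)"
  proof -
    have "4 / 3 \<le> sqrt (2::real)"
      by (rule real_le_rsqrt) (simp add: power2_eq_square)
    then show ?thesis by simp
  qed
  ultimately have c: "2 / 3 \<le> cos (Im z)"
    by (simp add: cos_45)
  have "3 / 4 * (2 / 3) \<le> exp (Re z) * cos (Im z)"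
    using e c by (intro mult_mono) auto
  then show ?thesis
    by (simp add: Re_exp)
qed

text \<open>For |t| <= Y the logarithm of the symbol is at most 2^-m / 8 in modulus. All powers
  below 2^(m + 1) then have real part at least 1 / 2, so the block does not cancel and has squared
  modulus at least 2^m / 4 on an interval of length 2 Y.\<close>

lemma norm_composition_dyadic_block:
  "(norm (composition_operator symbol_phi (dyadic_block m)))\<^sup>2 \<ge> 1 / (4 * pi * 2 ^ 20 * (1 + slope m))"
proof -
  \<comment> \<open>The square root term of \<open>norm_log_symbol_le\<close> dictates 2^20: its
    root turns 32 into 1 / 32. The summand 1 is needed because \<open>slope 0\<close> is 0.\<close>
  define Y where "Y = 1 / (2 ^ 20 * 2 ^ m * (1 + slope m))"
  have S: "1 + slope m \<ge> 1"
    using slope_nonneg[of m] by simp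
  have Y0: "Y > 0"
    using S by (auto simp: Y_def)
  have "(1::real) \<le> 2 ^ 20 * 2 ^ m * (1 + slope m)"
    using mult_mono[of 1 "2 ^ 20 * 2 ^ m" 1 "1 + slope m"] S by (simp add: one_le_power order_trans[of 1 "2 ^ m"])
  then have Y1: "Y \<le> 1"
    unfolding Y_def by (subst divide_le_eq_1_pos) linarith+
  have point: "2 ^ m / 4 \<le> (cmod (\<Sum>k<2 ^ Suc m. dyadic_coeff m k * bdry_phi t ^ k))\<^sup>2" if t: "\<bar>t\<bar> \<le> Y" for t
  proof -
    define y where "y = tan (t / 2)"
    have "tan (\<bar>t\<bar> / 2) \<le> \<bar>t\<bar>" "tan (\<bar>t\<bar> / 2) \<ge> 0"
      using t Y1 pi_gt3 by (auto intro!: tan_half_le order_trans[OF _ tan_half_ge])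
    then have "\<bar>y\<bar> \<le> \<bar>t\<bar>"
      unfolding y_def by (cases "t \<ge> 0") auto
    then have y: "\<bar>y\<bar> \<le> Y"
      using t by linarith
    define w where "w = Complex (- log_mod y) (log_arg y)"
    have bw: "bdry_phi t = exp w"
      by (simp add: bdry_phi_def w_def y_def)
    have "cmod w = cmod (Complex (log_mod y) (- log_arg y))"
      by (simp add: w_def cmod_def)
    also have "\<dots> = cmod (log_symbol (- \<i> * of_real y))"
      by (simp only: log_symbol_imaginary)
    also have "\<dots> \<le> 2 * slope m * \<bar>y\<bar> + 32 * sqrt \<bar>y\<bar> * (1 / sqrt 2) ^ m"
      using norm_log_symbol_le[of "- \<i> * of_real y" m] by (simp add: norm_mult)
    also have "\<dots> \<le> 2 * slope m * Y + 32 * sqrt Y * (1 / sqrt 2) ^ m"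
      using y slope_nonneg[of m] by (intro add_mono mult_left_mono mult_right_mono real_sqrt_le_mono) auto
    also have "\<dots> \<le> 1 / (16 * 2 ^ m) + 1 / (32 * 2 ^ m)"
    proof (rule add_mono)
      have "2 * slope m * Y = 2 / 2 ^ 20 / 2 ^ m * (slope m / (1 + slope m))"
        by (simp add: Y_def)
      also have "\<dots> \<le> 2 / 2 ^ 20 / 2 ^ m * 1"
        using S by (intro mult_left_mono) auto
      also have "\<dots> \<le> 1 / (16 * 2 ^ m)"
        by (simp add: field_simps)
      finally show "2 * slope m * Y \<le> 1 / (16 * 2 ^ m)" .
      have "Y \<le> 1 / (2 ^ 20 * 2 ^ m * 1)"
        unfolding Y_def using S by (intro divide_left_mono mult_left_mono) auto
      then have "sqrt Y \<le> sqrt (1 / (2 ^ 20 * 2 ^ m))"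
        by simp
      also have "\<dots> = 1 / (2 ^ 10 * sqrt 2 ^ m)"
      proof -
        have "sqrt (2 ^ 20) = (2 ^ 10 :: real)"
          by (rule real_sqrt_unique) auto
        then show ?thesis
          by (simp add: real_sqrt_divide real_sqrt_mult real_sqrt_power)
      qed
      finally have "32 * sqrt Y * (1 / sqrt 2) ^ m \<le> 32 * (1 / (2 ^ 10 * sqrt 2 ^ m)) * (1 / sqrt 2) ^ m"
        by (intro mult_right_mono mult_left_mono) auto
      also have "\<dots> = 1 / (32 * (sqrt 2 ^ m * sqrt 2 ^ m))"
        by (simp add: power_divide)
      also have "sqrt 2 ^ m * sqrt 2 ^ m = (2::real) ^ m"
        by (simp flip: power_mult_distrib)
      finally show "32 * sqrt Y * (1 / sqrt 2) ^ m \<le> 1 / (32 * 2 ^ m)" .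
    qed
    also have "\<dots> \<le> 1 / (8 * 2 ^ m)"
      by (simp add: field_simps)
    finally have w: "cmod w \<le> 1 / (8 * 2 ^ m)" .
    have half: "1 / 2 \<le> Re (bdry_phi t ^ k)" if k: "k < 2 ^ Suc m" for k
    proof -
      have "real k \<le> 2 * 2 ^ m"
        using k by (metis less_imp_le of_nat_le_iff of_nat_numeral of_nat_power power_Suc of_nat_mult)
      then have "real k * cmod w \<le> (2 * 2 ^ m) * (1 / (8 * 2 ^ m))"
        using w by (intro mult_mono) auto
      then have "cmod (of_nat k * w) \<le> 1 / 4"
        by (simp add: norm_mult)
      from Re_exp_ge_half[OF this] show ?thesis
        by (simp add: bw exp_of_nat_mult)
    qed
    have "1 / sqrt (2 ^ m) * (2 ^ m / 2) = (\<Sum>k\<in>{2 ^ m..<2 ^ Suc m :: nat}. 1 / sqrt (2 ^ m) * (1 / 2))"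
      by simp
    also have "\<dots> \<le> (\<Sum>k\<in>{2 ^ m..<2 ^ Suc m}. 1 / sqrt (2 ^ m) * Re (bdry_phi t ^ k))"
      using half by (intro sum_mono mult_left_mono) auto
    also have "\<dots> = (\<Sum>k<2 ^ Suc m. Re (dyadic_coeff m k * bdry_phi t ^ k))"
      by (rule sum.mono_neutral_cong_left) (auto simp: dyadic_coeff_def simp flip: of_real_divide)
    also have "\<dots> = Re (\<Sum>k<2 ^ Suc m. dyadic_coeff m k * bdry_phi t ^ k)"
      by simp
    also have "\<dots> \<le> cmod (\<Sum>k<2 ^ Suc m. dyadic_coeff m k * bdry_phi t ^ k)"
      by (rule complex_Re_le_cmod)
    finally have "(1 / sqrt (2 ^ m) * (2 ^ m / 2))\<^sup>2 \<le> (cmod (\<Sum>k<2 ^ Suc m. dyadic_coeff m k * bdry_phi t ^ k))\<^sup>2"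
      by (intro power_mono) auto
    moreover have "(1 / sqrt (2 ^ m) * (2 ^ m / 2))\<^sup>2 = (2 ^ m / 4 :: real)"
      by (simp add: power_mult_distrib power_divide power2_eq_square)
    ultimately show ?thesis
      by (simp only:)
  qed
  have YI: "{-Y..Y} \<subseteq> {-pi..pi}"
    using Y1 pi_gt3 by auto
  have "2 ^ m / 4 * (2 * Y) = (\<integral>t. indicator {-Y..Y} t * (2 ^ m / 4) \<partial>lborel)"
    using Y0 by simp
  also have "\<dots> = (\<integral>t. indicator {-Y..Y} t * (2 ^ m / 4) \<partial>circle_measure)"
  proof -
    have "indicator {-pi..pi} t *\<^sub>R (indicator {-Y..Y} t * (2 ^ m / 4)) = indicator {-Y..Y} t * (2 ^ m / 4 :: real)" for t
      using YI by (cases "t \<in> {-Y..Y}") auto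
    then show ?thesis
      by (simp only: circle_measure_def integral_restrict_space sets_lborel sets.Int_space_eq2 borel_closed closed_atLeastAtMost
        atLeastAtMost_borel space_lborel Int_UNIV_right)
  qed
  also have "\<dots> \<le> (\<integral>t. (cmod (\<Sum>k<2 ^ Suc m. dyadic_coeff m k * bdry_phi t ^ k))\<^sup>2 \<partial>circle_measure)"
  proof (rule integral_mono)
    show "integrable circle_measure (\<lambda>t. indicator {-Y..Y} t * (2 ^ m / 4) :: real)"
      by (rule integrable_circle_bounded[of _ "2 ^ m / 4"])
         (auto intro!: borel_measurable_circle simp: indicator_def)
    show "integrable circle_measure (\<lambda>t. (cmod (\<Sum>k<2 ^ Suc m. dyadic_coeff m k * bdry_phi t ^ k))\<^sup>2)"
    proof (rule integrable_circle_bounded[of _ "(\<Sum>k<2 ^ Suc m. cmod (dyadic_coeff m k))\<^sup>2"])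
      show "(\<lambda>t. (cmod (\<Sum>k<2 ^ Suc m. dyadic_coeff m k * bdry_phi t ^ k))\<^sup>2) \<in> borel_measurable circle_measure"
        by (intro borel_measurable_circle) measurable
      fix t
      have "cmod (\<Sum>k<2 ^ Suc m. dyadic_coeff m k * bdry_phi t ^ k) \<le> (\<Sum>k<2 ^ Suc m. cmod (dyadic_coeff m k))"
        by (intro order_trans[OF norm_sum] sum_mono)
          (simp add: norm_mult norm_power norm_bdry mult_left_le power_le_one log_mod_nonneg)
      then show "norm ((cmod (\<Sum>k<2 ^ Suc m. dyadic_coeff m k * bdry_phi t ^ k))\<^sup>2) \<le> (\<Sum>k<2 ^ Suc m. cmod (dyadic_coeff m k))\<^sup>2"
        by (simp add: power_mono del: sum.lessThan_Suc)
    qed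
    show "indicator {-Y..Y} t * (2 ^ m / 4) \<le> (cmod (\<Sum>k<2 ^ Suc m. dyadic_coeff m k * bdry_phi t ^ k))\<^sup>2" for t
      using point[of t] by (cases "t \<in> {-Y..Y}") auto
  qed
  also have "\<dots> = 2 * pi * (norm (composition_operator symbol_phi (dyadic_block m)))\<^sup>2"
    unfolding dyadic_block_def phi.composite_hpoly by simp
  finally have "2 ^ m / 4 * (2 * Y) / (2 * pi) \<le> (norm (composition_operator symbol_phi (dyadic_block m)))\<^sup>2"
    by (simp add: field_simps)
  moreover have "2 ^ m / 4 * (2 * Y) / (2 * pi) = 1 / (4 * pi * 2 ^ 20 * (1 + slope m))"
    by (simp add: Y_def)
  ultimately show ?thesis
    by simp
qed

text \<open>A power of \<open>slope m\<close> is a power of ln m, eventually below m + 1, so the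
  series dominates the harmonic one.\<close>

lemma not_summable_inverse_slope_power:
  assumes c: "c > 0"
  shows "\<not> summable (\<lambda>m. (1 / (c * (1 + slope m))) ^ q)"
proof
  assume s: "summable (\<lambda>m. (1 / (c * (1 + slope m))) ^ q)"
  have "(\<lambda>m. (c * (1 + slope m)) ^ q / (real m + 1)) \<longlonglongrightarrow> 0"
  proof (cases "q = 0")
    case True
    then show ?thesis
      by simp real_asymp
  next
    case False
    have "(\<lambda>m. c * (1 + slope m) / (real m + 1) powr (1 / real q)) \<longlonglongrightarrow> 0"
      unfolding slope_eq using False c by real_asymp
    then have "(\<lambda>m. (c * (1 + slope m) / (real m + 1) powr (1 / real q)) ^ q) \<longlonglongrightarrow> 0 ^ q"
      by (intro tendsto_power)
    moreover have "((real m + 1) powr (1 / real q)) ^ q = real m + 1" for m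
      using False by (simp add: powr_realpow[symmetric] powr_powr)
    ultimately show ?thesis
      using False by (simp add: power_divide power_0_left)
  qed
  then have "\<forall>\<^sub>F m in sequentially. (c * (1 + slope m)) ^ q / (real m + 1) < 1"
    by (rule order_tendstoD) simp
  then have "\<forall>\<^sub>F m in sequentially. norm (1 / (real m + 1)) \<le> (1 / (c * (1 + slope m))) ^ q"
  proof eventually_elim
    case (elim m)
    have "0 < (c * (1 + slope m)) ^ q"
      using c slope_nonneg[of m] by (intro zero_less_power mult_pos_pos) auto
    then show ?case
      using elim by (simp add: power_divide frac_le)
  qed
  then have "summable (\<lambda>m. 1 / (real m + 1))"
    by (rule summable_comparison_test_ev[OF _ s])
  then have "summable (\<lambda>m. inverse (real (Suc m)))"
    by (simp add: inverse_eq_divide add.commute)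
  then have "summable (\<lambda>m. inverse (real m))"
    by (subst (asm) summable_Suc_iff)
  then show False
    using not_summable_harmonic[where 'a = real] by simp
qed

lemma composition_phi_notin_schatten: "p > 0 \<Longrightarrow> composition_operator symbol_phi \<notin> schatten_class p"
proof
  assume p: "p > 0" and mem: "composition_operator symbol_phi \<in> schatten_class p"
  obtain q :: nat where "p < real q"
    using reals_Archimedean2 by blast
  then have q: "q \<ge> 1" "p \<le> 2 * real q"
    using p by auto
  have "summable (\<lambda>m. ((norm (composition_operator symbol_phi (dyadic_block m)))\<^sup>2) ^ q)"
    by (rule phi.schatten_summable_norm_orthonormal[OF mem p q cinner_dyadic_block])
  then have "summable (\<lambda>m. (1 / (4 * pi * 2 ^ 20 * (1 + slope m))) ^ q)"
  proof (rule summable_comparison_test')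
    fix m
    have nonneg: "0 \<le> 1 / (4 * pi * 2 ^ 20 * (1 + slope m))"
      using slope_nonneg[of m] by simp
    then have "norm ((1 / (4 * pi * 2 ^ 20 * (1 + slope m))) ^ q) = (1 / (4 * pi * 2 ^ 20 * (1 + slope m))) ^ q"
      unfolding real_norm_def by (intro abs_of_nonneg zero_le_power)
    also have "\<dots> \<le> ((norm (composition_operator symbol_phi (dyadic_block m)))\<^sup>2) ^ q"
      by (rule power_mono[OF norm_composition_dyadic_block nonneg])
    finally show "norm ((1 / (4 * pi * 2 ^ 20 * (1 + slope m))) ^ q)
        \<le> ((norm (composition_operator symbol_phi (dyadic_block m)))\<^sup>2) ^ q" .
  qed
  then show False
    using not_summable_inverse_slope_power[of "4 * pi * 2 ^ 20" q] by simp
qed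


section \<open>The second operator\<close>

text \<open>This plays the role of solving f c = \<open>\<tau>\<close> and changing variables, but
  asks neither for continuity nor for a solution: c is the supremum of the points with f <=
  \<open>\<tau>\<close>, or the left end of I if there are none.\<close>

lemma expanding_anchor:
  fixes f :: "real \<Rightarrow> real"
  assumes I: "convex I" "bounded I" and m: "m > 0"
    and f: "\<And>s t. s \<in> I \<Longrightarrow> t \<in> I \<Longrightarrow> s \<le> t \<Longrightarrow> m * (t - s) \<le> f t - f s"
  shows "\<exists>c. \<forall>t\<in>I. m * \<bar>t - c\<bar> \<le> \<bar>f t - \<tau>\<bar>"
proof -
  define S where "S = {t \<in> I. f t \<le> \<tau>}"
  define c where "c = (if S = {} then Inf I else Sup S)"
  have bdd: "bdd_above S" "bdd_below I"
    using I(2) bounded_imp_bdd_above[of I] bounded_imp_bdd_below[of I]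
    by (auto simp: S_def intro: bdd_above_mono)
  have between: "s \<in> I" if "p \<in> I" "q \<in> I" "p \<le> s" "s \<le> q" for p q s
    using I(1) that mem_is_interval_1_I is_interval_convex_1 by blast
  have "m * \<bar>t - c\<bar> \<le> \<bar>f t - \<tau>\<bar>" if t: "t \<in> I" for t
  proof (cases "f t \<le> \<tau>")
    case True
    then have tS: "t \<in> S"
      using t by (simp add: S_def)
    then have c: "c = Sup S" and tc: "t \<le> c"
      using bdd by (auto simp: c_def intro: cSup_upper)
    have "m * (c - t) \<le> \<tau> - f t"
    proof (rule ccontr)
      assume "\<not> ?thesis"
      then have "t + (\<tau> - f t) / m < c"
        using m by (simp add: field_simps)
      then obtain s where s: "s \<in> S" "t + (\<tau> - f t) / m < s"
        unfolding c using tS bdd less_cSup_iff[of S] by blast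
      have "0 \<le> (\<tau> - f t) / m"
        using True m by simp
      then have ts: "t \<le> s"
        using s(2) by linarith
      then have "m * (s - t) \<le> f s - f t"
        using s(1) t by (intro f) (auto simp: S_def)
      moreover have "\<tau> - f t < m * (s - t)"
        using s(2) m by (simp add: field_simps)
      ultimately show False
        using s(1) by (simp add: S_def)
    qed
    then show ?thesis
      using tc True by (simp add: abs_if)
  next
    case False
    have tc: "c \<le> t"
    proof (cases "S = {}")
      case True
      then show ?thesis
        using t bdd by (simp add: c_def cInf_lower)
    next
      case nonempty: False
      have "s \<le> t" if "s \<in> S" for s
      proof (rule ccontr)
        assume "\<not> s \<le> t"
        then have "m * (s - t) \<le> f s - f t" "0 \<le> m * (s - t)"
          using that t m by (auto intro!: f simp: S_def)
        then show False
          using that False by (simp add: S_def)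
      qed
      then show ?thesis
        using nonempty by (simp add: c_def cSup_least)
    qed
    have "m * (t - c) \<le> f t - \<tau>"
    proof (rule ccontr)
      assume neg: "\<not> ?thesis"
      \<comment> \<open>Expansion from s to t forces f s <= \<open>\<tau>\<close>, although s lies
        beyond c.\<close>
      define s where "s = t - (f t - \<tau>) / m"
      have s: "c < s" "s \<le> t"
        using neg m False by (auto simp: s_def field_simps)
      have "\<exists>p\<in>I. p \<le> s"
      proof (cases "S = {}")
        case True
        then have "Inf I < s"
          using s(1) by (simp add: c_def)
        then show ?thesis
          using cInf_less_iff[of I s] t bdd by (auto intro: less_imp_le)
      next
        case nonempty: False
        then obtain p where p: "p \<in> S" by blast
        then have "p \<le> c"
          using bdd by (auto simp: c_def intro: cSup_upper)
        then show ?thesis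
          using p s(1) by (auto simp: S_def intro!: bexI[of _ p])
      qed
      then have sI: "s \<in> I"
        using between t s(2) by blast
      have "s \<notin> S"
        using s(1) bdd cSup_upper[of s S] by (auto simp: c_def split: if_splits)
      then have "f s > \<tau>"
        using sI by (simp add: S_def)
      moreover have "m * (t - s) \<le> f t - f s"
        using f[OF sI t s(2)] .
      moreover have "m * (t - s) = f t - \<tau>"
        using m by (simp add: s_def)
      ultimately show False
        by simp
    qed
    then show ?thesis
      using tc False by (simp add: abs_if)
  qed
  then show ?thesis
    by blast
qed

lemma nn_integral_abs_powr:
  fixes c d \<delta> :: real
  assumes \<delta>: "\<delta> > 0" and d: "d \<ge> 0"
  shows "(\<integral>\<^sup>+x. ennreal (\<bar>x - c\<bar> powr (\<delta> - 1)) * indicator {c - d..c + d} x \<partial>lborel) \<le> ennreal (2 * (d powr \<delta> / \<delta>))"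
proof -
  define g where "g x = ennreal (x powr (\<delta> - 1)) * indicator {0..d} x" for x :: real
  have [measurable]: "g \<in> borel_measurable borel"
    unfolding g_def[abs_def] by measurable
  have "((\<lambda>x. x powr (\<delta> - 1)) has_integral (d powr (\<delta> - 1 + 1) / (\<delta> - 1 + 1))) {0..d}"
    using \<delta> d by (intro has_integral_powr_from_0) auto
  then have gi: "(\<integral>\<^sup>+x. g x \<partial>lborel) = ennreal (d powr \<delta> / \<delta>)"
    unfolding g_def by (intro nn_integral_has_integral_lebesgue') auto
  have s1: "(\<integral>\<^sup>+x. g (x - c) \<partial>lborel) = (\<integral>\<^sup>+x. g x \<partial>lborel)"
    using nn_integral_real_affine[of g 1 "- c"] by simp
  have s2: "(\<integral>\<^sup>+x. g (c - x) \<partial>lborel) = (\<integral>\<^sup>+x. g x \<partial>lborel)"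
    using nn_integral_real_affine[of g "- 1" c] by simp
  have "(\<integral>\<^sup>+x. ennreal (\<bar>x - c\<bar> powr (\<delta> - 1)) * indicator {c - d..c + d} x \<partial>lborel)
      \<le> (\<integral>\<^sup>+x. g (x - c) + g (c - x) \<partial>lborel)"
    by (intro nn_integral_mono) (auto simp: g_def indicator_def abs_if)
  also have "\<dots> = (\<integral>\<^sup>+x. g (x - c) \<partial>lborel) + (\<integral>\<^sup>+x. g (c - x) \<partial>lborel)"
    by (rule nn_integral_add) measurable
  also have "\<dots> = ennreal (2 * (d powr \<delta> / \<delta>))"
    unfolding s1 s2 gi using \<delta> by (simp flip: ennreal_plus)
  finally show ?thesis .
qed

text \<open>\<open>log_mod_ge\<close> loses a factor of order k, about log x, which a power
  x^\<open>\<delta>\<close> absorbs. The minimum with 1 has the form that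
  \<open>kernel_psi_le\<close> takes.\<close>

lemma log_mod_powr_ge:
  fixes \<delta> :: real
  assumes \<delta>: "\<delta> > 0"
  shows "\<exists>c>0. \<forall>x\<ge>1. \<forall>y\<ge>1 / x. c * x powr (- (1 + \<delta>)) \<le> min (log_mod y) 1"
proof -
  have l2: "ln 2 > (0::real)" by simp
  define C where "C = 4 + 1 / (\<delta> * ln 2)"
  have C: "C \<ge> 4"
    using \<delta> l2 by (simp add: C_def)
  have "1 / (10 * C) * x powr (- (1 + \<delta>)) \<le> min (log_mod y) 1" if x: "x \<ge> 1" and y: "y \<ge> 1 / x" for x y :: real
  proof -
    define k where "k = nat \<lfloor>log 2 x\<rfloor>"
    have "log 2 x \<ge> 0"
      using x by simp
    then have k: "real k \<le> log 2 x" "log 2 x < real k + 1"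
      unfolding k_def by linarith+
    have "2 powr real k \<le> 2 powr log 2 x" "2 powr log 2 x < 2 powr (real k + 1)"
      using k by auto
    then have k2: "2 ^ k \<le> x" "x < 2 ^ Suc k"
      using x by (auto simp: powr_realpow powr_add)
    have xd: "x powr \<delta> \<ge> 1"
      using x \<delta> by (simp add: ge_one_powr_ge_zero)
    have "log 2 x \<le> x powr \<delta> / \<delta> / ln 2"
      unfolding log_def using x \<delta> l2 by (intro divide_right_mono ln_powr_bound) auto
    also have "\<dots> = 1 / (\<delta> * ln 2) * x powr \<delta>"
      by simp
    finally have "real k + 4 \<le> 1 / (\<delta> * ln 2) * x powr \<delta> + 4 * x powr \<delta>"
      using k(1) xd by linarith
    also have "\<dots> = C * x powr \<delta>"
      by (simp add: C_def algebra_simps)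
    finally have kC: "real k + 4 \<le> C * x powr \<delta>" .
    have "x powr (- (1 + \<delta>)) = 1 / (x powr \<delta> * x)"
      unfolding powr_minus_divide powr_add using x by (simp add: mult.commute)
    then have "1 / (10 * C) * x powr (- (1 + \<delta>)) = 1 / (C * x powr \<delta>) / (10 * x)"
      by simp
    also have "\<dots> \<le> 1 / (real k + 4) / (10 * 2 ^ k)"
      using kC k2(1) x by (intro frac_le divide_left_mono) (auto intro!: mult_pos_pos)
    also have "\<dots> \<le> slope_incr k / (10 * 2 ^ k)"
      by (intro divide_right_mono slope_incr_ge) auto
    also have "\<dots> \<le> log_mod y"
    proof (rule log_mod_ge)
      have "1 / 2 ^ Suc k \<le> 1 / x"
        using k2(2) x by (intro divide_left_mono) auto
      then show "1 / 2 ^ Suc k \<le> \<bar>y\<bar>"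
        using y by linarith
    qed
    finally have 1: "1 / (10 * C) * x powr (- (1 + \<delta>)) \<le> log_mod y" .
    have "x powr (- (1 + \<delta>)) \<le> 1"
      using powr_mono[of "- (1 + \<delta>)" 0 x] x \<delta> by simp
    then have "1 / (10 * C) * x powr (- (1 + \<delta>)) \<le> 1 * 1"
      using C by (intro mult_mono) auto
    with 1 show ?thesis
      by simp
  qed
  then show ?thesis
    using C by (intro exI[of _ "1 / (10 * C)"]) auto
qed

section \<open>Argument and Schur kernel of the second symbol\<close>

definition arg_psi :: "real \<Rightarrow> real" where
  "arg_psi t = arg_phi t - 1 / tan (t / 2)"

lemma measurable_arg_psi [measurable]: "arg_psi \<in> borel_measurable borel"
  unfolding arg_psi_def[abs_def] by measurable

lemma arg_psi_minus: "arg_psi (- t) = - arg_psi t"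
  by (simp add: arg_psi_def arg_phi_minus)

lemma bdry_psi_eq: "bdry_psi t = exp (Complex (- mod_phi t) (arg_psi t))"
  by (simp add: bdry_psi_def mod_phi_def arg_psi_def arg_phi_def)

lemma bdry_psi_product:
  "bdry_psi t * cnj (bdry_psi t') = exp (Complex (- (mod_phi t + mod_phi t')) (arg_psi t - arg_psi t'))"
  unfolding bdry_psi_eq exp_cnj exp_add[symmetric] by (rule arg_cong[of _ _ exp]) (simp add: complex_eq_iff)

lemma tan_half_pos: "0 < t \<Longrightarrow> t < pi \<Longrightarrow> tan (t / 2) > (0::real)"
  using tan_half_ge[of t] by simp

text \<open>The derivative of - cot (t / 2) is (1 + (cot (t / 2))^2) / 2, and the cotangent is
  smallest at the right end; the increasing \<open>arg_phi\<close> only helps. X may be negative,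
  hence the maximum with 0.\<close>

lemma arg_psi_diff_ge:
  assumes "0 < s" "s \<le> t" "t < pi" and X: "X \<le> 1 / tan (t / 2)"
  shows "(1 + (max 0 X)\<^sup>2) / 2 * (t - s) \<le> arg_psi t - arg_psi s"
proof (cases "s = t")
  case False
  then have st: "s / 2 < t / 2"
    using assms by simp
  have "\<exists>z>s / 2. z < t / 2 \<and> - cot (t / 2) - - cot (s / 2) = (t / 2 - s / 2) * inverse ((sin z)\<^sup>2)"
  proof (rule MVT2[OF st])
    fix x assume x: "s / 2 \<le> x" "x \<le> t / 2"
    have "sin x > 0"
      using x assms by (intro sin_gt_zero) auto
    then show "((\<lambda>x. - cot x) has_real_derivative inverse ((sin x)\<^sup>2)) (at x)"
      using DERIV_minus[OF DERIV_cot[of x]] by simp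
  qed
  then obtain z where z: "s / 2 < z" "z < t / 2" "cot (s / 2) - cot (t / 2) = (t / 2 - s / 2) * inverse ((sin z)\<^sup>2)"
    by auto
  have sz: "sin z > 0"
    using z assms by (intro sin_gt_zero) auto
  have tz: "0 < tan z"
    using z assms by (intro tan_gt_zero) auto
  have "tan z \<le> tan (t / 2)"
    using z assms by (intro less_imp_le tan_monotone) auto
  then have "1 / tan (t / 2) \<le> 1 / tan z"
    using tz tan_half_pos[of t] assms by (intro divide_left_mono) auto
  then have "max 0 X \<le> 1 / tan z"
    using X tz by auto
  then have "(max 0 X)\<^sup>2 \<le> (1 / tan z)\<^sup>2"
    by (intro power_mono) auto
  moreover have "1 + (1 / tan z)\<^sup>2 = inverse ((sin z)\<^sup>2)"
  proof -
    have "((sin z)\<^sup>2 + (cos z)\<^sup>2) / (sin z)\<^sup>2 = (sin z)\<^sup>2 / (sin z)\<^sup>2 + (cos z)\<^sup>2 / (sin z)\<^sup>2"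
      by (rule add_divide_distrib)
    also have "\<dots> = 1 + (1 / tan z)\<^sup>2"
      using sz by (simp add: tan_def power_divide)
    finally show ?thesis
      by (simp only: sin_cos_squared_add inverse_eq_divide)
  qed
  ultimately have "1 + (max 0 X)\<^sup>2 \<le> inverse ((sin z)\<^sup>2)"
    by linarith
  then have "(t / 2 - s / 2) * (1 + (max 0 X)\<^sup>2) \<le> cot (s / 2) - cot (t / 2)"
    unfolding z(3) using st by (intro mult_left_mono) auto
  also have "\<dots> = 1 / tan (s / 2) - 1 / tan (t / 2)"
    by (simp add: cot_def tan_def)
  also have "\<dots> \<le> arg_psi t - arg_psi s"
    using arg_phi_mono[of s t] assms by (simp add: arg_psi_def)
  finally show ?thesis
    by (simp add: field_simps)
qed simp

text \<open>From x^\<open>\<gamma>\<close> <= exp x. Writing max 1 N includes N = 0, which later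
  gives boundedness.\<close>

lemma exp_minus_le_powr:
  assumes \<gamma>: "0 \<le> \<gamma>" "\<gamma> \<le> 1" and a: "a > 0"
  shows "exp (- (real N * a)) \<le> real (max 1 N) powr (- \<gamma>) * min a 1 powr (- \<gamma>)"
proof (cases "N = 0")
  case True
  have "(1::real) \<le> min a 1 powr (- \<gamma>)"
    using \<gamma> a powr_mono2'[of "- \<gamma>" "min a 1" 1] by simp
  then show ?thesis
    using True by simp
next
  case False
  have xe: "x powr \<gamma> \<le> exp x" if x: "x > 0" for x :: real
  proof (cases "x \<le> 1")
    case True
    then have "x powr \<gamma> \<le> 1"
      using x \<gamma> by (simp add: powr_le1)
    also have "\<dots> \<le> exp x"
      using x by simp
    finally show ?thesis .
  next
    case False
    then have "x powr \<gamma> \<le> x powr 1"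
      using \<gamma> by (intro powr_mono) auto
    also have "x powr 1 = x"
      using x by simp
    also have "x \<le> exp x"
      using exp_ge_add_one_self[of x] by linarith
    finally show ?thesis .
  qed
  have N: "real N > 0"
    using False by simp
  have "exp (- (real N * a)) = 1 / exp (real N * a)"
    by (simp add: exp_minus inverse_eq_divide)
  also have "\<dots> \<le> 1 / (real N * min a 1) powr \<gamma>"
  proof (rule divide_left_mono)
    have "(real N * min a 1) powr \<gamma> \<le> (real N * a) powr \<gamma>"
      using N a \<gamma> by (intro powr_mono2 mult_left_mono) auto
    also have "\<dots> \<le> exp (real N * a)"
      using N a by (intro xe) auto
    finally show "(real N * min a 1) powr \<gamma> \<le> exp (real N * a)" .
  qed (use N a in auto)
  also have "\<dots> = real N powr (- \<gamma>) * min a 1 powr (- \<gamma>)"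
    using N a by (simp add: powr_mult powr_minus_divide)
  finally show ?thesis
    using False by (simp add: max_def)
qed

text \<open>Interpolation: the reciprocal of q is split as q^(-\<open>\<delta>\<close>) *
  q^(\<open>\<delta>\<close> - 1), with the first factor estimated by the modulus and the second by
  the argument. The power of |b| stays integrable at 0, and the exponential supplies the decay in N
  at the price of a further power of the modulus.\<close>

lemma kernel_psi_le:
  fixes \<delta> :: real
  assumes \<delta>: "0 < \<delta>" "\<delta> < 1 / 2" and a: "a > 0" and b: "b \<noteq> 0" "\<bar>b\<bar> \<le> pi"
    and c: "0 < \<mu>" "\<mu> \<le> min a 1"
  shows "exp (- (real N * a)) / cmod (1 - exp (Complex (- a) b))
    \<le> 16 * real (max 1 N) powr (- (1 - 2 * \<delta>)) * \<mu> powr (- (1 - \<delta>)) * \<bar>b\<bar> powr (\<delta> - 1)"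
proof -
  define q where "q = cmod (1 - exp (Complex (- a) b))"
  define m where "m = min a 1"
  have m: "0 < m" "m \<le> 1" "m \<le> a"
    using a by (auto simp: m_def)
  have "m / 2 \<le> 1 - exp (- m)"
    using m by (intro exp_minus_le_half) auto
  also have "\<dots> \<le> 1 - exp (- a)"
    using m by simp
  also have "\<dots> \<le> q"
    unfolding q_def using a by (intro norm_one_minus_exp_ge_mod) simp
  finally have q1: "m / 2 \<le> q" .
  have q2: "\<bar>b\<bar> / 8 \<le> q"
    unfolding q_def using a b by (intro norm_one_minus_exp_ge_arg) auto
  have q0: "q > 0"
    using q1 m by linarith
  have "q powr (- \<delta>) \<le> (m / 2) powr (- \<delta>)"
    using q1 m \<delta> by (intro powr_mono2') auto
  also have "\<dots> = 2 powr \<delta> * m powr (- \<delta>)"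
    using m by (simp add: powr_divide powr_minus_divide)
  also have "\<dots> \<le> 2 powr 1 * m powr (- \<delta>)"
    using \<delta> by (intro mult_right_mono powr_mono) auto
  finally have A: "q powr (- \<delta>) \<le> 2 * m powr (- \<delta>)"
    by simp
  have "q powr (\<delta> - 1) \<le> (\<bar>b\<bar> / 8) powr (\<delta> - 1)"
    using q2 b \<delta> by (intro powr_mono2') auto
  also have "\<dots> = 8 powr (1 - \<delta>) * \<bar>b\<bar> powr (\<delta> - 1)"
  proof -
    have "8 powr (1 - \<delta>) = 1 / 8 powr (\<delta> - 1 :: real)"
      using powr_minus_divide[of 8 "\<delta> - 1"] by simp
    then show ?thesis
      using b by (simp add: powr_divide)
  qed
  also have "\<dots> \<le> 8 powr 1 * \<bar>b\<bar> powr (\<delta> - 1)"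
    using \<delta> by (intro mult_right_mono powr_mono) auto
  finally have B: "q powr (\<delta> - 1) \<le> 8 * \<bar>b\<bar> powr (\<delta> - 1)"
    by simp
  have "1 / q = q powr (- 1)"
    using q0 by (simp add: powr_minus_divide)
  also have "\<dots> = q powr (- \<delta>) * q powr (\<delta> - 1)"
    by (subst powr_add[symmetric]) simp
  also have "\<dots> \<le> (2 * m powr (- \<delta>)) * (8 * \<bar>b\<bar> powr (\<delta> - 1))"
    by (intro mult_mono A B) auto
  finally have C: "1 / q \<le> 16 * m powr (- \<delta>) * \<bar>b\<bar> powr (\<delta> - 1)"
    by simp
  have D: "exp (- (real N * a)) \<le> real (max 1 N) powr (- (1 - 2 * \<delta>)) * m powr (- (1 - 2 * \<delta>))"
    unfolding m_def using \<delta> a by (intro exp_minus_le_powr) auto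
  have "exp (- (real N * a)) * (1 / q)
      \<le> (real (max 1 N) powr (- (1 - 2 * \<delta>)) * m powr (- (1 - 2 * \<delta>))) * (16 * m powr (- \<delta>) * \<bar>b\<bar> powr (\<delta> - 1))"
    using q0 by (intro mult_mono C D) auto
  also have "\<dots> = 16 * real (max 1 N) powr (- (1 - 2 * \<delta>)) * (m powr (- (1 - 2 * \<delta>)) * m powr (- \<delta>)) * \<bar>b\<bar> powr (\<delta> - 1)"
    by (simp add: mult_ac)
  also have "m powr (- (1 - 2 * \<delta>)) * m powr (- \<delta>) = m powr (- (1 - \<delta>))"
    by (subst powr_add[symmetric]) simp
  also have "16 * real (max 1 N) powr (- (1 - 2 * \<delta>)) * m powr (- (1 - \<delta>)) * \<bar>b\<bar> powr (\<delta> - 1)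
      \<le> 16 * real (max 1 N) powr (- (1 - 2 * \<delta>)) * \<mu> powr (- (1 - \<delta>)) * \<bar>b\<bar> powr (\<delta> - 1)"
    using c m \<delta> unfolding m_def[symmetric] by (intro mult_right_mono mult_left_mono powr_mono2') auto
  finally show ?thesis
    by (simp add: q_def)
qed

lemma exp_Complex_periodic:
  "exp (Complex a b) = exp (Complex a (b - 2 * pi * of_int n))"
proof -
  have "Complex a b = Complex a (b - 2 * pi * of_int n) + of_int n * (of_real (2 * pi) * \<i>)"
    by (simp add: complex_eq_iff)
  then show ?thesis
    using exp_integer_2pi[of "of_int n"] by (simp add: exp_add mult_ac)
qed

text \<open>On the j-th piece the modulus is at least of order j^-(1 + \<open>\<delta>\<close>) and
  enters with exponent -(1 - \<open>\<delta>\<close>), while the expansion contributes j^-2. The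
  product is of order j^-(1 + \<open>\<delta>\<close>^2), just summable.\<close>

definition row_bound :: "real \<Rightarrow> real \<Rightarrow> nat \<Rightarrow> real" where
  "row_bound \<delta> c j = 16 * (c * (2 * pi * (real j + 2)) powr (- (1 + \<delta>))) powr (- (1 - \<delta>))
     * (2 * pi / \<delta>) * (36 / (real j + 1)\<^sup>2)"

lemma summable_row_bound:
  assumes \<delta>: "0 < \<delta>" "\<delta> < 1" and c: "c > 0"
  shows "summable (row_bound \<delta> c)"
proof (rule summable_comparison_test_bigo)
  show "summable (\<lambda>j. norm (real j powr (- (1 + \<delta>\<^sup>2))))"
    using \<delta> by (simp add: summable_real_powr_iff)
  have e: "(1 + \<delta>) * (1 - \<delta>) = 1 - \<delta>\<^sup>2"
    by (simp add: power2_eq_square algebra_simps)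
  have eq: "row_bound \<delta> c j = (16 * c powr (- (1 - \<delta>)) * (2 * pi / \<delta>) * 36) * ((2 * pi * (real j + 2)) powr (1 - \<delta>\<^sup>2) / (real j + 1)\<^sup>2)" for j
  proof -
    have "(c * (2 * pi * (real j + 2)) powr (- (1 + \<delta>))) powr (- (1 - \<delta>))
        = c powr (- (1 - \<delta>)) * (2 * pi * (real j + 2)) powr (- (1 + \<delta>) * - (1 - \<delta>))"
      using c by (simp only: powr_mult powr_powr)
    also have "- (1 + \<delta>) * - (1 - \<delta>) = 1 - \<delta>\<^sup>2"
      using e by (simp only: minus_mult_minus)
    finally show ?thesis
      by (simp add: row_bound_def)
  qed
  have "(\<lambda>j. (2 * pi * (real j + 2)) powr (1 - \<delta>\<^sup>2) / (real j + 1)\<^sup>2) \<in> O(\<lambda>j. real j powr (- (1 + \<delta>\<^sup>2)))"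
    by real_asymp
  then show "row_bound \<delta> c \<in> O(\<lambda>j. real j powr (- (1 + \<delta>\<^sup>2)))"
    unfolding eq[abs_def] by (simp only: cmult_in_bigo_iff disjI2)
qed

text \<open>The half circle is cut into the pieces on which \<open>arg_psi\<close> is within \<open>\<pi>\<close> of \<open>\<tau>\<close> modulo \<open>2 \<pi>\<close>. On the \<open>j\<close>-th
  piece \<open>cot (t / 2)\<close> is about \<open>2 \<pi> j\<close>, so that \<open>arg_psi\<close> expands by a factor of order \<open>j\<^sup>2\<close>.\<close>

lemma schur_row_psi_half:
  fixes \<delta> :: real
  assumes \<delta>: "0 < \<delta>" "\<delta> < 1 / 2"
    and c: "c > 0" "\<And>x y. x \<ge> 1 \<Longrightarrow> y \<ge> 1 / x \<Longrightarrow> c * x powr (- (1 + \<delta>)) \<le> min (log_mod y) 1"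
    and a0: "a0 \<ge> 0"
  shows "(\<integral>\<^sup>+t. ennreal (exp (- (real N * (a0 + mod_phi t))) / cmod (1 - exp (Complex (- (a0 + mod_phi t)) (\<tau> - arg_psi t))))
      * indicator {0<..<pi} t \<partial>lborel)
    \<le> ennreal (real (max 1 N) powr (- (1 - 2 * \<delta>)) * (\<Sum>j. row_bound \<delta> c j))"
proof -
  \<comment> \<open>\<open>\<tau>\<close> is shifted by a multiple of 2 pi so that
    \<open>\<xi>\<close> lies in [-3 pi, - pi). As \<open>arg_psi\<close> is at most 2 pi, all
    pieces then have an index j >= 0.\<close>
  define n0 where "n0 = \<lfloor>(- \<tau> + 3 * pi) / (2 * pi)\<rfloor>"
  define \<xi> where "\<xi> = - \<tau> - 2 * pi * of_int n0"
  have "of_int n0 \<le> (- \<tau> + 3 * pi) / (2 * pi)" "(- \<tau> + 3 * pi) / (2 * pi) < of_int n0 + 1"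
    unfolding n0_def by linarith+
  then have \<xi>: "- 3 * pi \<le> \<xi>" "\<xi> < - pi"
    using pi_gt_zero by (auto simp: \<xi>_def field_simps)
  define x where "x j = \<xi> + 2 * pi * real j" for j :: nat
  define I where "I j = {t \<in> {0<..<pi}. \<bar>arg_psi t + x j\<bar> \<le> pi}" for j
  \<comment> \<open>On the j-th piece cot (t / 2) is at least x j - pi, so this is the expansion
    factor from \<open>arg_psi_diff_ge\<close>.\<close>
  define m where "m j = (1 + (max 0 (x j - pi))\<^sup>2) / 2" for j
  have m: "m j > 0" for j
    by (simp add: m_def add_pos_nonneg)
  have arg_bounds: "0 \<le> arg_phi t" "arg_phi t \<le> 2 * pi" if "t \<in> {0<..<pi}" for t
    using that log_arg_le arg_phi_nonneg[of t] by (auto simp: arg_phi_def)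
  have cot: "x j - pi \<le> 1 / tan (t / 2)" "1 / tan (t / 2) \<le> x j + 3 * pi" if "t \<in> I j" for t j
    using that arg_bounds[of t] by (auto simp: I_def arg_psi_def)
  have expand: "m j * (t - s) \<le> arg_psi t - arg_psi s" if "s \<in> I j" "t \<in> I j" "s \<le> t" for s t j
    unfolding m_def using that cot[of t j] by (intro arg_psi_diff_ge) (auto simp: I_def)
  have mono: "arg_psi s \<le> arg_psi t" if "s \<in> {0<..<pi}" "t \<in> {0<..<pi}" "s \<le> t" for s t
    using arg_psi_diff_ge[of s t 0] that tan_half_pos[of t] by auto
  have conv: "convex (I j)" for j
  proof -
    have "is_interval (I j)"
      unfolding is_interval_1
    proof (intro ballI allI impI)
      fix p q s assume pq: "p \<in> I j" "q \<in> I j" and s: "p \<le> s \<and> s \<le> q"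
      then have "arg_psi p \<le> arg_psi s" "arg_psi s \<le> arg_psi q" "s \<in> {0<..<pi}"
        by (auto intro!: mono simp: I_def)
      then show "s \<in> I j"
        using pq by (auto simp: I_def)
    qed
    then show ?thesis
      by (simp add: is_interval_convex)
  qed
  have bdd: "bounded (I j)" for j
    by (rule bounded_subset[OF bounded_closed_interval[of 0 pi]]) (auto simp: I_def)
  have "\<exists>p. \<forall>t\<in>I j. m j * \<bar>t - p\<bar> \<le> \<bar>arg_psi t - (- x j)\<bar>" for j
    by (rule expanding_anchor[OF conv bdd m expand])
  then obtain p where p: "\<And>j t. t \<in> I j \<Longrightarrow> m j * \<bar>t - p j\<bar> \<le> \<bar>arg_psi t + x j\<bar>"
    by (metis diff_minus_eq_add)
  \<comment> \<open>On the j-th piece cot (t / 2) is at most x j + 3 pi, hence at most 2 pi (j + 2);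
    \<open>log_mod_powr_ge\<close> turns this into a lower bound for the modulus.\<close>
  define \<mu> where "\<mu> j = c * (2 * pi * (real j + 2)) powr (- (1 + \<delta>))" for j
  have \<mu>: "\<mu> j > 0" for j
    using c pi_gt_zero by (simp add: \<mu>_def add_nonneg_eq_0_iff)
  have \<mu>_le: "\<mu> j \<le> min (a0 + mod_phi t) 1" if t: "t \<in> I j" for t j
  proof -
    define y where "y = tan (t / 2)"
    have y: "y > 0"
      using t tan_half_pos[of t] by (auto simp: y_def I_def)
    have "1 / y \<le> x j + 3 * pi"
      using cot(2)[OF t] by (simp add: y_def)
    also have "\<dots> \<le> 2 * pi * (real j + 2)"
      using \<xi> by (simp add: x_def algebra_simps)
    finally have y_ge: "1 / y \<le> 2 * pi * (real j + 2)" .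
    have ge1: "1 \<le> 2 * pi * (real j + 2)"
      using pi_gt3 mult_mono[of 1 "2 * pi" 1 "real j + 2"] by simp
    have "1 \<le> 2 * pi * (real j + 2) * y"
      using y_ge y by (simp only: pos_divide_le_eq)
    then have "1 / (2 * pi * (real j + 2)) \<le> y"
      using ge1 by (subst pos_divide_le_eq) (linarith, simp only: mult.commute)
    then have "\<mu> j \<le> min (log_mod y) 1"
      unfolding \<mu>_def by (intro c(2) ge1)
    then show ?thesis
      using a0 by (simp add: y_def mod_phi_def)
  qed
  define L where "L = real (max 1 N) powr (- (1 - 2 * \<delta>))"
  define w where "w j = 16 * L * \<mu> j powr (- (1 - \<delta>)) * m j powr (\<delta> - 1)" for j
  have w: "w j \<ge> 0" for j
    by (simp add: w_def L_def)
  \<comment> \<open>The majorant for the piece, extended to the interval around the anchor that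
    contains it: m j * |t - p j| is at most pi there.\<close>
  define g where "g j t = ennreal (w j) * (ennreal (\<bar>t - p j\<bar> powr (\<delta> - 1)) * indicator {p j - pi / m j..p j + pi / m j} t)" for j t
  have [measurable]: "g j \<in> borel_measurable borel" for j
    unfolding g_def[abs_def] by measurable
  let ?K = "\<lambda>t. exp (- (real N * (a0 + mod_phi t))) / cmod (1 - exp (Complex (- (a0 + mod_phi t)) (\<tau> - arg_psi t)))"
  \<comment> \<open>At an anchor the real power of 0 is 0 and the majorant breaks down, so this
    countable null set is left out.\<close>
  have point: "ennreal (?K t) * indicator {0<..<pi} t \<le> (\<Sum>j. g j t)" if neq: "\<forall>j. t \<noteq> p j" for t
  proof (cases "t \<in> {0<..<pi}")
    case t: True
    define j where "j = nat \<lfloor>(- arg_psi t - \<xi> + pi) / (2 * pi)\<rfloor>"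
    have "arg_psi t \<le> 2 * pi"
      using arg_bounds[OF t] tan_half_pos[of t] t by (auto simp: arg_psi_def intro: order_trans[of _ "arg_phi t"])
    then have "(- arg_psi t - \<xi> + pi) / (2 * pi) \<ge> 0"
      using \<xi> by (intro divide_nonneg_nonneg) auto
    then have "real j \<le> (- arg_psi t - \<xi> + pi) / (2 * pi)" "(- arg_psi t - \<xi> + pi) / (2 * pi) < real j + 1"
      unfolding j_def by linarith+
    then have "2 * pi * real j \<le> - arg_psi t - \<xi> + pi" "- arg_psi t - \<xi> + pi < 2 * pi * (real j + 1)"
      using pi_gt_zero by (simp_all add: field_simps)
    then have abs_le: "\<bar>arg_psi t + x j\<bar> \<le> pi"
      by (auto simp: x_def algebra_simps abs_if)
    then have tI: "t \<in> I j"
      using t by (simp add: I_def)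
    define b where "b = - (arg_psi t + x j)"
    have pj: "m j * \<bar>t - p j\<bar> \<le> \<bar>b\<bar>"
      using p[OF tI] by (simp add: b_def)
    have d0: "m j * \<bar>t - p j\<bar> > 0"
      using m[of j] neq by simp
    then have b: "b \<noteq> 0" "\<bar>b\<bar> \<le> pi"
      using pj abs_le by (auto simp: b_def)
    have "\<tau> - arg_psi t - 2 * pi * of_int (int j - n0) = b"
      by (simp add: b_def x_def \<xi>_def algebra_simps)
    then have "exp (Complex (- (a0 + mod_phi t)) (\<tau> - arg_psi t)) = exp (Complex (- (a0 + mod_phi t)) b)"
      using exp_Complex_periodic[of "- (a0 + mod_phi t)" "\<tau> - arg_psi t" "int j - n0"] by simp
    then have "?K t \<le> 16 * L * \<mu> j powr (- (1 - \<delta>)) * \<bar>b\<bar> powr (\<delta> - 1)"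
      unfolding L_def using \<delta> b \<mu> \<mu>_le[OF tI] a0 mod_phi_pos[of t] t
      by (simp only:) (intro kernel_psi_le, auto intro: add_nonneg_pos)
    also have "\<dots> \<le> 16 * L * \<mu> j powr (- (1 - \<delta>)) * (m j * \<bar>t - p j\<bar>) powr (\<delta> - 1)"
      using pj d0 \<delta> by (intro mult_left_mono powr_mono2') (auto simp: L_def)
    also have "\<dots> = w j * \<bar>t - p j\<bar> powr (\<delta> - 1)"
      using m[of j] by (simp add: w_def powr_mult)
    finally have "ennreal (?K t) \<le> ennreal (w j * \<bar>t - p j\<bar> powr (\<delta> - 1))"
      by (rule ennreal_leI)
    also have "\<dots> = g j t"
    proof -
      have "\<bar>t - p j\<bar> \<le> pi / m j"
        using pj b(2) m[of j] by (simp add: pos_le_divide_eq mult.commute)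
      then have "t \<in> {p j - pi / m j..p j + pi / m j}"
        by (auto simp: abs_if split: if_splits)
      then show ?thesis
        using w[of j] by (simp add: g_def ennreal_mult)
    qed
    also have "\<dots> \<le> (\<Sum>j. g j t)"
      using sum_le_suminf[of "\<lambda>j. g j t" "{j}"] by (simp add: summableI)
    finally show ?thesis
      using t by simp
  qed simp
  have "AE t in lborel. \<forall>j. t \<noteq> p j"
    by (subst AE_all_countable) (intro allI AE_lborel_singleton)
  then have "AE t in lborel. ennreal (?K t) * indicator {0<..<pi} t \<le> (\<Sum>j. g j t)"
    by eventually_elim (rule point)
  then have "(\<integral>\<^sup>+t. ennreal (?K t) * indicator {0<..<pi} t \<partial>lborel) \<le> (\<integral>\<^sup>+t. (\<Sum>j. g j t) \<partial>lborel)"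
    by (rule nn_integral_mono_AE)
  also have "\<dots> = (\<Sum>j. \<integral>\<^sup>+t. g j t \<partial>lborel)"
    by (rule nn_integral_suminf) measurable
  also have "\<dots> \<le> (\<Sum>j. ennreal (L * row_bound \<delta> c j))"
  proof (intro suminf_le summableI)
    fix j
    have "(\<integral>\<^sup>+t. g j t \<partial>lborel)
        = ennreal (w j) * (\<integral>\<^sup>+t. ennreal (\<bar>t - p j\<bar> powr (\<delta> - 1)) * indicator {p j - pi / m j..p j + pi / m j} t \<partial>lborel)"
      unfolding g_def by (rule nn_integral_cmult) measurable
    also have "\<dots> \<le> ennreal (w j) * ennreal (2 * ((pi / m j) powr \<delta> / \<delta>))"
      using \<delta> m[of j] by (intro mult_left_mono nn_integral_abs_powr) auto
    also have "\<dots> = ennreal (w j * (2 * ((pi / m j) powr \<delta> / \<delta>)))"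
      by (rule ennreal_mult[symmetric]) (use w \<delta> in auto)
    also have "\<dots> \<le> ennreal (L * row_bound \<delta> c j)"
    proof (rule ennreal_leI)
      have pd: "pi powr \<delta> \<le> pi"
        using powr_mono[of \<delta> 1 pi] \<delta> pi_gt3 by simp
      have "m j powr (\<delta> - 1) * (pi / m j) powr \<delta> = pi powr \<delta> * (m j powr (\<delta> - 1) * m j powr (- \<delta>))"
        using m[of j] by (simp add: powr_divide powr_minus_divide)
      also have "m j powr (\<delta> - 1) * m j powr (- \<delta>) = 1 / m j"
        using m[of j] by (subst powr_add[symmetric]) (simp add: powr_minus_divide)
      also have "pi powr \<delta> * (1 / m j) \<le> pi * (36 / (real j + 1)\<^sup>2)"
      proof (intro mult_mono pd)
        \<comment> \<open>The constant 36 is for small j, where x j - pi may be negative and only m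
          j >= 1 / 2 is known, against (j + 1)^2 <= 16.\<close>
        have "(real j + 1)\<^sup>2 \<le> 36 * m j"
        proof (cases "j < 4")
          case True
          then have "(real j + 1)\<^sup>2 \<le> 4\<^sup>2"
            by (intro power_mono) auto
          moreover have "18 \<le> 36 * m j"
            by (simp add: m_def)
          ultimately show ?thesis
            by simp
        next
          case False
          have "real j + 1 \<le> 2 * pi * real j - 4 * pi"
          proof -
            have "3 * (2 * real j - 4) \<le> pi * (2 * real j - 4)"
              using False pi_gt3 by (intro mult_right_mono) auto
            then show ?thesis
              using False by (simp add: algebra_simps)
          qed
          also have "\<dots> \<le> x j - pi"
            using \<xi> by (simp add: x_def)
          finally have "(real j + 1)\<^sup>2 \<le> (max 0 (x j - pi))\<^sup>2"
            by (intro power_mono) auto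
          moreover have "36 * m j = 18 + 18 * (max 0 (x j - pi))\<^sup>2"
            unfolding m_def by simp
          ultimately show ?thesis
            using zero_le_power2[of "max 0 (x j - pi)"] by linarith
        qed
        then show "1 / m j \<le> 36 / (real j + 1)\<^sup>2"
          using m[of j] by (simp add: field_simps)
      qed (use m[of j] in auto)
      finally have le: "m j powr (\<delta> - 1) * (pi / m j) powr \<delta> \<le> pi * (36 / (real j + 1)\<^sup>2)" .
      have "w j * (2 * ((pi / m j) powr \<delta> / \<delta>))
          = 16 * L * \<mu> j powr (- (1 - \<delta>)) * (2 / \<delta>) * (m j powr (\<delta> - 1) * (pi / m j) powr \<delta>)"
        by (simp add: w_def)
      also have "\<dots> \<le> 16 * L * \<mu> j powr (- (1 - \<delta>)) * (2 / \<delta>) * (pi * (36 / (real j + 1)\<^sup>2))"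
        using \<delta> by (intro mult_left_mono le) (auto simp: L_def)
      also have "\<dots> = L * row_bound \<delta> c j"
        by (simp add: row_bound_def \<mu>_def)
      finally show "w j * (2 * ((pi / m j) powr \<delta> / \<delta>)) \<le> L * row_bound \<delta> c j" .
    qed
    finally show "(\<integral>\<^sup>+t. g j t \<partial>lborel) \<le> ennreal (L * row_bound \<delta> c j)" .
  qed
  also have "\<dots> = ennreal (\<Sum>j. L * row_bound \<delta> c j)"
    using \<delta> c by (intro suminf_ennreal2 summable_mult summable_row_bound) (auto simp: L_def row_bound_def)
  also have "(\<Sum>j. L * row_bound \<delta> c j) = L * (\<Sum>j. row_bound \<delta> c j)"
    using \<delta> c by (intro suminf_mult summable_row_bound) auto
  finally show ?thesis
    by (simp add: L_def)
qed

lemma norm_one_minus_exp_minus: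
  "cmod (1 - exp (Complex a b)) = cmod (1 - exp (Complex a (- b)))"
proof -
  have "cnj (1 - exp (Complex a b)) = 1 - exp (Complex a (- b))"
    by (simp add: exp_cnj complex_cnj)
  then show ?thesis
    by (metis complex_mod_cnj)
qed

text \<open>The row integrals are bounded uniformly in t and \<open>\<tau>\<close>, so the constant
  weight 1 works. The lower half circle is folded onto the upper one: \<open>arg_psi\<close> is odd,
  and conjugation turns the row for \<open>arg_psi t\<close> into that for -
  \<open>arg_psi t\<close>.\<close>

lemma psi_bound:
  fixes \<delta> :: real
  assumes \<delta>: "0 < \<delta>" "\<delta> < 1 / 2"
  shows "\<exists>C\<ge>0. \<forall>N a n. (\<forall>k<N. a k = 0) \<longrightarrow> (\<integral>t. (cmod (\<Sum>k<n. a k * bdry_psi t ^ k))\<^sup>2 \<partial>circle_measure)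
    \<le> 2 * pi * (C * real (max 1 N) powr (- (1 - 2 * \<delta>))) * (\<Sum>k<n. (cmod (a k))\<^sup>2)"
proof -
  obtain c where c: "c > 0" "\<And>x y. x \<ge> 1 \<Longrightarrow> y \<ge> 1 / x \<Longrightarrow> c * x powr (- (1 + \<delta>)) \<le> min (log_mod y) 1"
    using log_mod_powr_ge[OF \<delta>(1)] by blast
  define R where "R = (\<Sum>j. row_bound \<delta> c j)"
  have R: "R \<ge> 0"
    unfolding R_def using \<delta> c by (intro suminf_nonneg summable_row_bound) (auto simp: row_bound_def)
  define A where "A = {-pi<..<pi} - {0::real}"
  have A: "A \<in> sets borel" "A \<subseteq> {-pi..pi}"
    by (auto simp: A_def)
  have bound: "(\<integral>t. (cmod (\<Sum>k<n. a k * bdry_psi t ^ k))\<^sup>2 \<partial>circle_measure)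
      \<le> 2 * (2 * (real (max 1 N) powr (- (1 - 2 * \<delta>)) * R)) * (\<Sum>k<n. (cmod (a k))\<^sup>2)"
    if a: "\<forall>k<N. a k = 0" for N a n
  proof -
    define L where "L = real (max 1 N) powr (- (1 - 2 * \<delta>)) * R"
    have L: "L \<ge> 0"
      using R by (simp add: L_def)
    have norm_le: "cmod (bdry_psi t) \<le> 1" for t
      by (simp add: norm_bdry log_mod_nonneg)
    \<comment> \<open>Splitting with an empty second part removes the points - pi, 0 and pi, so that
      the strict inequality in \<open>schur_test\<close> holds everywhere on A.\<close>
    have "(\<integral>t. (cmod (\<Sum>k<n. a k * bdry_psi t ^ k))\<^sup>2 \<partial>circle_measure)
      = (\<integral>t. (cmod (\<Sum>k<n. a k * bdry_psi t ^ k))\<^sup>2 \<partial>restrict_space lborel A)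
        + (\<integral>t. (cmod (\<Sum>k<n. a k * bdry_psi t ^ k))\<^sup>2 \<partial>restrict_space lborel {})"
    proof (rule integral_circle_split)
      show "(\<lambda>t. (cmod (\<Sum>k<n. a k * bdry_psi t ^ k))\<^sup>2) \<in> borel_measurable borel"
        by measurable
      fix t
      have "cmod (\<Sum>k<n. a k * bdry_psi t ^ k) \<le> (\<Sum>k<n. cmod (a k))"
        using norm_le[of t] by (intro order_trans[OF norm_sum] sum_mono)
          (simp add: norm_mult norm_power mult_left_le power_le_one)
      then show "\<bar>(cmod (\<Sum>k<n. a k * bdry_psi t ^ k))\<^sup>2\<bar> \<le> (\<Sum>k<n. cmod (a k))\<^sup>2"
        by (simp add: power_mono)
    qed (use A in \<open>auto simp: A_def\<close>)
    also have "(\<integral>t. (cmod (\<Sum>k<n. a k * bdry_psi t ^ k))\<^sup>2 \<partial>restrict_space lborel {}) = 0"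
      by (subst integral_restrict_space) auto
    also have "(\<integral>t. (cmod (\<Sum>k<n. a k * bdry_psi t ^ k))\<^sup>2 \<partial>restrict_space lborel A) + 0
        \<le> 2 * (2 * L) * (\<Sum>k<n. (cmod (a k))\<^sup>2)"
      unfolding add_0_right
    proof (rule schur_test[where w = "\<lambda>_. 1" and N = N])
      show "finite_measure (restrict_space lborel A)"
        by (rule finite_measure_restrict_circle[OF A])
      show "bdry_psi \<in> borel_measurable (restrict_space lborel A)"
        by (intro measurable_restrict_space1) simp
      fix t assume "t \<in> space (restrict_space lborel A)"
      then have t: "t \<in> A"
        by (simp add: space_restrict_space)
      then have "mod_phi t > 0"
        by (intro mod_phi_pos) (auto simp: A_def)
      then show "cmod (bdry_psi t) < 1"
        by (simp add: bdry_psi_eq)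
      let ?K = "\<lambda>\<tau> s. ennreal (exp (- (real N * (mod_phi t + mod_phi s)))
          / cmod (1 - exp (Complex (- (mod_phi t + mod_phi s)) (\<tau> - arg_psi s)))) * indicator {0<..<pi} s"
      have Km: "(\<lambda>s. ?K \<tau> s) \<in> borel_measurable borel" for \<tau>
      proof -
        have [measurable]: "(\<lambda>s. exp (Complex (- (mod_phi t + mod_phi s)) (\<tau> - arg_psi s))) \<in> borel_measurable borel"
          by (rule measurable_exp_Complex) measurable
        show ?thesis
          by measurable
      qed
      have row: "(\<integral>\<^sup>+s. ?K \<tau> s \<partial>lborel) \<le> ennreal L" for \<tau>
        unfolding L_def R_def by (rule schur_row_psi_half[OF \<delta> c mod_phi_nonneg])
      have "(\<integral>\<^sup>+t'. ennreal (cmod (bdry_psi t * bdry_psi t') ^ N / cmod (1 - bdry_psi t * cnj (bdry_psi t')) * 1) \<partial>restrict_space lborel A)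
          = (\<integral>\<^sup>+t'. ennreal (cmod (bdry_psi t * bdry_psi t') ^ N / cmod (1 - bdry_psi t * cnj (bdry_psi t'))) * indicator A t' \<partial>lborel)"
        using A by (subst nn_integral_restrict_space) auto
      also have "\<dots> \<le> (\<integral>\<^sup>+t'. ?K (arg_psi t) t' + ?K (- arg_psi t) (- t') \<partial>lborel)"
      proof (rule nn_integral_mono)
        fix t'
        have num: "cmod (bdry_psi t * bdry_psi t') ^ N = exp (- (real N * (mod_phi t + mod_phi t')))"
          by (simp add: bdry_psi_eq norm_mult exp_add[symmetric] exp_of_nat_mult[symmetric] algebra_simps)
        show "ennreal (cmod (bdry_psi t * bdry_psi t') ^ N / cmod (1 - bdry_psi t * cnj (bdry_psi t'))) * indicator A t'
            \<le> ?K (arg_psi t) t' + ?K (- arg_psi t) (- t')"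
        proof (cases "t' \<in> A")
          case True
          then consider "t' \<in> {0<..<pi}" | "- t' \<in> {0<..<pi}"
            unfolding A_def by fastforce
          then show ?thesis
          proof cases
            case 1
            then show ?thesis
              using True by (simp add: num bdry_psi_product)
          next
            case 2
            have "cmod (1 - bdry_psi t * cnj (bdry_psi t'))
                = cmod (1 - exp (Complex (- (mod_phi t + mod_phi t')) (- arg_psi t - arg_psi (- t'))))"
              unfolding bdry_psi_product arg_psi_minus by (subst norm_one_minus_exp_minus) simp
            then show ?thesis
              using True 2 by (simp add: num mod_phi_minus)
          qed
        qed simp
      qed
      also have "\<dots> = (\<integral>\<^sup>+t'. ?K (arg_psi t) t' \<partial>lborel) + (\<integral>\<^sup>+t'. ?K (- arg_psi t) (- t') \<partial>lborel)"
        using Km by (intro nn_integral_add) (auto intro: measurable_compose[OF borel_measurable_uminus[OF measurable_ident]])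
      also have "(\<integral>\<^sup>+t'. ?K (- arg_psi t) (- t') \<partial>lborel) = (\<integral>\<^sup>+t'. ?K (- arg_psi t) t' \<partial>lborel)"
        by (rule nn_integral_reflect[OF Km])
      also have "(\<integral>\<^sup>+t'. ?K (arg_psi t) t' \<partial>lborel) + \<dots> \<le> ennreal L + ennreal L"
        by (intro add_mono row)
      also have "\<dots> = ennreal (2 * L * 1)"
        using L by (simp flip: ennreal_plus)
      finally show "(\<integral>\<^sup>+t'. ennreal (cmod (bdry_psi t * bdry_psi t') ^ N / cmod (1 - bdry_psi t * cnj (bdry_psi t')) * 1)
          \<partial>restrict_space lborel A) \<le> ennreal (2 * L * 1)" .
    qed (use a L in auto)
    finally show ?thesis
      by (simp add: L_def)
  qed
  show ?thesis
  proof (intro exI[of _ "2 * R / pi"] conjI allI impI)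
    show "2 * R / pi \<ge> 0"
      using R by simp
    show "(\<integral>t. (cmod (\<Sum>k<n. a k * bdry_psi t ^ k))\<^sup>2 \<partial>circle_measure)
        \<le> 2 * pi * (2 * R / pi * real (max 1 N) powr (- (1 - 2 * \<delta>))) * (\<Sum>k<n. (cmod (a k))\<^sup>2)"
      if "\<forall>k<N. a k = 0" for N a n
    proof -
      have "2 * pi * (2 * R / pi * real (max 1 N) powr (- (1 - 2 * \<delta>))) = 2 * (2 * (real (max 1 N) powr (- (1 - 2 * \<delta>)) * R))"
        by simp
      then show ?thesis
        using bound[OF that, of n] by (simp only:)
    qed
  qed
qed

section \<open>Compactness and Schatten membership of the second operator\<close>

definition bound_psi :: real where
  "bound_psi = (SOME B. B \<ge> 0 \<and> (\<forall>a n. (\<integral>t. (cmod (\<Sum>k<n. a k * bdry_psi t ^ k))\<^sup>2 \<partial>circle_measure)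
     \<le> 2 * pi * B * (\<Sum>k<n. (cmod (a k))\<^sup>2)))"

interpretation psi: bounded_boundary_map symbol_psi bdry_psi bound_psi
proof -
  obtain C where C: "C \<ge> 0" "\<And>N a n. (\<forall>k<N. a k = 0) \<Longrightarrow> (\<integral>t. (cmod (\<Sum>k<n. a k * bdry_psi t ^ k))\<^sup>2 \<partial>circle_measure)
    \<le> 2 * pi * (C * real (max 1 N) powr (- (1 - 2 * (1 / 4)))) * (\<Sum>k<n. (cmod (a k))\<^sup>2)"
    using psi_bound[of "1 / 4"] by auto
  have "C \<ge> 0 \<and> (\<forall>a n. (\<integral>t. (cmod (\<Sum>k<n. a k * bdry_psi t ^ k))\<^sup>2 \<partial>circle_measure)
     \<le> 2 * pi * C * (\<Sum>k<n. (cmod (a k))\<^sup>2))"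
    using C(1) C(2)[of 0] by simp
  from someI[of "\<lambda>B. B \<ge> 0 \<and> (\<forall>a n. (\<integral>t. (cmod (\<Sum>k<n. a k * bdry_psi t ^ k))\<^sup>2 \<partial>circle_measure)
     \<le> 2 * pi * B * (\<Sum>k<n. (cmod (a k))\<^sup>2))", OF this]
  show "bounded_boundary_map symbol_psi bdry_psi bound_psi"
    unfolding bound_psi_def[symmetric] by unfold_locales auto
qed

lemma norm_composition_psi_le:
  assumes "0 < \<delta>" "\<delta> < 1 / 2"
  shows "\<exists>C\<ge>0. \<forall>N f. (\<forall>k<N. hcoeff f k = 0) \<longrightarrow>
    norm (composition_operator symbol_psi f) \<le> sqrt (C * real (max 1 N) powr (- (1 - 2 * \<delta>))) * norm f"
proof -
  obtain C where C: "C \<ge> 0" "\<And>N a n. (\<forall>k<N. a k = 0) \<Longrightarrow> (\<integral>t. (cmod (\<Sum>k<n. a k * bdry_psi t ^ k))\<^sup>2 \<partial>circle_measure)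
    \<le> 2 * pi * (C * real (max 1 N) powr (- (1 - 2 * \<delta>))) * (\<Sum>k<n. (cmod (a k))\<^sup>2)"
    using psi_bound[OF assms] by blast
  have "norm (composition_operator symbol_psi f) \<le> sqrt (C * real (max 1 N) powr (- (1 - 2 * \<delta>))) * norm f"
    if "\<forall>k<N. hcoeff f k = 0" for N f
  proof (rule psi.norm_composition_le)
    show "C * real (max 1 N) powr (- (1 - 2 * \<delta>)) \<ge> 0"
      using C(1) by simp
    show "(\<integral>t. (cmod (\<Sum>k<n. a k * bdry_psi t ^ k))\<^sup>2 \<partial>circle_measure)
        \<le> 2 * pi * (C * real (max 1 N) powr (- (1 - 2 * \<delta>))) * (\<Sum>k<n. (cmod (a k))\<^sup>2)"
      if "\<And>k. k < N \<Longrightarrow> a k = 0" for a n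
      using that by (intro C(2)) auto
    show "hcoeff f k = 0" if "k < N" for k
      using that \<open>\<forall>k<N. hcoeff f k = 0\<close> by simp
  qed
  then show ?thesis
    using C(1) by blast
qed

lemma compact_composition_psi: "compact_operator (composition_operator symbol_psi)"
proof (rule compact_operatorI[OF psi.linear_composition_operator])
  fix e :: real assume e: "e > 0"
  obtain C where C: "\<And>N f. (\<forall>k<N. hcoeff f k = 0) \<Longrightarrow>
    norm (composition_operator symbol_psi f) \<le> sqrt (C * real (max 1 N) powr (- (1 - 2 * (1 / 4)))) * norm f"
    using norm_composition_psi_le[of "1 / 4"] by auto
  have "(\<lambda>N. sqrt (C * real N powr (- 1 / 2))) \<longlonglongrightarrow> sqrt (C * 0)"
    by (intro tendsto_intros) real_asymp
  then have "\<forall>\<^sub>F N in sequentially. sqrt (C * real N powr (- 1 / 2)) < e"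
    using e by (intro order_tendstoD) auto
  then have "\<forall>\<^sub>F N in sequentially. sqrt (C * real N powr (- 1 / 2)) < e \<and> N \<ge> 1"
    using eventually_ge_at_top[of "1::nat"] by (rule eventually_conj)
  then obtain N where N: "sqrt (C * real N powr (- 1 / 2)) < e" "N \<ge> 1"
    by (auto simp: eventually_sequentially)
  then have N': "sqrt (C * real (max 1 N) powr (- (1 - 2 * (1 / 4)))) \<le> e"
    by (simp add: max_def)
  have "norm (composition_operator symbol_psi f) \<le> e * norm f" if "\<forall>k<N. hcoeff f k = 0" for f
    using C[OF that] mult_right_mono[OF N' norm_ge_zero[of f]] by linarith
  then show "\<exists>N. \<forall>f. (\<forall>k<N. hcoeff f k = 0) \<longrightarrow> norm (composition_operator symbol_psi f) \<le> e * norm f"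
    by blast
qed

interpretation psi: injective_compact_operator "composition_operator symbol_psi"
  by unfold_locales (use compact_composition_psi psi.composition_operator_inj[OF symbol_psi_nonconstant] in auto)

lemma composition_psi_in_schatten:
  assumes p: "p > 2"
  shows "composition_operator symbol_psi \<in> schatten_class p"
proof -
  \<comment> \<open>This makes \<open>\<gamma>\<close> equal to 1 / 2 + 1 / p, so that
    \<open>\<gamma> * (p / 2)\<close> is p / 4 + 1 / 2, which exceeds 1 exactly for p > 2.\<close>
  define \<delta> where "\<delta> = (1 - 2 / p) / 4"
  have \<delta>: "0 < \<delta>" "\<delta> < 1 / 2"
    using p by (auto simp: \<delta>_def field_simps)
  define \<gamma> where "\<gamma> = 1 - 2 * \<delta>"
  have \<gamma>: "\<gamma> * (p / 2) > 1"
    using p by (simp add: \<gamma>_def \<delta>_def field_simps)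
  obtain C where C: "C \<ge> 0" "\<And>N f. (\<forall>k<N. hcoeff f k = 0) \<Longrightarrow>
    norm (composition_operator symbol_psi f) \<le> sqrt (C * real (max 1 N) powr (- \<gamma>)) * norm f"
    using norm_composition_psi_le[OF \<delta>] unfolding \<gamma>_def by blast
  let ?s = "singular_numbers (composition_operator symbol_psi)"
  have s_le: "?s N \<le> sqrt (C * real (max 1 N) powr (- \<gamma>))" for N
    by (rule psi.singular_number_le) (use C(2) in auto)
  have s_ge: "?s N > 0" for N
    unfolding psi.singular_numbers_eq by (rule psi.sing_pos)
  have "summable (\<lambda>N. ?s N powr p)"
  proof (rule summable_comparison_test_ev)
    show "summable (\<lambda>N. C powr (p / 2) * real N powr (- \<gamma> * (p / 2)))"
      using \<gamma> by (intro summable_mult) (simp add: summable_real_powr_iff)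
    show "\<forall>\<^sub>F N in sequentially. norm (?s N powr p) \<le> C powr (p / 2) * real N powr (- \<gamma> * (p / 2))"
      using eventually_ge_at_top[of "1::nat"]
    proof eventually_elim
      case (elim N)
      have "?s N powr p \<le> sqrt (C * real (max 1 N) powr (- \<gamma>)) powr p"
        using s_le[of N] s_ge[of N] p by (intro powr_mono2) auto
      also have "\<dots> = (C * real N powr (- \<gamma>)) powr (p / 2)"
        using elim C(1) by (simp add: max_def powr_half_sqrt[symmetric] powr_powr)
      also have "\<dots> = C powr (p / 2) * real N powr (- \<gamma> * (p / 2))"
        using C(1) by (simp add: powr_mult powr_powr)
      finally show ?case
        by simp
    qed
  qed
  then show ?thesis
    using compact_composition_psi by (simp add: schatten_class_def)
qed

theorem theorem5p7:
  "\<exists>\<phi> \<psi>. symbol \<phi> \<and> symbol \<psi> \<and>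
     ae_circle (\<lambda>\<zeta>. cmod (radial_limit \<phi> \<zeta>) = cmod (radial_limit \<psi> \<zeta>)) \<and>
     compact_operator (composition_operator \<phi>) \<and>
     (\<forall>p>0. composition_operator \<phi> \<notin> schatten_class p) \<and>
     (\<forall>p>2. composition_operator \<psi> \<in> schatten_class p)"
  using symbol_symbol_phi symbol_symbol_psi same_modulus compact_composition_phi
    composition_phi_notin_schatten composition_psi_in_schatten
  by blast

end
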